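(* Let $N\ge 1$ be an integer, and let $\mathbf c$ be a rectifiable and open curve in $\mathbb R^{N+1}$, parameterized in arc-length by $\mathbf c:[0,L]\to\mathbb R^{N+1}$, where $L=\mathcal L(\mathbf c)$ is its length, and let $I_L=(0,L)$. Then for every exponent $p>1$ $$\mathcal F_p(\mathbf c)<\infty\iff \mathbf c\in W^{2,p}(I_L,\mathbb R^{N+1}),$$ and in that case $$\mathcal F_p(\mathbf c)=\int_0^L\|\ddot{\mathbf c}(s)\|^p\,ds .$$
   Context: Inscribed polygonals and modulus. A polygonal $P$ is inscribed in the curve $\mathbf c:[0,L]\to\mathbb R^{N+1}$, written $P\ll\mathbf c$, if there is a finite partition $0=t_0<t_1<\dots<t_n=L$ such that $P$ is the polygonal with consecutive vertices $\mathbf c(t_0),\mathbf c(t_1),\dots,\mathbf c(t_n)$. The modulus $\mu_{\mathbf c}(P)$ is the maximum of the diameters of the arcs of $\mathbf c$ determined by consecutive vertices of $P$. Notation $\{P_h\}\ll\mathbf c$ means that $\{P_h\}$ is a sequence of polygonals each inscribed in $\mathbf c$. $p$-rotation. Let $P$ be an open polygonal given by $n$ non-degenerate consecutive segments $\mathbf v_1,\dots,\mathbf v_n$ of lengths $\ell_i>0$, with $v_i$ the common vertex of $\mathbf v_i$ and $\mathbf v_{i+1}$, and turning (exterior) angle $\theta_i=\arccos\big(\frac{\mathbf v_i\bullet\mathbf v_{i+1}}{\ell_i\ell_{i+1}}\big)\in[0,\pi]$ at $v_i$, $i=1,\dots,n-1$. Suppose first that all $\theta_i<\pi$. Let $r_i=\min\{\ell_i,\ell_{i+1}\}$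 and let $t_i^-\in\mathbf v_i$, $t_i^+\in\mathbf v_{i+1}$ be the points at distance $r_i/2$ from $v_i$. If $\theta_i>0$ let $\gamma_i$ be the oriented circular arc from $t_i^-$ to $t_i^+$ tangent to $\mathbf v_i$ at $t_i^-$ and to $\mathbf v_{i+1}$ at $t_i^+$ (radius $(r_i/2)/\tan(\theta_i/2)$, total angle $\theta_i$); if $\theta_i=0$ let $\gamma_i$ be the segment from $t_i^-$ to $t_i^+$. Let $\gamma(P)$ be the curve that runs consecutively through $\gamma_1$, the segment from $t_1^+$ to $t_2^-$, $\gamma_2$, the segment from $t_2^+$ to $t_3^-$, ..., $\gamma_{n-1}$. For $p\ge1$ the $p$-rotation of $P$ is the integral over $\gamma(P)$, in arc-length, of the $p$-th power of its scalar curvature, i.e. $$\mathbf k_p(P)=\sum_{i=1}^{n-1}\theta_i\Big(\frac{\tan(\theta_i/2)}{r_i/2}\Big)^{p-1}.$$ If some turning angle of $P$ equals $\pi$, one sets $\mathbf k_p(P)=+\infty$ for each $p>1$. $p$-curvature. For a rectifiable curve $\mathbf c$, $$\mathcal F_p(\mathbf c):=\inf\Big\{\liminf_{h\to\infty}\mathbf k_p(P_h)\ \Big|\ \{P_h\}\ll\mathbf c,\ \mu_{\mathbf c}(P_h)\to0\Big\}.$$ *)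

theory Defs
  imports "HOL-Analysis.Analysis"
begin

section \<open>Curves, length and arc-length parameterization\<close>

text \<open>A partition \<open>a = t\<^sub>0 < t\<^sub>1 < \<dots> < t\<^sub>n = b\<close> is encoded as the list \<open>[t\<^sub>0, \<dots>, t\<^sub>n]\<close>.\<close>

definition is_partition :: "real \<Rightarrow> real \<Rightarrow> real list \<Rightarrow> bool" where
  "is_partition a b t \<longleftrightarrow> t \<noteq> [] \<and> sorted_wrt (<) t \<and> hd t = a \<and> last t = b"

definition curve_length :: "(real \<Rightarrow> 'a::metric_space) \<Rightarrow> real \<Rightarrow> real \<Rightarrow> ennreal" where
  "curve_length c a b =
     (SUP t \<in> Collect (is_partition a b). \<Sum>i = 1..<length t. ennreal (dist (c (t ! (i - 1))) (c (t ! i))))"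

text \<open>Taking \<open>a = 0\<close> and \<open>b = L\<close> shows that \<open>L\<close> is the length of the curve; in particular the
  curve is rectifiable.\<close>

definition arclength_curve :: "real \<Rightarrow> (real \<Rightarrow> 'a::metric_space) \<Rightarrow> bool" where
  "arclength_curve L c \<longleftrightarrow> continuous_on {0..L} c \<and>
     (\<forall>a b. 0 \<le> a \<and> a \<le> b \<and> b \<le> L \<longrightarrow> curve_length c a b = ennreal (b - a))"


section \<open>Polygonals and \<open>p\<close>-rotation\<close>

text \<open>A polygonal is given by the list of its consecutive vertices. With \<open>n + 1\<close> vertices
  \<open>P ! 0, \<dots>, P ! n\<close>, the segments are \<open>edge P 1, \<dots>, edge P n\<close> and the interior vertices, where the
  turning angles live, are \<open>P ! 1, \<dots>, P ! (n - 1)\<close>.\<close>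

definition edge :: "'a::real_inner list \<Rightarrow> nat \<Rightarrow> 'a" where
  "edge P i = P ! i - P ! (i - 1)"

definition polygonal :: "'a::real_inner list \<Rightarrow> bool" where
  "polygonal P \<longleftrightarrow> 2 \<le> length P \<and> (\<forall>i\<in>{1..<length P}. edge P i \<noteq> 0)"

definition turning_angle :: "'a::real_inner list \<Rightarrow> nat \<Rightarrow> real" where
  "turning_angle P i =
     arccos (edge P i \<bullet> edge P (Suc i) / (norm (edge P i) * norm (edge P (Suc i))))"

definition min_edge :: "'a::real_inner list \<Rightarrow> nat \<Rightarrow> real" where
  "min_edge P i = min (norm (edge P i)) (norm (edge P (Suc i)))"

text \<open>The \<open>p\<close>-rotation, for \<open>p > 1\<close>. The \<open>i\<close>-th summand is the integral of the \<open>p\<close>-th power of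
  the curvature over the circular arc of radius \<open>(r\<^sub>i / 2) / tan (\<theta>\<^sub>i / 2)\<close> and angle \<open>\<theta>\<^sub>i\<close> that
  rounds off the \<open>i\<close>-th corner (and is \<open>0\<close> if \<open>\<theta>\<^sub>i = 0\<close>). Turning angles equal to \<open>pi\<close> need a separate
  case, all the more since \<open>tan (pi / 2) = 0\<close> in HOL.\<close>

definition p_rotation :: "real \<Rightarrow> 'a::real_inner list \<Rightarrow> ennreal" where
  "p_rotation p P =
     (if \<exists>i\<in>{1..<length P - 1}. turning_angle P i = pi then \<infinity>
      else ennreal (\<Sum>i = 1..<length P - 1.
        turning_angle P i * (tan (turning_angle P i / 2) / (min_edge P i / 2)) powr (p - 1)))"


section \<open>Inscribed polygonals, modulus and \<open>p\<close>-curvature\<close>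

text \<open>The partition is kept as an argument since the modulus depends on it, not only on the
  vertices.\<close>

definition inscribed :: "real \<Rightarrow> (real \<Rightarrow> 'a::real_inner) \<Rightarrow> real list \<Rightarrow> 'a list \<Rightarrow> bool" where
  "inscribed L c t P \<longleftrightarrow> is_partition 0 L t \<and> P = map c t \<and> polygonal P"

definition modulus :: "(real \<Rightarrow> 'a::metric_space) \<Rightarrow> real list \<Rightarrow> real" where
  "modulus c t = Max ((\<lambda>i. diameter (c ` {t ! (i - 1)..t ! i})) ` {1..<length t})"

definition p_curvature :: "real \<Rightarrow> real \<Rightarrow> (real \<Rightarrow> 'a::real_inner) \<Rightarrow> ennreal" where
  "p_curvature p L c =
     Inf {liminf (\<lambda>h. p_rotation p (P h)) | P t.
            (\<forall>h. inscribed L c (t h) (P h)) \<and> (\<lambda>h. modulus c (t h)) \<longlonglongrightarrow> 0}"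


section \<open>Sobolev spaces on open subsets of the real line\<close>

definition test_function :: "real set \<Rightarrow> (real \<Rightarrow> real) \<Rightarrow> bool" where
  "test_function S \<phi> \<longleftrightarrow>
     (\<forall>k x. (deriv ^^ k) \<phi> field_differentiable at x) \<and>
     compact (closure {x. \<phi> x \<noteq> 0}) \<and> closure {x. \<phi> x \<noteq> 0} \<subseteq> S"

definition locally_integrable_on :: "(real \<Rightarrow> 'a::euclidean_space) \<Rightarrow> real set \<Rightarrow> bool"
    (infix \<open>locally'_integrable'_on\<close> 50) where
  "f locally_integrable_on S \<longleftrightarrow> (\<forall>K. compact K \<and> K \<subseteq> S \<longrightarrow> f absolutely_integrable_on K)"

definition has_weak_derivative ::
    "real set \<Rightarrow> nat \<Rightarrow> (real \<Rightarrow> 'a::euclidean_space) \<Rightarrow> (real \<Rightarrow> 'a) \<Rightarrow> bool" where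
  "has_weak_derivative S k f g \<longleftrightarrow>
     f locally_integrable_on S \<and> g locally_integrable_on S \<and>
     (\<forall>\<phi>. test_function S \<phi> \<longrightarrow>
        (LINT x:S|lebesgue. (deriv ^^ k) \<phi> x *\<^sub>R f x) =
        (-1) ^ k *\<^sub>R (LINT x:S|lebesgue. \<phi> x *\<^sub>R g x))"

definition Lp_on :: "real \<Rightarrow> real set \<Rightarrow> (real \<Rightarrow> 'a::euclidean_space) set" where
  "Lp_on p S = {f. set_borel_measurable lebesgue S f \<and>
                   set_integrable lebesgue S (\<lambda>x. norm (f x) powr p)}"

definition sobolev :: "nat \<Rightarrow> real \<Rightarrow> real set \<Rightarrow> (real \<Rightarrow> 'a::euclidean_space) set" where
  "sobolev k p S =
     {f \<in> Lp_on p S. \<forall>j\<in>{1..k}. \<exists>g\<in>Lp_on p S. has_weak_derivative S j f g}"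

end

(*
Lower bound.  Let polygonals with vertices c(t_0), ..., c(t_n), modulus tending to 0 and p-rotation
below M be inscribed in c.  With v_i the edges, e_i their directions and r_i = min |v_i| |v_(i+1)|,
the p-rotation dominates the sum of |e_(i+1) - e_i|^p / r_i^(p-1).  Hoelder's inequality for sums
makes the piecewise constant direction field t |-> e_i almost equi-Hoelder-continuous in the
arc-length parameter, and since the lengths of the polygonals tend to L it converges to the
derivative T of c, with sum |T(s_(j+1)) - T(s_j)|^p / (s_(j+1) - s_j)^(p-1) <= M for all partitions.
By the theorem of F. Riesz T is then an indefinite integral of some g with int |g|^p <= M, and
g = c'' weakly.

Upper bound.  The weak second derivative g of c has c(t) = c(0) + int_0^t T with T an indefinite
integral of g.  For the uniform polygonals with step h the edges have length h (1 - o(1)), so the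
p-rotation is (1 + o(1)) times the sum of |v_(i+1) - v_i|^p / h^(2p-1); and v_(i+1) - v_i is a double
integral of g over a square of side h, so Hoelder's inequality bounds that sum by int |g|^p.
*)
theory Submission
  imports Defs
begin

text \<open>Three obstacles shape the argument. The modulus measures diameters in space, while all
  estimates run in the arc-length parameter; the link is that an arc-length curve is constant on no
  interval. The edges of one polygonal may have very unequal lengths, so Hoelder's inequality is
  weighted by the r_i, whose sum is at most the elapsed parameter. And nothing is known beforehand
  about |T| in the upper bound, so the lower bound for the edges comes from polygons inscribed in
  short subarcs. Pointwise convergence of the directions uses no compactness: a chord over a
  parameter interval of length u determines the direction at its left end up to an error that is
  small with u. Both bounds rest on |e_(i+1) - e_i| = 2 sin (\<theta>_i / 2). The lower one uses 2
  sin (\<theta>/2) \<le> \<theta> \<le> 2 tan (\<theta>/2), the upper one reverses this at the cost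
  of a factor cos (\<theta>/2), which tends to 1. In the lower bound M is any real number above the
  p-curvature, so the bounds meet. The integrals obtained belong to particular weak second
  derivatives; almost everywhere uniqueness carries the equality over to each of them.\<close>

section \<open>Inequalities of Young and Hoelder\<close>

text \<open>Convexity: the graph of x^p lies above its tangent at z, that is z^p + p z^(p-1) (x - z)
  \<le> x^p. Both forms of Hoelder's inequality below come from adding up this affine bound, with
  the tangent taken at a mean value.\<close>

lemma powr_tangent_le:
  fixes p x z :: real
  assumes p: "p > 1" and x: "0 \<le> x" and z: "0 \<le> z"
  shows "p * z powr (p - 1) * x \<le> x powr p + (p - 1) * z powr p"
proof -
  define q where "q = p / (p - 1)"
  have q: "q > 1" "1 / p + 1 / q = 1" using p by (auto simp: q_def field_simps)
  have "x * z powr (p - 1) \<le> x powr p / p + (z powr (p - 1)) powr q / q"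
    by (rule Youngs_inequality) (use p q x in auto)
  also have "(z powr (p - 1)) powr q = z powr p"
    using p by (simp add: powr_powr q_def)
  finally have "p * (x * z powr (p - 1)) \<le> p * (x powr p / p + z powr p / q)"
    using p by (intro mult_left_mono) auto
  also have "\<dots> = x powr p + (p - 1) * z powr p"
    using p by (simp add: q_def field_simps)
  finally show ?thesis by (simp add: mult_ac)
qed

lemma powr_mult_powr_minus_one: "0 \<le> x \<Longrightarrow> x * x powr (p - 1) = x powr (p::real)"
  by (cases "x = 0") (auto simp: powr_diff)

text \<open>Jensen's inequality for x^p with weights r_i, applied to the ratios x_i / r_i. The
  weights will be the minimal edge lengths at the vertices.\<close>

lemma sum_Holder:
  fixes x r :: "nat \<Rightarrow> real"
  assumes p: "p > 1" and x: "\<And>i. i \<in> I \<Longrightarrow> 0 \<le> x i" and r: "\<And>i. i \<in> I \<Longrightarrow> 0 < r i"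
  shows "(\<Sum>i\<in>I. x i) powr p \<le> (\<Sum>i\<in>I. x i powr p / r i powr (p - 1)) * (\<Sum>i\<in>I. r i) powr (p - 1)"
proof (cases "finite I \<and> I \<noteq> {}")
  case True
  define R where "R = (\<Sum>i\<in>I. r i)"
  define X where "X = (\<Sum>i\<in>I. x i)"
  have R: "R > 0" unfolding R_def using True r by (intro sum_pos) auto
  have X: "X \<ge> 0" unfolding X_def using x by (intro sum_nonneg) auto
  \<comment> \<open>The weighted mean of the ratios x_i / r_i: for the tangent at this point the
    affine bounds add up to exactly \<open>m powr p * R\<close>.\<close>
  define m where "m = X / R"
  have m: "m \<ge> 0" using R X by (simp add: m_def)
  have "p * m powr (p - 1) * x i - (p - 1) * m powr p * r i \<le> x i powr p / r i powr (p - 1)"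
    if i: "i \<in> I" for i
  proof -
    have "p * m powr (p - 1) * (x i / r i) \<le> (x i / r i) powr p + (p - 1) * m powr p"
      using x[OF i] r[OF i] m by (intro powr_tangent_le[OF p]) auto
    then have "r i * (p * m powr (p - 1) * (x i / r i)) \<le> r i * ((x i / r i) powr p + (p - 1) * m powr p)"
      using r[OF i] by (intro mult_left_mono) auto
    moreover have "r i * (x i / r i) powr p = x i powr p / r i powr (p - 1)"
      using x[OF i] r[OF i] by (simp add: powr_divide powr_diff)
    ultimately show ?thesis using r[OF i] by (simp add: algebra_simps)
  qed
  then have "(\<Sum>i\<in>I. p * m powr (p - 1) * x i - (p - 1) * m powr p * r i)
      \<le> (\<Sum>i\<in>I. x i powr p / r i powr (p - 1))" by (rule sum_mono)
  then have "p * m powr (p - 1) * X - (p - 1) * m powr p * R \<le> (\<Sum>i\<in>I. x i powr p / r i powr (p - 1))"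
    by (simp add: sum_subtractf R_def X_def flip: sum_distrib_left)
  moreover have "m powr (p - 1) * X = m powr p * R"
    using R powr_mult_powr_minus_one[OF m, of p] by (simp add: m_def field_simps)
  then have "p * m powr (p - 1) * X = p * (m powr p * R)" by simp
  moreover have "(p - 1) * m powr p * R = p * (m powr p * R) - m powr p * R" by (simp add: algebra_simps)
  ultimately have "m powr p * R \<le> (\<Sum>i\<in>I. x i powr p / r i powr (p - 1))"
    by linarith
  then have "m powr p * R * R powr (p - 1) \<le> (\<Sum>i\<in>I. x i powr p / r i powr (p - 1)) * R powr (p - 1)"
    by (intro mult_right_mono) auto
  moreover have "m powr p * R * R powr (p - 1) = X powr p"
    using R X by (simp add: m_def powr_divide powr_diff)
  ultimately show ?thesis by (simp add: R_def X_def)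
qed auto

text \<open>The same tangent argument at the mean \<open>m\<close> of \<open>norm (f x)\<close>. The
  degenerate interval is treated apart because \<open>m\<close> divides by its length.\<close>

lemma set_integral_Holder:
  fixes f :: "real \<Rightarrow> 'a::euclidean_space"
  assumes p: "p > 1" and ab: "a \<le> b"
    and f: "set_integrable M {a..b} f"
    and fp: "set_integrable M {a..b} (\<lambda>x. norm (f x) powr p)"
    and M: "emeasure M {a..b} = ennreal (b - a)" "{a..b} \<in> sets M"
  shows "norm (LINT x:{a..b}|M. f x) powr p \<le> (b - a) powr (p - 1) * (LINT x:{a..b}|M. norm (f x) powr p)"
proof (cases "a = b")
  case True
  have "AE x in M. x \<notin> {a..b}"
    using M True by (intro AE_not_in) auto
  then have "(LINT x:{a..b}|M. f x) = (LINT x|M. 0)"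
    unfolding set_lebesgue_integral_def using f unfolding set_integrable_def
    by (intro integral_cong_AE) (auto simp: indicator_def)
  then show ?thesis using True by simp
next
  case False
  with ab have ab: "a < b" by simp
  have fn: "set_integrable M {a..b} (\<lambda>x. norm (f x))"
    by (rule set_integrable_norm[OF f])
  define X where "X = (LINT x:{a..b}|M. norm (f x))"
  define I where "I = (LINT x:{a..b}|M. norm (f x) powr p)"
  have nX: "norm (LINT x:{a..b}|M. f x) \<le> X"
    unfolding X_def set_lebesgue_integral_def
    by (rule order_trans[OF integral_norm_bound]) (simp add: )
  then have X: "X \<ge> 0" using norm_ge_zero order_trans by blast
  define m where "m = X / (b - a)"
  have m: "m \<ge> 0" using X ab by (simp add: m_def)
  have c: "set_integrable M {a..b} (\<lambda>x. c)" for c :: real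
    unfolding set_integrable_def real_scaleR_def
    by (intro integrable_mult_left integrable_real_indicator) (use M in auto)
  have ci: "(LINT x:{a..b}|M. c) = c * (b - a)" for c :: real
    using M ab by (simp add: set_lebesgue_integral_def measure_def)
  have "(LINT x:{a..b}|M. p * m powr (p - 1) * norm (f x) - (p - 1) * m powr p) \<le> I"
    unfolding I_def
  proof (rule set_integral_mono)
    show "set_integrable M {a..b} (\<lambda>x. p * m powr (p - 1) * norm (f x) - (p - 1) * m powr p)"
      by (intro set_integral_diff set_integrable_mult_right fn c)
    show "p * m powr (p - 1) * norm (f x) - (p - 1) * m powr p \<le> norm (f x) powr p" for x
      using powr_tangent_le[OF p _ m, of "norm (f x)"] by simp
  qed (rule fp)
  also have "(LINT x:{a..b}|M. p * m powr (p - 1) * norm (f x) - (p - 1) * m powr p)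
      = p * m powr (p - 1) * X - (p - 1) * m powr p * (b - a)"
    by (subst set_integral_diff) (auto intro!: fn c simp: ci X_def)
  also have "m powr (p - 1) * X = m powr p * (b - a)"
    using ab powr_mult_powr_minus_one[OF m, of p] by (simp add: m_def field_simps)
  then have "p * m powr (p - 1) * X = p * (m powr p * (b - a))" by simp
  then have "p * m powr (p - 1) * X - (p - 1) * m powr p * (b - a) = m powr p * (b - a)"
    by (simp add: algebra_simps)
  finally have "m powr p * (b - a) * (b - a) powr (p - 1) \<le> I * (b - a) powr (p - 1)"
    by (intro mult_right_mono) auto
  moreover have "m powr p * (b - a) * (b - a) powr (p - 1) = X powr p"
    using ab X by (simp add: m_def powr_divide powr_diff)
  moreover have "norm (LINT x:{a..b}|M. f x) powr p \<le> X powr p"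
    using nX p by (intro powr_mono2) auto
  ultimately show ?thesis by (simp add: I_def mult.commute)
qed

section \<open>Directions of the edges of inscribed polygonals\<close>

text \<open>The curve enters through its 1-Lipschitz bound. \<open>m\<close> is an upper bound for
  the mesh rather than the mesh itself, so that a tolerance can be put in its place.\<close>

locale curve_partition =
  fixes c :: "real \<Rightarrow> 'a::real_inner" and L m :: real and n :: nat and x :: "nat \<Rightarrow> real"
    and v :: "nat \<Rightarrow> 'a"
  defines "v \<equiv> \<lambda>i. c (x (Suc i)) - c (x i)"
  assumes n: "0 < n" and x0: "x 0 = 0" and xn: "x n = L"
    and inc: "\<And>i. i < n \<Longrightarrow> x i < x (Suc i)"
    and mesh: "\<And>i. i < n \<Longrightarrow> x (Suc i) - x i \<le> m"
    and lip: "\<And>s t. 0 \<le> s \<Longrightarrow> s \<le> t \<Longrightarrow> t \<le> L \<Longrightarrow> norm (c t - c s) \<le> t - s"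
begin

text \<open>Edges are numbered from \<open>0\<close>: the parameters of \<open>v i\<close> run from \<open>x i\<close> to \<open>x (Suc i)\<close>, and
  \<open>idx s\<close> is the edge whose parameter interval contains \<open>s\<close>.\<close>

definition idx :: "real \<Rightarrow> nat" where "idx s = (LEAST i. s \<le> x (Suc i))"

lemma x_mono: "i \<le> j \<Longrightarrow> j \<le> n \<Longrightarrow> x i \<le> x j"
  by (induction rule: dec_induct) (use inc in \<open>auto intro: order_trans[OF _ less_imp_le]\<close>)

lemma x_range: "i \<le> n \<Longrightarrow> 0 \<le> x i \<and> x i \<le> L"
  using x_mono[of 0 i] x_mono[of i n] x0 xn by auto

lemma norm_v_le: "i < n \<Longrightarrow> norm (v i) \<le> x (Suc i) - x i"
  unfolding v_def using x_range[of i] x_range[of "Suc i"] inc[of i] by (intro lip) auto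

lemma m_pos: "m > 0"
  using inc[of 0] mesh[of 0] n by simp

lemma idx:
  assumes "0 \<le> s" "s \<le> L"
  shows "idx s < n" "s \<le> x (Suc (idx s))" "x (idx s) \<le> s"
proof -
  have ex: "s \<le> x (Suc (n - 1))" using assms n xn by simp
  show "s \<le> x (Suc (idx s))" unfolding idx_def by (rule LeastI[of "\<lambda>i. s \<le> x (Suc i)", OF ex])
  have "idx s \<le> n - 1" unfolding idx_def by (rule Least_le[of "\<lambda>i. s \<le> x (Suc i)", OF ex])
  then show "idx s < n" using n by simp
  show "x (idx s) \<le> s"
  proof (cases "idx s")
    case 0
    then show ?thesis using x0 assms by simp
  next
    case (Suc i)
    then have "\<not> s \<le> x (Suc i)" using not_less_Least[of i "\<lambda>i. s \<le> x (Suc i)"] by (simp add: idx_def)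
    then show ?thesis using Suc by simp
  qed
qed

lemma idx_mono:
  assumes "0 \<le> a" "a \<le> b" "b \<le> L"
  shows "idx a \<le> idx b"
proof -
  have "a \<le> x (Suc (idx b))" using idx(2)[of b] assms by simp
  then show ?thesis unfolding idx_def[of a] by (rule Least_le)
qed

lemma x_idx_diff:
  assumes "0 \<le> a" "a \<le> b" "b \<le> L"
  shows "x (idx b) - x (idx a) \<le> b - a + m"
  using idx[of a] idx[of b] mesh[of "idx a"] assms by simp

lemma chord_le_polygon:
  assumes "i \<le> j" "j \<le> n"
  shows "norm (c (x j) - c (x i)) \<le> (\<Sum>k=i..<j. norm (v k))"
proof -
  have "c (x j) - c (x i) = (\<Sum>k=i..<j. v k)"
    unfolding v_def using assms sum_Suc_diff'[of i j "\<lambda>k. c (x k)"] by simp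
  then show ?thesis by (simp add: norm_sum)
qed

text \<open>Each y_j is moved to the node on its left, at distance at most m along the curve, which
  costs 2m per chord. Chords between nodes are bounded by the edges between them, and these blocks
  of edges are disjoint because \<open>idx\<close> is monotone.\<close>

lemma inscribed_length_le:
  assumes y: "\<And>j. j < k \<Longrightarrow> y j \<le> y (Suc j)" "0 \<le> y 0" "y k \<le> L"
  shows "(\<Sum>j<k. norm (c (y (Suc j)) - c (y j))) \<le> (\<Sum>i<n. norm (v i)) + 2 * m * real k"
proof -
  have ym: "y i \<le> y j" if "i \<le> j" "j \<le> k" for i j
    using that by (induction rule: dec_induct) (use y in \<open>auto intro: order_trans\<close>)
  have rng: "0 \<le> y j \<and> y j \<le> L" if "j \<le> k" for j using ym[of 0 j] ym[of j k] y that by auto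
  have near: "norm (c (y j) - c (x (idx (y j)))) \<le> m" if "j \<le> k" for j
    using lip[of "x (idx (y j))" "y j"] idx[of "y j"] rng[OF that] mesh[of "idx (y j)"] x_range[of "idx (y j)"] by simp
  \<comment> \<open>The bound for the first \<open>i\<close> chords involves only edges before
    \<open>idx (y i)\<close>, so the next block of edges can be appended in the induction
    step.\<close>
  have "(\<Sum>j<i. norm (c (y (Suc j)) - c (y j))) \<le> (\<Sum>k<idx (y i). norm (v k)) + 2 * m * real i" if "i \<le> k" for i
    using that
  proof (induction i)
    case 0
    then show ?case by (simp add: sum_nonneg)
  next
    case (Suc i)
    have yi: "idx (y i) \<le> idx (y (Suc i))"
      using rng[of i] rng[of "Suc i"] y(1)[of i] Suc.prems by (intro idx_mono) auto
    have "c (y (Suc i)) - c (y i) = (c (x (idx (y (Suc i)))) - c (x (idx (y i))))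
       + ((c (y (Suc i)) - c (x (idx (y (Suc i))))) - (c (y i) - c (x (idx (y i)))))" by simp
    then have "norm (c (y (Suc i)) - c (y i)) \<le> norm (c (x (idx (y (Suc i)))) - c (x (idx (y i))))
       + (norm (c (y (Suc i)) - c (x (idx (y (Suc i))))) + norm (c (y i) - c (x (idx (y i)))))"
      by (metis norm_triangle_le norm_triangle_ineq4 add_left_mono)
    also have "\<dots> \<le> (\<Sum>k=idx (y i)..<idx (y (Suc i)). norm (v k)) + (m + m)"
      using near[of i] near[of "Suc i"] Suc.prems yi idx(1)[of "y (Suc i)"] rng[of "Suc i"]
      by (intro add_mono chord_le_polygon) auto
    finally have "(\<Sum>j<Suc i. norm (c (y (Suc j)) - c (y j))) \<le>
       ((\<Sum>k<idx (y i). norm (v k)) + (\<Sum>k=idx (y i)..<idx (y (Suc i)). norm (v k))) + 2 * m * real (Suc i)"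
      using Suc by (simp add: algebra_simps)
    also have "(\<Sum>k<idx (y i). norm (v k)) + (\<Sum>k=idx (y i)..<idx (y (Suc i)). norm (v k))
       = (\<Sum>k<idx (y (Suc i)). norm (v k))"
      using yi by (simp add: lessThan_atLeast0 sum.atLeastLessThan_concat)
    finally show ?case .
  qed
  from this[of k] have "(\<Sum>j<k. norm (c (y (Suc j)) - c (y j))) \<le> (\<Sum>k<idx (y k). norm (v k)) + 2 * m * real k" by simp
  also have "(\<Sum>k<idx (y k). norm (v k)) \<le> (\<Sum>i<n. norm (v i))"
    using idx(1)[of "y k"] rng[of k] by (intro sum_mono2) auto
  finally show ?thesis by simp
qed

end

text \<open>\<open>q i\<close> is the lower bound that the p-rotation yields at the vertex between
  edges i and i + 1, \<open>M\<close> bounds the total of these, and \<open>\<delta>\<close> bounds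
  the length that the polygonal loses against the curve.\<close>

locale inscribed_approximation = curve_partition c L m n x
  for c :: "real \<Rightarrow> 'a::real_inner" and L m :: real and n :: nat and x :: "nat \<Rightarrow> real" +
  fixes p M \<delta> :: real and e :: "nat \<Rightarrow> 'a" and q :: "nat \<Rightarrow> real"
  defines "e \<equiv> \<lambda>i. v i /\<^sub>R norm (v i)"
    and "q \<equiv> \<lambda>i. norm (e (Suc i) - e i) powr p / min (norm (v i)) (norm (v (Suc i))) powr (p - 1)"
  assumes p: "p > 1"
    and ne: "\<And>i. i < n \<Longrightarrow> v i \<noteq> 0"
    and len: "L - (\<Sum>i<n. norm (v i)) \<le> \<delta>"
    and energy: "(\<Sum>i<n-1. q i) \<le> M"
begin

definition tangent :: "real \<Rightarrow> 'a" where "tangent s = e (idx s)"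

lemma norm_e: "i < n \<Longrightarrow> norm (e i) = 1"
  using ne[of i] by (simp add: e_def)

lemma q_nonneg: "0 \<le> q i"
  by (simp add: q_def)

text \<open>Hoelder's inequality with the weights r_k. As r_k is at most the length of edge k, hence
  at most x_(k+1) - x_k, the weights add up to no more than the elapsed parameter.\<close>

lemma e_diff:
  assumes ij: "i \<le> j" "j < n"
  shows "norm (e j - e i) powr p \<le> (\<Sum>k=i..<j. q k) * (x j - x i) powr (p - 1)"
proof -
  let ?r = "\<lambda>k. min (norm (v k)) (norm (v (Suc k)))"
  have "e j - e i = (\<Sum>k=i..<j. e (Suc k) - e k)" using ij by (simp add: sum_Suc_diff')
  then have "norm (e j - e i) \<le> (\<Sum>k=i..<j. norm (e (Suc k) - e k))" by (simp add: norm_sum)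
  then have "norm (e j - e i) powr p \<le> (\<Sum>k=i..<j. norm (e (Suc k) - e k)) powr p"
    using p by (intro powr_mono2) auto
  also have "\<dots> \<le> (\<Sum>k=i..<j. q k) * (\<Sum>k=i..<j. ?r k) powr (p - 1)"
    unfolding q_def by (rule sum_Holder[OF p]) (use ne ij in auto)
  also have "\<dots> \<le> (\<Sum>k=i..<j. q k) * (x j - x i) powr (p - 1)"
  proof (rule mult_left_mono)
    have "(\<Sum>k=i..<j. ?r k) \<le> (\<Sum>k=i..<j. x (Suc k) - x k)"
    proof (rule sum_mono)
      fix k assume "k \<in> {i..<j}"
      then have "norm (v k) \<le> x (Suc k) - x k" using ij by (intro norm_v_le) auto
      then show "?r k \<le> x (Suc k) - x k" by linarith
    qed
    also have "\<dots> = x j - x i" using ij by (simp add: sum_Suc_diff')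
    finally show "(\<Sum>k=i..<j. ?r k) powr (p - 1) \<le> (x j - x i) powr (p - 1)"
      using p by (intro powr_mono2 sum_nonneg) auto
  qed (auto intro: sum_nonneg q_nonneg)
  finally show ?thesis .
qed

lemma q_sum_le: "i \<le> j \<Longrightarrow> j < n \<Longrightarrow> (\<Sum>k=i..<j. q k) \<le> M"
  by (rule order_trans[OF sum_mono2 energy]) (auto simp: q_nonneg)

lemma M_nonneg: "0 \<le> M"
  using q_sum_le[of 0 0] n by simp

text \<open>The extra \<open>m\<close> is the price of replacing a and b by the nodes to their left,
  whose distance may exceed b - a by one cell.\<close>

lemma tangent_diff:
  assumes ab: "0 \<le> a" "a \<le> b" "b \<le> L"
  shows "norm (tangent b - tangent a) powr p \<le> (\<Sum>k=idx a..<idx b. q k) * (b - a + m) powr (p - 1)"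
proof -
  have "norm (tangent b - tangent a) powr p \<le> (\<Sum>k=idx a..<idx b. q k) * (x (idx b) - x (idx a)) powr (p - 1)"
    unfolding tangent_def using idx[of b] ab idx_mono by (intro e_diff) auto
  also have "\<dots> \<le> (\<Sum>k=idx a..<idx b. q k) * (b - a + m) powr (p - 1)"
  proof (rule mult_left_mono)
    have "0 \<le> x (idx b) - x (idx a)"
      using x_mono[OF idx_mono[OF ab]] idx[of b] ab by simp
    then show "(x (idx b) - x (idx a)) powr (p - 1) \<le> (b - a + m) powr (p - 1)"
      using x_idx_diff[OF ab] p by (intro powr_mono2) auto
  qed (auto intro: sum_nonneg q_nonneg)
  finally show ?thesis .
qed

text \<open>Consecutive intervals use consecutive, disjoint blocks of vertices, so their bounds add
  up to part of the total energy. The extra \<open>m\<close> in the denominator keeps it positive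
  even where two points coincide.\<close>

lemma tangent_Riesz_sum:
  assumes y: "\<And>j. j < k \<Longrightarrow> y j \<le> y (Suc j)" "0 \<le> y 0" "y k \<le> L"
  shows "(\<Sum>j<k. norm (tangent (y (Suc j)) - tangent (y j)) powr p / (y (Suc j) - y j + m) powr (p - 1)) \<le> M"
proof -
  have ym: "y i \<le> y j" if "i \<le> j" "j \<le> k" for i j
    using that by (induction rule: dec_induct) (use y in \<open>auto intro: order_trans\<close>)
  have rng: "0 \<le> y j \<and> y j \<le> L" if "j \<le> k" for j using ym[of 0 j] ym[of j k] y that by auto
  have "(\<Sum>j<i. norm (tangent (y (Suc j)) - tangent (y j)) powr p / (y (Suc j) - y j + m) powr (p - 1))
     \<le> (\<Sum>k=idx (y 0)..<idx (y i). q k)" if "i \<le> k" for i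
    using that
  proof (induction i)
    case (Suc i)
    have yi: "0 \<le> y i" "y i \<le> y (Suc i)" "y (Suc i) \<le> L" "y 0 \<le> y i"
      using rng[of i] rng[of "Suc i"] y(1)[of i] ym[of 0 i] Suc.prems by auto
    have "norm (tangent (y (Suc i)) - tangent (y i)) powr p / (y (Suc i) - y i + m) powr (p - 1)
      \<le> (\<Sum>k=idx (y i)..<idx (y (Suc i)). q k)"
      using tangent_diff[OF yi(1-3)] yi m_pos by (simp add: pos_divide_le_eq)
    then have "(\<Sum>j<Suc i. norm (tangent (y (Suc j)) - tangent (y j)) powr p / (y (Suc j) - y j + m) powr (p - 1))
      \<le> (\<Sum>k=idx (y 0)..<idx (y i). q k) + (\<Sum>k=idx (y i)..<idx (y (Suc i)). q k)"
      using Suc by simp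
    also have "\<dots> = (\<Sum>k=idx (y 0)..<idx (y (Suc i)). q k)"
      using yi y(2) by (intro sum.atLeastLessThan_concat idx_mono) auto
    finally show ?case .
  qed simp
  from this[of k] q_sum_le[of "idx (y 0)" "idx (y k)"] show ?thesis
    using idx_mono[of "y 0" "y k"] ym[of 0 k] y idx(1)[of "y k"] by simp
qed

text \<open>Three sources of error: moving a and b to nodes (a multiple of m), the length lost by
  the polygonal (\<delta>), and the turning of the directions between a and b (the last
  summand).\<close>

lemma tangent_chord:
  assumes ab: "0 \<le> a" "a \<le> b" "b \<le> L"
  shows "norm (c b - c a - (b - a) *\<^sub>R tangent a)
    \<le> 4 * m + \<delta> + (b - a + m) * (M * (b - a + m) powr (p - 1)) powr (1 / p)"
proof -
  define i where "i = idx a"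
  define j where "j = idx b"
  have ij: "i \<le> j" "j < n" "i < n" using idx_mono[OF ab] idx[of b] ab by (auto simp: i_def j_def)
  define \<omega> where "\<omega> = (M * (b - a + m) powr (p - 1)) powr (1 / p)"
  have xa: "x i \<le> a" "a \<le> x (Suc i)" "x (Suc i) - x i \<le> m"
    using idx[of a] ab mesh[of i] ij by (auto simp: i_def)
  have xb: "x j \<le> b" "b \<le> x (Suc j)" "x (Suc j) - x j \<le> m"
    using idx[of b] ab mesh[of j] ij by (auto simp: j_def)
  have xij: "0 \<le> x j - x i" "x j - x i \<le> b - a + m"
    using x_mono[of i j] ij x_idx_diff[OF ab] by (auto simp: i_def j_def)
  have ek: "norm (e k - e i) \<le> \<omega>" if k: "i \<le> k" "k < j" for k
  proof -
    have "norm (e k - e i) powr p \<le> (\<Sum>l=i..<k. q l) * (x k - x i) powr (p - 1)"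
      using k ij by (intro e_diff) auto
    also have "\<dots> \<le> M * (b - a + m) powr (p - 1)"
    proof (rule mult_mono)
      show "(x k - x i) powr (p - 1) \<le> (b - a + m) powr (p - 1)"
        using x_mono[of i k] x_mono[of k j] k ij xij p by (intro powr_mono2) auto
    qed (use q_sum_le[of i k] k ij M_nonneg in auto)
    finally have "(norm (e k - e i) powr p) powr (1 / p) \<le> \<omega>"
      unfolding \<omega>_def using p by (intro powr_mono2) auto
    then show ?thesis using p by (simp add: powr_powr)
  qed
  have sv: "(\<Sum>k=i..<j. v k) = c (x j) - c (x i)" unfolding v_def using ij sum_Suc_diff'[of i j "\<lambda>k. c (x k)"] by simp
  have sx: "(\<Sum>k=i..<j. x (Suc k) - x k) = x j - x i" using ij by (simp add: sum_Suc_diff')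
  have "norm ((c (x j) - c (x i)) - (x j - x i) *\<^sub>R e i)
      = norm (\<Sum>k=i..<j. v k - (x (Suc k) - x k) *\<^sub>R e i)"
    unfolding sv[symmetric] sx[symmetric] by (simp only: sum_subtractf[of v] scaleR_sum_left)
  also have "\<dots> \<le> (\<Sum>k=i..<j. ((x (Suc k) - x k) - norm (v k)) + (x (Suc k) - x k) * \<omega>)"
  proof (rule sum_norm_le)
    fix k assume k: "k \<in> {i..<j}"
    have kn: "k < n" using k ij by simp
    \<comment> \<open>An edge deviates from the expected vector for two reasons: it is shorter than
      its parameter interval, and its direction is \<open>e k\<close> instead of
      \<open>e i\<close>.\<close>
    have "v k - (x (Suc k) - x k) *\<^sub>R e i
       = (norm (v k) - (x (Suc k) - x k)) *\<^sub>R e k + (x (Suc k) - x k) *\<^sub>R (e k - e i)"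
      using ne[OF kn] by (simp add: e_def algebra_simps)
    then have "norm (v k - (x (Suc k) - x k) *\<^sub>R e i)
      \<le> norm ((norm (v k) - (x (Suc k) - x k)) *\<^sub>R e k) + norm ((x (Suc k) - x k) *\<^sub>R (e k - e i))"
      by (metis norm_triangle_ineq)
    also have "\<dots> \<le> ((x (Suc k) - x k) - norm (v k)) + (x (Suc k) - x k) * \<omega>"
      using norm_e[OF kn] norm_v_le[OF kn] inc[OF kn] ek[of k] k by (auto intro!: add_mono mult_left_mono)
    finally show "norm (v k - (x (Suc k) - x k) *\<^sub>R e i) \<le> ((x (Suc k) - x k) - norm (v k)) + (x (Suc k) - x k) * \<omega>" .
  qed
  also have "\<dots> = (\<Sum>k=i..<j. (x (Suc k) - x k) - norm (v k)) + (x j - x i) * \<omega>"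
    unfolding sx[symmetric] by (simp add: sum.distrib sum_distrib_right)
  \<comment> \<open>Every deficit is nonnegative, so the deficit of a stretch is at most the total
    one.\<close>
  also have "(\<Sum>k=i..<j. (x (Suc k) - x k) - norm (v k)) \<le> (\<Sum>k<n. (x (Suc k) - x k) - norm (v k))"
    using norm_v_le ij by (intro sum_mono2) auto
  also have "\<dots> \<le> \<delta>"
    using len x0 xn sum_lessThan_telescope[of x n] by (simp add: sum_subtractf[of _ "\<lambda>k. norm (v k)"])
  also have "(x j - x i) * \<omega> \<le> (b - a + m) * \<omega>"
    using xij by (intro mult_right_mono) (auto simp: \<omega>_def)
  finally have 1: "norm ((c (x j) - c (x i)) - (x j - x i) *\<^sub>R e i) \<le> \<delta> + (b - a + m) * \<omega>" by simp
  have 2: "norm (c b - c (x j)) \<le> m" "norm (c a - c (x i)) \<le> m"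
    using lip[of "x j" b] lip[of "x i" a] x_range[of i] x_range[of j] ij xa xb ab by auto
  \<comment> \<open>Both a - x_i and b - x_j lie in [0, m], so their difference is at most m in
    absolute value.\<close>
  have 3: "norm (((x j - x i) - (b - a)) *\<^sub>R e i) \<le> m"
    using norm_e[OF ij(3)] xa xb by (simp add: abs_le_iff)
  have eq: "c b - c a - (b - a) *\<^sub>R e i = ((c b - c (x j)) - (c a - c (x i)))
      + (((c (x j) - c (x i)) - (x j - x i) *\<^sub>R e i) + ((x j - x i) - (b - a)) *\<^sub>R e i)"
    by (simp add: algebra_simps)
  have "norm (c b - c a - (b - a) *\<^sub>R e i) \<le> (norm (c b - c (x j)) + norm (c a - c (x i)))
      + (norm ((c (x j) - c (x i)) - (x j - x i) *\<^sub>R e i) + norm (((x j - x i) - (b - a)) *\<^sub>R e i))"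
    unfolding eq by (intro norm_triangle_le[OF add_mono] norm_triangle_ineq4 norm_triangle_ineq)
  then show ?thesis using 1 2 3 m_pos unfolding tangent_def i_def[symmetric] \<omega>_def by linarith
qed

end

section \<open>Passage to the limit in the direction fields\<close>

text \<open>By the chord estimate S h a is close to the difference quotient of c over [a, a + u],
  which does not depend on h. Hence the fields are Cauchy at each point, the limit inherits the
  bound on the sums, and letting u tend to 0 identifies it as the derivative of c.\<close>

lemma Riesz_sum_limit:
  fixes c :: "real \<Rightarrow> 'a::euclidean_space" and S :: "nat \<Rightarrow> real \<Rightarrow> 'a"
  assumes p: "p > 1" and L: "0 < L" and M: "0 \<le> M"
    and \<mu>: "\<And>h. 0 < \<mu> h" "\<mu> \<longlonglongrightarrow> 0" and \<delta>: "\<delta> \<longlonglongrightarrow> 0"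
    and chord: "\<And>h a b. 0 \<le> a \<Longrightarrow> a \<le> b \<Longrightarrow> b \<le> L \<Longrightarrow> norm (c b - c a - (b - a) *\<^sub>R S h a)
      \<le> 4 * \<mu> h + \<delta> h + (b - a + \<mu> h) * (M * (b - a + \<mu> h) powr (p - 1)) powr (1 / p)"
    and Riesz: "\<And>h k y. (\<And>j. j < k \<Longrightarrow> y j \<le> y (Suc j)) \<Longrightarrow> 0 \<le> y 0 \<Longrightarrow> y k \<le> L \<Longrightarrow>
      (\<Sum>j<k. norm (S h (y (Suc j)) - S h (y j)) powr p / (y (Suc j) - y j + \<mu> h) powr (p - 1)) \<le> M"
  obtains T where
    "\<And>k y. (\<And>j. j < k \<Longrightarrow> y j < y (Suc j)) \<Longrightarrow> 0 \<le> y 0 \<Longrightarrow> y k \<le> L \<Longrightarrow>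
      (\<Sum>j<k. norm (T (y (Suc j)) - T (y j)) powr p / (y (Suc j) - y j) powr (p - 1)) \<le> M"
    "\<And>a. 0 < a \<Longrightarrow> a < L \<Longrightarrow> (c has_vector_derivative T a) (at a)"
proof -
  \<comment> \<open>Equal to M^(1/p) u^(1 - 1/p): the Hoelder modulus of the one-dimensional Sobolev
    embedding.\<close>
  define \<omega> where "\<omega> u = (M * u powr (p - 1)) powr (1 / p)" for u
  have \<omega>0: "\<omega> u \<ge> 0" for u by (simp add: \<omega>_def)
  have scale: "norm (w /\<^sub>R r) \<le> u" if "norm w \<le> r * u" "r > 0" for w :: 'a and r u
    using that by (simp add: divide_simps mult.commute)
  have \<omega>lim0: "(\<omega> \<longlongrightarrow> 0) (at_right 0)"
  proof -
    have "((\<lambda>u::real. u powr ((p - 1) / p)) \<longlongrightarrow> 0 powr ((p - 1) / p)) (at_right 0)"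
      by (rule tendsto_powr'[OF tendsto_ident_at tendsto_const]) (use p in \<open>auto simp: eventually_at_filter\<close>)
    then have "((\<lambda>u::real. M powr (1 / p) * u powr ((p - 1) / p)) \<longlongrightarrow> 0) (at_right 0)"
      by (intro tendsto_mult_right_zero) simp
    moreover have "\<omega> = (\<lambda>u. M powr (1 / p) * u powr ((p - 1) / p))"
      using M by (simp add: \<omega>_def[abs_def] powr_mult powr_powr)
    ultimately show ?thesis by simp
  qed
  have \<omega>lim: "(\<lambda>h. \<omega> (u + \<mu> h)) \<longlonglongrightarrow> \<omega> u" if "u > 0" for u
  proof -
    have "(\<lambda>h. u + \<mu> h) \<longlonglongrightarrow> u" using tendsto_add[OF tendsto_const \<mu>(2), of u] by simp
    then have "(\<lambda>h. M powr (1 / p) * (u + \<mu> h) powr ((p - 1) / p)) \<longlonglongrightarrow> M powr (1 / p) * u powr ((p - 1) / p)"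
      using that by (intro tendsto_intros) auto
    then show ?thesis using M by (simp add: \<omega>_def powr_mult powr_powr)
  qed
  have hol: "norm (S h b - S h a) \<le> \<omega> (b - a + \<mu> h)" if "0 \<le> a" "a \<le> b" "b \<le> L" for h a b
  proof -
    have "norm (S h b - S h a) powr p / (b - a + \<mu> h) powr (p - 1) \<le> M"
      using Riesz[of 1 "\<lambda>j. if j = 0 then a else b" h] that by simp
    then have "norm (S h b - S h a) powr p \<le> M * (b - a + \<mu> h) powr (p - 1)"
      using \<mu>(1)[of h] that pos_divide_le_eq[of "(b - a + \<mu> h) powr (p - 1)"] by simp
    then have "(norm (S h b - S h a) powr p) powr (1 / p) \<le> \<omega> (b - a + \<mu> h)"
      unfolding \<omega>_def using p by (intro powr_mono2) auto
    then show ?thesis using p by (simp add: powr_powr)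
  qed
  have small: "\<exists>u. \<omega> u < \<epsilon> \<and> u < r \<and> 0 < u" if "0 < r" "0 < \<epsilon>" for r \<epsilon>
  proof -
    have "eventually (\<lambda>u. \<omega> u < \<epsilon>) (at_right 0)" using order_tendstoD(2)[OF \<omega>lim0 that(2)] .
    moreover have "eventually (\<lambda>u. u < r) (at_right 0)"
      using that by (intro eventually_at_rightI[of _ r]) auto
    moreover have "eventually (\<lambda>u::real. 0 < u) (at_right 0)" by (simp add: eventually_at_filter)
    ultimately have "eventually (\<lambda>u. \<omega> u < \<epsilon> \<and> u < r \<and> 0 < u) (at_right 0)"
      by eventually_elim auto
    then show ?thesis by (rule eventually_happens'[rotated]) simp
  qed
  have Cauchy0: "Cauchy (\<lambda>h. S h a)" if a: "0 \<le> a" "a < L" for a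
  proof (rule metric_CauchyI)
    fix \<epsilon> :: real assume \<epsilon>: "\<epsilon> > 0"
    obtain u where u: "\<omega> u < \<epsilon> / 4" "u < L - a" "0 < u"
      using small[of "L - a" "\<epsilon> / 4"] a \<epsilon> by auto
    \<comment> \<open>\<open>u\<close> is fixed before h grows: the error then tends to u
      \<omega>(u), which is below u \<epsilon> / 4, and division by u compares S h a with S k
      a.\<close>
    define err where "err h = 4 * \<mu> h + \<delta> h + (u + \<mu> h) * \<omega> (u + \<mu> h)" for h
    have "err \<longlonglongrightarrow> 4 * 0 + 0 + (u + 0) * \<omega> u"
      unfolding err_def[abs_def] by (intro tendsto_intros \<mu> \<delta> \<omega>lim u)
    moreover have "4 * 0 + 0 + (u + 0) * \<omega> u < u * (\<epsilon> / 4)" using u by simp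
    ultimately have "eventually (\<lambda>h. err h < u * (\<epsilon> / 4)) sequentially" by (rule order_tendstoD(2))
    then obtain H where H: "\<And>h. h \<ge> H \<Longrightarrow> err h < u * (\<epsilon> / 4)" by (auto simp: eventually_sequentially)
    show "\<exists>H. \<forall>h\<ge>H. \<forall>k\<ge>H. dist (S h a) (S k a) < \<epsilon>"
    proof (intro exI[of _ H] allI impI)
      fix h k assume hk: "h \<ge> H" "k \<ge> H"
      have 1: "norm (c (a + u) - c a - u *\<^sub>R S l a) \<le> err l" for l
        using chord[of a "a + u" l] a u by (simp add: err_def \<omega>_def)
      have "u * norm (S h a - S k a) = norm ((c (a + u) - c a - u *\<^sub>R S k a) - (c (a + u) - c a - u *\<^sub>R S h a))"
        using u by (simp add: algebra_simps flip: scaleR_diff_right)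
      also have "\<dots> \<le> err k + err h"
        by (rule order_trans[OF norm_triangle_ineq4]) (intro add_mono 1)
      also have "\<dots> < u * \<epsilon>" using H[OF hk(1)] H[OF hk(2)] u \<epsilon> by (simp add: field_simps) (smt (verit) mult_pos_pos)
      finally show "dist (S h a) (S k a) < \<epsilon>" using u by (simp add: dist_norm)
    qed
  qed
  have Cauchy: "Cauchy (\<lambda>h. S h a)" if a: "0 \<le> a" "a \<le> L" for a
  proof (cases "a < L")
    case False
    \<comment> \<open>No chord to the right starts at L; the Hoelder bound transports convergence
      there from L - u.\<close>
    with a have aL: "a = L" by simp
    show ?thesis
    proof (rule metric_CauchyI)
      fix \<epsilon> :: real assume \<epsilon>: "\<epsilon> > 0"
      obtain u where u: "\<omega> u < \<epsilon> / 4" "u < L" "0 < u"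
        using small[of L "\<epsilon> / 4"] L \<epsilon> by auto
      have "eventually (\<lambda>h. \<omega> (u + \<mu> h) < \<epsilon> / 4) sequentially"
        by (rule order_tendstoD(2)[OF \<omega>lim[OF u(3)] u(1)])
      then obtain H1 where H1: "\<And>h. h \<ge> H1 \<Longrightarrow> \<omega> (u + \<mu> h) < \<epsilon> / 4" by (auto simp: eventually_sequentially)
      obtain H2 where H2: "\<And>h k. h \<ge> H2 \<Longrightarrow> k \<ge> H2 \<Longrightarrow> dist (S h (L - u)) (S k (L - u)) < \<epsilon> / 4"
        using metric_CauchyD[OF Cauchy0[of "L - u"], of "\<epsilon> / 4"] u \<epsilon> by auto
      show "\<exists>H. \<forall>h\<ge>H. \<forall>k\<ge>H. dist (S h a) (S k a) < \<epsilon>"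
      proof (intro exI[of _ "max H1 H2"] allI impI)
        fix h k assume hk: "h \<ge> max H1 H2" "k \<ge> max H1 H2"
        have "dist (S l L) (S l (L - u)) < \<epsilon> / 4" if "l \<ge> max H1 H2" for l
          using hol[of "L - u" L l] H1[of l] u that by (simp add: dist_norm)
        from this[OF hk(1)] this[OF hk(2)] H2[of h k] hk
        show "dist (S h a) (S k a) < \<epsilon>"
          unfolding aL using dist_triangle[of "S h L" "S k L" "S h (L - u)"]
            dist_triangle[of "S h (L - u)" "S k L" "S k (L - u)"] \<epsilon> by (simp add: dist_commute)
      qed
    qed
  qed (use Cauchy0 a in auto)
  define T where "T a = lim (\<lambda>h. S h a)" for a
  have T: "(\<lambda>h. S h a) \<longlonglongrightarrow> T a" if "0 \<le> a" "a \<le> L" for a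
    using Cauchy[OF that] by (simp add: T_def Cauchy_convergent convergent_LIMSEQ_iff[symmetric])
  have chordT: "norm (c b - c a - (b - a) *\<^sub>R T a) \<le> (b - a) * \<omega> (b - a)"
    if ab: "0 \<le> a" "a < b" "b \<le> L" for a b
  proof (rule LIMSEQ_le)
    show "(\<lambda>h. norm (c b - c a - (b - a) *\<^sub>R S h a)) \<longlonglongrightarrow> norm (c b - c a - (b - a) *\<^sub>R T a)"
      using ab by (intro tendsto_intros T) auto
    have "(\<lambda>h. 4 * \<mu> h + \<delta> h + (b - a + \<mu> h) * \<omega> (b - a + \<mu> h)) \<longlonglongrightarrow> 4 * 0 + 0 + (b - a + 0) * \<omega> (b - a)"
      using ab by (intro tendsto_intros \<mu> \<delta> \<omega>lim) auto
    then show "(\<lambda>h. 4 * \<mu> h + \<delta> h + (b - a + \<mu> h) * \<omega> (b - a + \<mu> h)) \<longlonglongrightarrow> (b - a) * \<omega> (b - a)" by simp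
    show "\<exists>N. \<forall>h\<ge>N. norm (c b - c a - (b - a) *\<^sub>R S h a) \<le> 4 * \<mu> h + \<delta> h + (b - a + \<mu> h) * \<omega> (b - a + \<mu> h)"
      using chord[of a b] ab by (auto simp: \<omega>_def)
  qed
  have holT: "norm (T b - T a) \<le> \<omega> (b - a)" if ab: "0 \<le> a" "a < b" "b \<le> L" for a b
  proof (rule LIMSEQ_le)
    show "(\<lambda>h. norm (S h b - S h a)) \<longlonglongrightarrow> norm (T b - T a)"
      using ab by (intro tendsto_intros T) auto
    show "(\<lambda>h. \<omega> (b - a + \<mu> h)) \<longlonglongrightarrow> \<omega> (b - a)" using ab by (intro \<omega>lim) auto
  qed (use hol[of a b] ab in auto)
  show thesis
  proof (rule that[of T])
    fix k and y :: "nat \<Rightarrow> real"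
    assume y: "\<And>j. j < k \<Longrightarrow> y j < y (Suc j)" "0 \<le> y 0" "y k \<le> L"
    have ym: "y i \<le> y j" if "i \<le> j" "j \<le> k" for i j
      using that by (induction rule: dec_induct) (use y(1) in \<open>auto intro: order_trans[OF _ less_imp_le]\<close>)
    have rng: "0 \<le> y j \<and> y j \<le> L" if "j \<le> k" for j using ym[of 0 j] ym[of j k] y that by auto
    show "(\<Sum>j<k. norm (T (y (Suc j)) - T (y j)) powr p / (y (Suc j) - y j) powr (p - 1)) \<le> M"
    proof (rule LIMSEQ_le_const2)
      show "(\<lambda>h. \<Sum>j<k. norm (S h (y (Suc j)) - S h (y j)) powr p / (y (Suc j) - y j + \<mu> h) powr (p - 1))
        \<longlonglongrightarrow> (\<Sum>j<k. norm (T (y (Suc j)) - T (y j)) powr p / (y (Suc j) - y j) powr (p - 1))"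
      proof (rule tendsto_sum)
        fix j assume "j \<in> {..<k}"
        then have j: "y j < y (Suc j)" "0 \<le> y j" "y j \<le> L" "0 \<le> y (Suc j)" "y (Suc j) \<le> L"
          using y(1) rng[of j] rng[of "Suc j"] by auto
        have "(\<lambda>h. norm (S h (y (Suc j)) - S h (y j)) powr p / (y (Suc j) - y j + \<mu> h) powr (p - 1))
          \<longlonglongrightarrow> norm (T (y (Suc j)) - T (y j)) powr p / (y (Suc j) - y j + 0) powr (p - 1)"
          using j p by (intro tendsto_divide tendsto_powr' tendsto_intros T \<mu>) auto
        then show "(\<lambda>h. norm (S h (y (Suc j)) - S h (y j)) powr p / (y (Suc j) - y j + \<mu> h) powr (p - 1))
          \<longlonglongrightarrow> norm (T (y (Suc j)) - T (y j)) powr p / (y (Suc j) - y j) powr (p - 1)" by simp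
      qed
      show "\<exists>N. \<forall>h\<ge>N. (\<Sum>j<k. norm (S h (y (Suc j)) - S h (y j)) powr p / (y (Suc j) - y j + \<mu> h) powr (p - 1)) \<le> M"
        using Riesz[of k y] y less_imp_le by blast
    qed
  next
    fix a assume a: "0 < a" "a < L"
    \<comment> \<open>To the right of a the chord estimate applies as it stands. To the left the
      chord starts at y and involves T y; replacing T y by T a costs a second \<omega>, whence the
      factor 2.\<close>
    have est: "norm ((c y - c a - (y - a) *\<^sub>R T a) /\<^sub>R \<bar>y - a\<bar>) \<le> 2 * \<omega> \<bar>y - a\<bar>"
      if y: "y \<noteq> a" "0 < y" "y < L" for y
    proof (cases "y > a")
      case True
      then have "norm (c y - c a - (y - a) *\<^sub>R T a) \<le> (y - a) * \<omega> (y - a)" using chordT a y by simp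
      then have "norm ((c y - c a - (y - a) *\<^sub>R T a) /\<^sub>R \<bar>y - a\<bar>) \<le> \<omega> (y - a)"
        using True scale by simp
      then show ?thesis using \<omega>0[of "y - a"] True by simp
    next
      case False
      then have ya: "y < a" using y by simp
      have "c y - c a - (y - a) *\<^sub>R T a = - (c a - c y - (a - y) *\<^sub>R T y) + (a - y) *\<^sub>R (T a - T y)"
        by (simp add: algebra_simps)
      then have "norm (c y - c a - (y - a) *\<^sub>R T a) \<le> norm (c a - c y - (a - y) *\<^sub>R T y) + norm ((a - y) *\<^sub>R (T a - T y))"
        by (metis norm_minus_cancel norm_triangle_ineq)
      also have "\<dots> \<le> (a - y) * \<omega> (a - y) + (a - y) * \<omega> (a - y)"
        using chordT[of y a] holT[of y a] ya y a by (intro add_mono) auto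
      finally have "norm (c y - c a - (y - a) *\<^sub>R T a) \<le> \<bar>y - a\<bar> * (2 * \<omega> \<bar>y - a\<bar>)" using ya by (simp add: algebra_simps)
      then show ?thesis using ya by (intro scale) auto
    qed
    have "((\<lambda>y. \<omega> \<bar>y - a\<bar>) \<longlongrightarrow> 0) (at a)"
    proof (rule filterlim_compose[OF \<omega>lim0])
      show "filterlim (\<lambda>y. \<bar>y - a\<bar>) (at_right 0) (at a)"
        unfolding filterlim_at by (auto intro!: tendsto_eq_intros simp: eventually_at_filter)
    qed
    then have "((\<lambda>y. 2 * \<omega> \<bar>y - a\<bar>) \<longlongrightarrow> 0) (at a)" by (rule tendsto_mult_right_zero)
    moreover have "eventually (\<lambda>y. norm ((c y - c a - (y - a) *\<^sub>R T a) /\<^sub>R \<bar>y - a\<bar>) \<le> 2 * \<omega> \<bar>y - a\<bar>) (at a)"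
    proof -
      have "eventually (\<lambda>y. y \<in> {0<..<L}) (at a)" using a by (intro eventually_at_in_open') auto
      moreover have "eventually (\<lambda>y. y \<noteq> a) (at a)" by (simp add: eventually_at_filter)
      ultimately show ?thesis by eventually_elim (use est in auto)
    qed
    ultimately have "((\<lambda>y. (c y - c a - (y - a) *\<^sub>R T a) /\<^sub>R \<bar>y - a\<bar>) \<longlongrightarrow> 0) (at a)"
      by (rule Lim_null_comparison[rotated])
    then show "(c has_vector_derivative T a) (at a)"
      unfolding has_vector_derivative_def has_derivative_iff_norm
      by (simp add: bounded_linear_scaleR_left tendsto_norm_zero_iff[symmetric, of "\<lambda>y. (c y - c a - (y - a) *\<^sub>R T a) /\<^sub>R \<bar>y - a\<bar>"] divide_inverse mult.commute)
  qed
qed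

section \<open>Length, modulus and mesh of partitions of an arc-length curve\<close>

lemma is_partition_nth:
  assumes t: "is_partition a b t"
  shows "i < length t \<Longrightarrow> a \<le> t ! i \<and> t ! i \<le> b" "t ! 0 = a" "t ! (length t - 1) = b"
    "Suc i < length t \<Longrightarrow> t ! i < t ! Suc i" "0 < length t"
proof -
  have ne: "t \<noteq> []" and s: "sorted_wrt (<) t" and h: "hd t = a" and l: "last t = b"
    using t by (auto simp: is_partition_def)
  show 0: "t ! 0 = a" "t ! (length t - 1) = b" using ne h l by (auto simp: hd_conv_nth last_conv_nth)
  have lt: "t ! i < t ! j" if "i < j" "j < length t" for i j using s that by (auto simp: sorted_wrt_iff_nth_less)
  show "Suc i < length t \<Longrightarrow> t ! i < t ! Suc i" using lt by simp
  show "0 < length t" using ne by simp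
  show "a \<le> t ! i \<and> t ! i \<le> b" if i: "i < length t"
  proof
    show "a \<le> t ! i" using lt[of 0 i] 0 i by (cases "i = 0") auto
    show "t ! i \<le> b"
    proof (cases "i = length t - 1")
      case False
      then have "i < length t - 1" "length t - 1 < length t" using i by linarith+
      then show ?thesis using lt[of i "length t - 1"] 0(2) i by simp
    qed (use 0 in simp)
  qed
qed

lemma sum_nth_dist:
  "(\<Sum>i = 1..<length t. ennreal (dist (c (t ! (i - 1))) (c (t ! i))))
    = ennreal (\<Sum>j<length t - 1. dist (c (t ! j)) (c (t ! Suc j)))"
proof (cases t)
  case (Cons a u)
  have "(\<Sum>i = 1..<length t. ennreal (dist (c (t ! (i - 1))) (c (t ! i))))
     = (\<Sum>j<length t - 1. ennreal (dist (c (t ! j)) (c (t ! Suc j))))"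
    using Cons sum.atLeast_Suc_lessThan_Suc_shift[of "\<lambda>i. ennreal (dist (c (t ! (i - 1))) (c (t ! i)))" 0 "length u"]
    by (simp add: lessThan_atLeast0)
  then show ?thesis by (simp add: sum_ennreal)
qed simp

lemma arclength_curve_Lipschitz:
  fixes c :: "real \<Rightarrow> 'a::real_normed_vector"
  assumes c: "arclength_curve L c" and st: "0 \<le> s" "s \<le> t" "t \<le> L"
  shows "norm (c t - c s) \<le> t - s"
proof (cases "s = t")
  case False
  have "is_partition s t [s, t]" using st False by (auto simp: is_partition_def)
  then have "(\<Sum>i = 1..<length [s, t]. ennreal (dist (c ([s, t] ! (i - 1))) (c ([s, t] ! i)))) \<le> curve_length c s t"
    unfolding curve_length_def by (intro SUP_upper) simp
  also have "curve_length c s t = ennreal (t - s)" using c st by (auto simp: arclength_curve_def)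
  finally have "ennreal (dist (c s) (c t)) \<le> ennreal (t - s)" by (simp add: numeral_2_eq_2)
  then show ?thesis using st by (simp add: dist_norm norm_minus_commute)
qed simp

lemma arclength_curve_inscribed:
  fixes c :: "real \<Rightarrow> 'a::real_normed_vector"
  assumes c: "arclength_curve L c" and ab: "0 \<le> a" "a < b" "b \<le> L" and \<epsilon>: "0 < \<epsilon>"
  obtains t where "is_partition a b t" "b - a - \<epsilon> < (\<Sum>j<length t - 1. norm (c (t ! Suc j) - c (t ! j)))"
proof -
  have "ennreal (b - a - \<epsilon>) < ennreal (b - a)" using ab \<epsilon> by (auto simp: ennreal_less_iff intro!: ennreal_lessI)
  also have "ennreal (b - a) = curve_length c a b" using c ab by (auto simp: arclength_curve_def)
  finally obtain t where t: "is_partition a b t"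
    "ennreal (b - a - \<epsilon>) < (\<Sum>i = 1..<length t. ennreal (dist (c (t ! (i - 1))) (c (t ! i))))"
    unfolding curve_length_def by (auto simp: less_SUP_iff)
  have "b - a - \<epsilon> < (\<Sum>j<length t - 1. norm (c (t ! Suc j) - c (t ! j)))"
  \<comment> \<open>\<open>ennreal\<close> sends negative reals to 0, so the inequality can be read
    back in the reals only for a nonnegative left side; a negative one lies below any sum of
    norms.\<close>
  proof (cases "b - a - \<epsilon> \<ge> 0")
    case True
    then show ?thesis using t(2) unfolding sum_nth_dist
      by (subst (asm) ennreal_less_iff) (auto simp: dist_norm norm_minus_commute)
  next
    case False
    have "0 \<le> (\<Sum>j<length t - 1. norm (c (t ! Suc j) - c (t ! j)))" by (intro sum_nonneg) auto
    then show ?thesis using False by linarith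
  qed
  with t(1) show thesis by (rule that)
qed

text \<open>On an interval of constancy all inscribed polygons would have length 0, against the
  positive length b - a.\<close>

lemma arclength_curve_not_constant:
  fixes c :: "real \<Rightarrow> 'a::real_normed_vector"
  assumes c: "arclength_curve L c" and ab: "0 \<le> a" "a < b" "b \<le> L"
  obtains u v where "u \<in> {a..b}" "v \<in> {a..b}" "c u \<noteq> c v"
proof -
  obtain t where t: "is_partition a b t" "b - a - (b - a) / 2 < (\<Sum>j<length t - 1. norm (c (t ! Suc j) - c (t ! j)))"
    using arclength_curve_inscribed[OF c ab, of "(b - a) / 2"] ab by auto
  have "\<exists>j<length t - 1. c (t ! Suc j) \<noteq> c (t ! j)"
  proof (rule ccontr)
    assume "\<not> ?thesis"
    then have "(\<Sum>j<length t - 1. norm (c (t ! Suc j) - c (t ! j))) = 0" by (intro sum.neutral) auto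
    then show False using t(2) ab by (simp add: field_simps)
  qed
  then obtain j where "j < length t - 1" "c (t ! Suc j) \<noteq> c (t ! j)" by blast
  then show thesis using is_partition_nth(1)[OF t(1), of j] is_partition_nth(1)[OF t(1), of "Suc j"]
    by (intro that[of "t ! Suc j" "t ! j"]) auto
qed

text \<open>Cut [0, L] into N cells of length h with 2h < \<delta> and pick in each cell two points
  with different images; \<open>\<epsilon>\<close> is the smallest of the N distances. A parameter
  interval longer than 2h contains a whole cell, so its arc has diameter at least
  \<open>\<epsilon>\<close>.\<close>

lemma small_modulus_small_mesh:
  fixes c :: "real \<Rightarrow> 'a::euclidean_space"
  assumes c: "arclength_curve L c" and L: "0 < L" and \<delta>: "0 < \<delta>"
  obtains \<epsilon> where "0 < \<epsilon>"
    "\<And>t i. is_partition 0 L t \<Longrightarrow> modulus c t < \<epsilon> \<Longrightarrow> Suc i < length t \<Longrightarrow> t ! Suc i - t ! i \<le> \<delta>"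
proof -
  obtain N :: nat where N: "2 * L / \<delta> < real N" using reals_Archimedean2 by blast
  then have N0: "0 < real N" using L \<delta> by (smt (verit) divide_pos_pos)
  define h where "h = L / real N"
  have h: "h > 0" "2 * h < \<delta>" using L N0 N \<delta> by (auto simp: h_def field_simps)
  have "\<forall>k\<in>{..<N}. \<exists>u. fst u \<in> {real k * h..real (Suc k) * h} \<and> snd u \<in> {real k * h..real (Suc k) * h} \<and> c (fst u) \<noteq> c (snd u)"
  proof
    fix k assume k: "k \<in> {..<N}"
    have "real (Suc k) * h \<le> real N * h" using k h by (intro mult_right_mono) auto
    then have "real (Suc k) * h \<le> L" using N0 by (simp add: h_def)
    moreover have "0 \<le> real k * h" "real k * h < real (Suc k) * h" using h by (auto simp: algebra_simps)
    ultimately obtain u w where "u \<in> {real k * h..real (Suc k) * h}" "w \<in> {real k * h..real (Suc k) * h}" "c u \<noteq> c w"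
      using arclength_curve_not_constant[OF c] by blast
    then show "\<exists>u. fst u \<in> {real k * h..real (Suc k) * h} \<and> snd u \<in> {real k * h..real (Suc k) * h} \<and> c (fst u) \<noteq> c (snd u)"
      by (intro exI[of _ "(u, w)"]) auto
  qed
  from bchoice[OF this] obtain u where u: "\<And>k. k < N \<Longrightarrow> fst (u k) \<in> {real k * h..real (Suc k) * h} \<and>
      snd (u k) \<in> {real k * h..real (Suc k) * h} \<and> c (fst (u k)) \<noteq> c (snd (u k))" by auto
  define \<epsilon> where "\<epsilon> = Min ((\<lambda>k. dist (c (fst (u k))) (c (snd (u k)))) ` {..<N})"
  have \<epsilon>0: "\<epsilon> > 0" unfolding \<epsilon>_def using N0 u by (subst Min_gr_iff) auto
  show thesis
  proof (rule that[OF \<epsilon>0])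
    fix t i assume t: "is_partition 0 L t" and m: "modulus c t < \<epsilon>" and i: "Suc i < length t"
    show "t ! Suc i - t ! i \<le> \<delta>"
    proof (rule ccontr)
      assume "\<not> ?thesis"
      then have big: "t ! Suc i - t ! i > 2 * h" using h by simp
      have ti: "0 \<le> t ! i" "t ! Suc i \<le> L"
        using is_partition_nth(1)[OF t, of i] is_partition_nth(1)[OF t, of "Suc i"] i by auto
      \<comment> \<open>The first cell starting at or after t_i. It begins within h of t_i, so it
        ends before t_(i+1).\<close>
      define k where "k = nat \<lceil>t ! i / h\<rceil>"
      have "0 \<le> t ! i / h" using ti h by simp
      then have k: "t ! i / h \<le> real k" "real k < t ! i / h + 1" unfolding k_def by linarith+
      have k1: "t ! i \<le> real k * h" using k(1) h by (simp add: field_simps)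
      have k2: "real (Suc k) * h < t ! Suc i" using k(2) h big by (simp add: field_simps)
      have "real (Suc k) * h < real N * h" using k2 ti N0 by (simp add: h_def)
      then have kN: "k < N" using h by simp
      have "dist (c (fst (u k))) (c (snd (u k))) \<le> diameter (c ` {t ! i..t ! Suc i})"
      proof (rule diameter_bounded_bound)
        have "continuous_on {t ! i..t ! Suc i} c"
          using c ti by (auto simp: arclength_curve_def elim: continuous_on_subset)
        then show "bounded (c ` {t ! i..t ! Suc i})"
          using compact_continuous_image[of "{t ! i..t ! Suc i}" c] by (simp add: compact_imp_bounded)
      qed (use u[OF kN] k1 k2 in auto)
      also have "\<dots> \<le> modulus c t"
        unfolding modulus_def using i by (intro Max_ge) (auto intro!: image_eqI[of _ _ "Suc i"])
      finally have "dist (c (fst (u k))) (c (snd (u k))) < \<epsilon>" using m by simp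
      moreover have "\<epsilon> \<le> dist (c (fst (u k))) (c (snd (u k)))" unfolding \<epsilon>_def using kN by (intro Min_le) auto
      ultimately show False by simp
    qed
  qed
qed

text \<open>One fixed polygonal with vertices on the curve already has length above L - \<delta>/2.
  A polygonal of mesh at most m is shorter than it by at most 2m per chord, and
  \<open>\<eta>\<close> is chosen to make this total at most \<delta>/2.\<close>

lemma small_mesh_polygon_length:
  fixes c :: "real \<Rightarrow> 'a::real_inner"
  assumes c: "arclength_curve L c" and L: "0 < L" and \<delta>: "0 < \<delta>"
  obtains \<eta> where "0 < \<eta>"
    "\<And>m n x. curve_partition c L m n x \<Longrightarrow> m \<le> \<eta> \<Longrightarrow> L - (\<Sum>i<n. norm (c (x (Suc i)) - c (x i))) \<le> \<delta>"
proof -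
  obtain \<tau> where \<tau>: "is_partition 0 L \<tau>" "L - 0 - \<delta> / 2 < (\<Sum>j<length \<tau> - 1. norm (c (\<tau> ! Suc j) - c (\<tau> ! j)))"
    using arclength_curve_inscribed[OF c, of 0 L "\<delta> / 2"] L \<delta> by auto
  define \<eta> where "\<eta> = \<delta> / (4 * real (length \<tau>))"
  have l: "0 < length \<tau>" using is_partition_nth(5)[OF \<tau>(1)] .
  show thesis
  proof (rule that[of \<eta>])
    show "\<eta> > 0" using l \<delta> by (simp add: \<eta>_def)
    fix m n x assume "curve_partition c L m n x" and m: "m \<le> \<eta>"
    then interpret P: curve_partition c L m n x "\<lambda>i. c (x (Suc i)) - c (x i)" by simp
    have "(\<Sum>j<length \<tau> - 1. norm (c (\<tau> ! Suc j) - c (\<tau> ! j)))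
      \<le> (\<Sum>i<n. norm (c (x (Suc i)) - c (x i))) + 2 * m * real (length \<tau> - 1)"
      using is_partition_nth[OF \<tau>(1)] by (intro P.inscribed_length_le) (auto intro!: less_imp_le)
    also have "2 * m * real (length \<tau> - 1) \<le> 2 * \<eta> * real (length \<tau>)"
      using m l P.m_pos by (intro mult_mono) auto
    also have "2 * \<eta> * real (length \<tau>) = \<delta> / 2" using l by (simp add: \<eta>_def field_simps)
    finally show "L - (\<Sum>i<n. norm (c (x (Suc i)) - c (x i))) \<le> \<delta>" using \<tau>(2) by simp
  qed
qed

section \<open>The theorem of Riesz on indefinite integrals of p-integrable functions\<close>

lemma UN_Ioc_nat_eq_UNIV: "(\<Union>i. {- real i<..real i}) = UNIV"
proof safe
  fix x :: real
  obtain n :: nat where "\<bar>x\<bar> < n" using reals_Archimedean2 by blast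
  then show "x \<in> (\<Union>i. {- real i<..real i})" by (intro UN_I[of n]) auto
qed simp

text \<open>With \<open>\<beta>\<close> the interval measure of the difference of two distribution functions, this extends
  comparisons of measures from half-open intervals to Borel sets.\<close>

lemma borel_measure_sum_eqI:
  fixes \<alpha> \<beta> \<gamma> :: "real measure"
  assumes [measurable_cong]: "sets \<alpha> = sets borel" "sets \<beta> = sets borel" "sets \<gamma> = sets borel"
    and Ioc: "\<And>a b. a \<le> b \<Longrightarrow> emeasure \<alpha> {a<..b} + emeasure \<beta> {a<..b} = emeasure \<gamma> {a<..b}"
    and fin: "\<And>a b. a \<le> b \<Longrightarrow> emeasure \<gamma> {a<..b} \<noteq> \<infinity>"
    and A: "A \<in> sets borel"
  shows "emeasure \<alpha> A + emeasure \<beta> A = emeasure \<gamma> A"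
proof -
  \<comment> \<open>The set function \<alpha> + \<beta> made into a measure, so that uniqueness of
    measures on an intersection-stable generator, the half-open intervals, applies to it.\<close>
  define S where "S = measure_of UNIV (sets borel) (\<lambda>A. emeasure \<alpha> A + emeasure \<beta> A)"
  have S: "emeasure S A = emeasure \<alpha> A + emeasure \<beta> A" if "A \<in> sets borel" for A
    unfolding S_def
  proof (rule emeasure_measure_of_sigma[OF _ _ _ that])
    show "sigma_algebra UNIV (sets (borel :: real measure))"
      using sets.sigma_algebra_axioms[of "borel :: real measure"] by simp
    show "positive (sets borel) (\<lambda>A. emeasure \<alpha> A + emeasure \<beta> A)"
      by (simp add: positive_def)
    show "countably_additive (sets borel) (\<lambda>A. emeasure \<alpha> A + emeasure \<beta> A)"
    proof (rule countably_additiveI)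
      fix X :: "nat \<Rightarrow> real set"
      assume X: "range X \<subseteq> sets borel" "disjoint_family X" "(\<Union>i. X i) \<in> sets borel"
      have "(\<Sum>i. emeasure \<alpha> (X i) + emeasure \<beta> (X i)) = (\<Sum>i. emeasure \<alpha> (X i)) + (\<Sum>i. emeasure \<beta> (X i))"
        by (intro suminf_add[symmetric]) auto
      also have "\<dots> = emeasure \<alpha> (\<Union>i. X i) + emeasure \<beta> (\<Union>i. X i)"
        using X assms(1,2) by (auto intro!: arg_cong2[where f="(+)"] suminf_emeasure)
      finally show "(\<Sum>i. emeasure \<alpha> (X i) + emeasure \<beta> (X i))
          = emeasure \<alpha> (\<Union>i. X i) + emeasure \<beta> (\<Union>i. X i)" .
    qed
  qed
  have "S = \<gamma>"
  proof (rule measure_eqI_generator_eq[where E="range (\<lambda>(a, b). {a <.. b::real})" and \<Omega>=UNIV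
          and A="\<lambda>n. {- real n<..real n}"])
    show "Int_stable (range (\<lambda>(a, b). {a <.. b::real}))"
    proof (rule Int_stableI)
      fix X Y assume "X \<in> range (\<lambda>(a, b). {a <.. b::real})" "Y \<in> range (\<lambda>(a, b). {a <.. b::real})"
      then obtain a b c d where "X = {a<..b}" "Y = {c<..d}" by auto
      then have "X \<inter> Y = {max a c<..min b d}" by auto
      then show "X \<inter> Y \<in> range (\<lambda>(a, b). {a <.. b::real})" by auto
    qed
    show "emeasure S X = emeasure \<gamma> X" if "X \<in> range (\<lambda>(a, b). {a <.. b::real})" for X
    proof -
      from that obtain a b where X: "X = {a<..b}" by auto
      show ?thesis
      proof (cases "a \<le> b")
        case True then show ?thesis using Ioc[OF True] S[of X] X by simp
      qed (simp add: X)
    qed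
    have borel: "sets borel = sigma_sets UNIV (range (\<lambda>(a, b). {a <.. b::real}))"
      by (subst borel_sigma_sets_Ioc) simp
    show "sets S = sigma_sets UNIV (range (\<lambda>(a, b). {a <.. b::real}))"
      using sets.sigma_sets_eq[of "borel :: real measure"] borel
      by (simp add: S_def sets_measure_of_conv)
    show "sets \<gamma> = sigma_sets UNIV (range (\<lambda>(a, b). {a <.. b::real}))"
      using assms(3) borel by simp
    show "(\<Union>i. {- real i<..real i}) = UNIV" by (rule UN_Ioc_nat_eq_UNIV)
    show "emeasure S {- real n<..real n} \<noteq> \<infinity>" for n
      using fin[of "- real n" "real n"] Ioc[of "- real n" "real n"] S[of "{- real n<..real n}"]
      by simp
  qed auto
  then show ?thesis using S[OF A] by simp
qed

text \<open>Boundedness makes \<open>interval_measure F\<close> finite, as the Radon-Nikodym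
  derivatives below require. No limit at minus infinity is prescribed, since only increments of F
  matter.\<close>

definition distribution_like :: "(real \<Rightarrow> real) \<Rightarrow> bool" where
  "distribution_like F \<longleftrightarrow> mono F \<and> (\<forall>a. continuous (at_right a) F) \<and> bounded (range F)"

lemma emeasure_interval_measure_UNIV_le:
  assumes F: "distribution_like F" and M: "\<And>x y. F y - F x \<le> M"
  shows "emeasure (interval_measure F) UNIV \<le> ennreal M"
proof -
  have "emeasure (interval_measure F) (\<Union>i. {- real i<..real i})
      = (SUP i. emeasure (interval_measure F) {- real i<..real i})"
    by (intro SUP_emeasure_incseq[symmetric]) (auto simp: incseq_def)
  also have "\<dots> \<le> ennreal M"
  proof (rule SUP_least)
    fix i
    show "emeasure (interval_measure F) {- real i<..real i} \<le> ennreal M"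
      using F M by (subst emeasure_interval_measure_Ioc)
        (auto simp: distribution_like_def mono_def intro!: ennreal_leI)
  qed
  finally show ?thesis by (simp only: UN_Ioc_nat_eq_UNIV)
qed

lemma finite_interval_measure:
  assumes F: "distribution_like F"
  shows "finite_measure (interval_measure F)"
proof -
  obtain B where B: "\<And>x. \<bar>F x\<bar> \<le> B"
    using F by (auto simp: distribution_like_def bounded_iff)
  have "F y - F x \<le> 2 * B" for x y using B[of x] B[of y] by linarith
  from emeasure_interval_measure_UNIV_le[OF F this]
  show ?thesis by (intro finite_measureI) (auto simp: top_unique)
qed

lemma distribution_like_add:
  "distribution_like F \<Longrightarrow> distribution_like G \<Longrightarrow> distribution_like (\<lambda>x. F x + G x)"
  unfolding distribution_like_def
  by (auto simp: mono_def add_mono intro!: continuous_add bounded_plus_comp)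

lemma emeasure_interval_measure_add:
  assumes F: "distribution_like F" and G: "distribution_like G" and A: "A \<in> sets borel"
  shows "emeasure (interval_measure F) A + emeasure (interval_measure G) A
    = emeasure (interval_measure (\<lambda>x. F x + G x)) A"
proof (rule borel_measure_sum_eqI[OF _ _ _ _ _ A])
  note FG = distribution_like_add[OF F G]
  fix a b :: real assume ab: "a \<le> b"
  show "emeasure (interval_measure F) {a<..b} + emeasure (interval_measure G) {a<..b}
      = emeasure (interval_measure (\<lambda>x. F x + G x)) {a<..b}"
    using F G FG ab unfolding distribution_like_def mono_def
    by (simp add: emeasure_interval_measure_Ioc flip: ennreal_plus)
  show "emeasure (interval_measure (\<lambda>x. F x + G x)) {a<..b} \<noteq> \<infinity>"
    using FG ab unfolding distribution_like_def mono_def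
    by (simp add: emeasure_interval_measure_Ioc)
qed auto

text \<open>The monotonicity assumption says dG \<le> 2 dK, so Radon-Nikodym applies. The factor 2
  accommodates G = F + K where F is a signed function whose variation is dominated by dK: then dG
  lies between 0 and 2 dK.\<close>

lemma distribution_like_density:
  assumes K: "distribution_like K" and G: "distribution_like G"
    and KG: "mono (\<lambda>x. K x + K x - G x)"
  obtains D where "D \<in> borel_measurable borel" "\<And>x. 0 \<le> D x"
    "density (interval_measure K) (\<lambda>x. ennreal (D x)) = interval_measure G"
proof -
  note KK = distribution_like_add[OF K K]
  have D: "distribution_like (\<lambda>x. K x + K x - G x)"
    using KK G KG unfolding distribution_like_def
    by (auto intro!: continuous_diff bounded_minus_comp)
  interpret K: finite_measure "interval_measure K" by (rule finite_interval_measure[OF K])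
  interpret G: finite_measure "interval_measure G" by (rule finite_interval_measure[OF G])
  have ac: "absolutely_continuous (interval_measure K) (interval_measure G)"
    unfolding absolutely_continuous_def
  proof
    fix A assume "A \<in> null_sets (interval_measure K)"
    then have A: "A \<in> sets borel" "emeasure (interval_measure K) A = 0" by (auto dest: null_setsD1)
    \<comment> \<open>dG and the nonnegative measure 2 dK - dG add up to 2 dK, so a null set of dK
      is a null set of dG.\<close>
    have "emeasure (interval_measure G) A + emeasure (interval_measure (\<lambda>x. K x + K x - G x)) A
      = emeasure (interval_measure K) A + emeasure (interval_measure K) A"
      using emeasure_interval_measure_add[OF G D A(1)] emeasure_interval_measure_add[OF K K A(1)] by simp
    then show "A \<in> null_sets (interval_measure G)" using A by auto
  qed
  obtain D where D: "D \<in> borel_measurable (interval_measure K)"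
    "AE x in interval_measure K. RN_deriv (interval_measure K) (interval_measure G) x = ennreal (D x)"
    "\<And>x. 0 \<le> D x"
    using K.real_RN_deriv[OF G.finite_measure_axioms ac] by auto
  have "density (interval_measure K) (\<lambda>x. ennreal (D x))
      = density (interval_measure K) (RN_deriv (interval_measure K) (interval_measure G))"
    using D by (intro density_cong) auto
  also have "\<dots> = interval_measure G" by (rule K.density_RN_deriv[OF ac]) simp
  finally show thesis using D by (intro that[of D]) auto
qed

text \<open>The indefinite integral G of u is nondecreasing, and on intervals the negative part of u
  plus dG equals the positive part. This extends to Borel sets; on the set where u < 0 the positive
  part has no mass, hence neither has the negative one.\<close>

lemma AE_nonneg_if_integral_Ioc_nonneg:
  fixes u :: "real \<Rightarrow> real"
  assumes fin: "finite_measure \<nu>" and sets[measurable_cong]: "sets \<nu> = sets borel"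
    and u: "integrable \<nu> u"
    and Ioc: "\<And>a b. a \<le> b \<Longrightarrow> 0 \<le> (LINT x:{a<..b}|\<nu>. u x)"
  shows "AE x in \<nu>. 0 \<le> u x"
proof -
  interpret finite_measure \<nu> by fact
  have si: "set_integrable \<nu> A u" if "A \<in> sets borel" for A
    using integrable_mult_indicator[of A \<nu> u] u that sets unfolding set_integrable_def by simp
  have [measurable]: "u \<in> borel_measurable borel" using u sets by (simp cong: measurable_cong_sets)
  define G where "G x = (LINT y:{..x}|\<nu>. u y)" for x
  have Gdiff: "G b - G a = (LINT x:{a<..b}|\<nu>. u x)" if "a \<le> b" for a b
  proof -
    have "{..b} = {..a} \<union> {a<..b}" using that by auto
    then have "G b = G a + (LINT x:{a<..b}|\<nu>. u x)"
      unfolding G_def by (subst set_integral_Un[symmetric]) (auto intro: si)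
    then show ?thesis by simp
  qed
  have G: "distribution_like G"
    unfolding distribution_like_def
  proof safe
    show "mono G" using Ioc Gdiff by (intro monoI) (metis diff_ge_0_iff_ge)
    show "bounded (range G)"
    proof (rule boundedI[of _ "LINT x|\<nu>. norm (u x)"], clarify)
      fix x
      have "norm (G x) \<le> (LINT y|\<nu>. norm (indicator {..x} y *\<^sub>R u y))"
        unfolding G_def set_lebesgue_integral_def by (rule integral_norm_bound)
      also have "\<dots> \<le> (LINT y|\<nu>. norm (u y))"
        using u si[of "{..x}"] unfolding set_integrable_def
        by (intro integral_mono) (auto simp: indicator_def)
      finally show "norm (G x) \<le> (LINT y|\<nu>. norm (u y))" .
    qed
    show "continuous (at_right a) G" for a
      unfolding continuous_within
    proof (rule tendsto_at_right_sequentially[of a "a+1"])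
      fix S :: "nat \<Rightarrow> real" assume S: "\<And>n. a < S n" "decseq S" "S \<longlonglongrightarrow> a"
      show "(\<lambda>n. G (S n)) \<longlonglongrightarrow> G a"
        unfolding G_def set_lebesgue_integral_def
      proof (rule integral_dominated_convergence[where w="\<lambda>x. norm (u x)"])
        show "AE x in \<nu>. (\<lambda>n. indicat_real {..S n} x *\<^sub>R u x) \<longlonglongrightarrow> indicat_real {..a} x *\<^sub>R u x"
        proof (rule AE_I2)
          fix x
          have "eventually (\<lambda>n. indicat_real {..S n} x *\<^sub>R u x = indicat_real {..a} x *\<^sub>R u x) sequentially"
          proof (cases "x \<le> a")
            case True
            then show ?thesis using S(1) by (auto intro!: always_eventually simp: indicator_def) (meson less_le_not_le order.trans)
          next
            case False
            then have "eventually (\<lambda>n. S n < x) sequentially" using S(3) order_tendstoD(2) by fastforce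
            then show ?thesis by eventually_elim (use False in \<open>auto simp: indicator_def\<close>)
          qed
          then show "(\<lambda>n. indicat_real {..S n} x *\<^sub>R u x) \<longlonglongrightarrow> indicat_real {..a} x *\<^sub>R u x"
            by (rule tendsto_eventually)
        qed
      qed (use u in \<open>auto simp: indicator_def\<close>)
    qed simp
  qed
  define N where "N = density \<nu> (\<lambda>x. ennreal (- u x))"
  define P where "P = density \<nu> (\<lambda>x. ennreal (u x))"
  have fin': "(\<integral>\<^sup>+x\<in>A. ennreal (u x) \<partial>\<nu>) < \<infinity>" "(\<integral>\<^sup>+x\<in>A. ennreal (- u x) \<partial>\<nu>) < \<infinity>"
    if "A \<in> sets borel" for A
  proof -
    have *: "(\<integral>\<^sup>+x. ennreal (norm (u x)) \<partial>\<nu>) < \<infinity>" using u by (simp add: integrable_iff_bounded)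
    have "(\<integral>\<^sup>+x\<in>A. ennreal (u x) \<partial>\<nu>) \<le> (\<integral>\<^sup>+x. ennreal (norm (u x)) \<partial>\<nu>)"
      by (intro nn_integral_mono) (auto simp: indicator_def intro!: ennreal_leI)
    moreover have "(\<integral>\<^sup>+x\<in>A. ennreal (- u x) \<partial>\<nu>) \<le> (\<integral>\<^sup>+x. ennreal (norm (u x)) \<partial>\<nu>)"
      by (intro nn_integral_mono) (auto simp: indicator_def intro!: ennreal_leI)
    ultimately show "(\<integral>\<^sup>+x\<in>A. ennreal (u x) \<partial>\<nu>) < \<infinity>" "(\<integral>\<^sup>+x\<in>A. ennreal (- u x) \<partial>\<nu>) < \<infinity>"
      using * by (auto intro: le_less_trans)
  qed
  define A where "A = {x. u x < 0}"
  have A[measurable]: "A \<in> sets borel" unfolding A_def by simp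
  have "emeasure N A + emeasure (interval_measure G) A = emeasure P A"
  proof (rule borel_measure_sum_eqI[OF _ _ _ _ _ A])
    fix a b :: real assume ab: "a \<le> b"
    define n where "n = (\<integral>\<^sup>+x\<in>{a<..b}. ennreal (- u x) \<partial>\<nu>)"
    define q where "q = (\<integral>\<^sup>+x\<in>{a<..b}. ennreal (u x) \<partial>\<nu>)"
    have nq: "n < \<infinity>" "q < \<infinity>" using fin'[of "{a<..b}"] by (simp_all add: n_def q_def)
    have "G b - G a = enn2real q - enn2real n"
      unfolding Gdiff[OF ab] set_lebesgue_integral_def n_def q_def
      using si[of "{a<..b}"] unfolding set_integrable_def
      by (subst real_lebesgue_integral_def) (auto intro!: arg_cong2[where f="(-)"] arg_cong[where f=enn2real]
          nn_integral_cong simp: indicator_def)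
    moreover have "0 \<le> G b - G a" using Ioc[OF ab] Gdiff[OF ab] by simp
    moreover have "emeasure (interval_measure G) {a<..b} = ennreal (G b - G a)"
      using G ab by (subst emeasure_interval_measure_Ioc) (auto simp: distribution_like_def mono_def)
    ultimately have "n + emeasure (interval_measure G) {a<..b} = q"
      using nq by (cases n; cases q) (auto simp flip: ennreal_plus)
    then show "emeasure N {a<..b} + emeasure (interval_measure G) {a<..b} = emeasure P {a<..b}"
      using sets by (simp add: N_def P_def emeasure_density n_def q_def)
    show "emeasure P {a<..b} \<noteq> \<infinity>"
      using sets nq by (simp add: P_def emeasure_density q_def)
  qed (auto simp: N_def P_def sets)
  moreover have "emeasure P A = 0"
    using sets by (simp add: P_def emeasure_density A_def nn_integral_0_iff_AE)
       (auto simp: indicator_def ennreal_neg)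
  ultimately have "emeasure N A = 0" by simp
  then have "AE x in \<nu>. ennreal (- u x) * indicator A x = 0"
    using sets by (simp add: N_def emeasure_density nn_integral_0_iff_AE)
  then show ?thesis by eventually_elim (auto simp: A_def indicator_def ennreal_eq_0_iff split: if_splits)
qed

lemma density_interval_measure_integral:
  fixes D :: "real \<Rightarrow> real"
  assumes G: "distribution_like G" and D[measurable]: "D \<in> borel_measurable borel" "\<And>x. 0 \<le> D x"
    and eq: "density \<nu> (\<lambda>x. ennreal (D x)) = interval_measure G" and [measurable_cong]: "sets \<nu> = sets borel"
  shows "integrable \<nu> D" and "\<And>a b. a \<le> b \<Longrightarrow> (LINT x:{a<..b}|\<nu>. D x) = G b - G a"
proof -
  interpret G: finite_measure "interval_measure G" by (rule finite_interval_measure[OF G])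
  have "integrable (density \<nu> (\<lambda>x. ennreal (D x))) (\<lambda>x. 1 :: real)" unfolding eq by simp
  then show "integrable \<nu> D" by (subst (asm) integrable_density) (use D in auto)
  fix a b :: real assume ab: "a \<le> b"
  have "(LINT x|density \<nu> (\<lambda>x. ennreal (D x)). indicat_real {a<..b} x) = G b - G a"
    unfolding eq using G ab by (simp add: distribution_like_def mono_def measure_interval_measure_Ioc)
  then show "(LINT x:{a<..b}|\<nu>. D x) = G b - G a"
    by (subst (asm) integral_density) (use D in \<open>auto simp: set_lebesgue_integral_def mult.commute\<close>)
qed

lemma distribution_like_clamp: "distribution_like (\<lambda>x. max 0 (min L x))"
  unfolding distribution_like_def
  by (auto simp: mono_def bounded_iff intro!: continuous_max continuous_min exI[of _ "\<bar>L\<bar>"])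

lemma interval_measure_clamp:
  assumes L: "0 < L"
  shows "interval_measure (\<lambda>x. max 0 (min L x)) = density lborel (\<lambda>x. ennreal (indicator {0..L} x))"
proof (rule measure_eqI)
  fix A assume "A \<in> sets (interval_measure (\<lambda>x. max 0 (min L x)))"
  then have A: "A \<in> sets borel" by simp
  have D: "emeasure (density lborel (\<lambda>x. ennreal (indicator {0..L} x))) {a<..b} = ennreal (max 0 (min L b) - max 0 (min L a))"
    if "a \<le> b" for a b
  proof -
    have "emeasure (density lborel (\<lambda>x. ennreal (indicator {0..L} x))) {a<..b}
       = (\<integral>\<^sup>+x. ennreal (indicator {0..L} x) * indicator {a<..b} x \<partial>lborel)"
      by (subst emeasure_density) auto
    also have "\<dots> = (\<integral>\<^sup>+x. indicator {max 0 (min L a)..max 0 (min L b)} x \<partial>lborel)"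
      by (rule nn_integral_cong_AE, use AE_lborel_singleton[of a] AE_lborel_singleton[of 0] AE_lborel_singleton[of L] in eventually_elim)
         (use L that in \<open>auto simp: indicator_def max_def min_def split: if_splits\<close>)
    also have "\<dots> = ennreal (max 0 (min L b) - max 0 (min L a))"
      using that by (simp add: max_def min_def)
    finally show ?thesis .
  qed
  \<comment> \<open>With the zero measure as second summand the comparison of sums becomes plain
    uniqueness of measures.\<close>
  have "emeasure (interval_measure (\<lambda>x. max 0 (min L x))) A + emeasure (null_measure borel) A
     = emeasure (density lborel (\<lambda>x. ennreal (indicator {0..L} x))) A"
    by (rule borel_measure_sum_eqI[OF _ _ _ _ _ A])
       (use distribution_like_clamp[of L] in \<open>auto simp: D emeasure_interval_measure_Ioc distribution_like_def mono_def\<close>)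
  then show "emeasure (interval_measure (\<lambda>x. max 0 (min L x))) A
     = emeasure (density lborel (\<lambda>x. ennreal (indicator {0..L} x))) A" by simp
qed simp

text \<open>\<open>E\<close> may have a singular part, so everything is differentiated with respect to the sum \<open>\<nu>\<close> of \<open>dE\<close> and
  Lebesgue measure on \<open>[0, L]\<close>: let \<open>e\<close>, \<open>k\<close>, \<open>f\<close> be the densities of \<open>dE\<close>, of Lebesgue measure and of \<open>dT\<close>.
  By Young's inequality \<open>p |z|\<^sup>p\<^sup>-\<^sup>2 z \<bullet> f \<le> e + (p - 1) |z|\<^sup>p k\<close> holds on intervals, hence almost
  everywhere, simultaneously for all \<open>z\<close> by density of a countable set. Letting \<open>z\<close> tend to infinity
  gives \<open>f = 0\<close> where \<open>k = 0\<close>; taking \<open>z = f / k\<close> elsewhere gives \<open>|f / k|\<^sup>p k \<le> e\<close>. So \<open>g = f / k\<close>.\<close>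

lemma Riesz_density:
  fixes T :: "real \<Rightarrow> 'a::euclidean_space"
  assumes p: "p > 1" and L: "0 < L"
    and E: "distribution_like E" and M: "\<And>x y. E y - E x \<le> M"
    and TE: "\<And>a b. a \<le> b \<Longrightarrow>
      norm (T b - T a) powr p \<le> (E b - E a) * (max 0 (min L b) - max 0 (min L a)) powr (p - 1)"
  obtains g where "g \<in> borel_measurable borel" "set_integrable lborel {0..L} g"
    "\<And>a b. 0 \<le> a \<Longrightarrow> a \<le> b \<Longrightarrow> b \<le> L \<Longrightarrow> T b - T a = (LINT x:{a..b}|lborel. g x)"
    "(\<integral>\<^sup>+x\<in>{0..L}. ennreal (norm (g x) powr p) \<partial>lborel) \<le> ennreal M"
proof -
  define cl where "cl x = max 0 (min L x)" for x
  have cl: "distribution_like cl" unfolding cl_def by (rule distribution_like_clamp)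
  have clm: "a \<le> b \<Longrightarrow> cl a \<le> cl b" for a b by (auto simp: cl_def)
  have Em: "a \<le> b \<Longrightarrow> E a \<le> E b" for a b using E by (auto simp: distribution_like_def mono_def)
  define K where "K x = E x + cl x" for x
  have K: "distribution_like K" unfolding K_def by (rule distribution_like_add[OF E cl])
  \<comment> \<open>The slope s is free and the inequality is homogeneous of degree one in the
    increments of T, E and the clamp; in this form, unlike \<open>TE\<close>, it can be passed on to
    densities.\<close>
  have key: "p * s powr (p - 1) * norm (T b - T a) \<le> (E b - E a) + (p - 1) * s powr p * (cl b - cl a)"
    if ab: "a \<le> b" and s: "s \<ge> 0" for a b s
  proof (cases "cl b = cl a")
    case True
    \<comment> \<open>Where the clamp does not increase, the factor \<open>0 powr (p - 1)\<close> is
      0, so T does not move even if E does.\<close>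
    then have "norm (T b - T a) powr p \<le> 0" using TE[OF ab] by (simp add: cl_def)
    then have "norm (T b - T a) = 0" using powr_gt_zero[of "norm (T b - T a)" p] by (metis linorder_not_less)
    then show ?thesis using Em[OF ab] True by simp
  next
    case False
    define l where "l = cl b - cl a"
    have l: "l > 0" using False clm[OF ab] by (simp add: l_def)
    have "l * (p * s powr (p - 1) * (norm (T b - T a) / l)) \<le> l * ((norm (T b - T a) / l) powr p + (p - 1) * s powr p)"
      using l s by (intro mult_left_mono powr_tangent_le[OF p]) auto
    also have "l * ((norm (T b - T a) / l) powr p + (p - 1) * s powr p)
        = norm (T b - T a) powr p / l powr (p - 1) + (p - 1) * s powr p * l"
      using l by (simp add: powr_divide powr_diff field_simps)
    also have "norm (T b - T a) powr p / l powr (p - 1) \<le> E b - E a"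
      using TE[OF ab] l pos_divide_le_eq[of "l powr (p - 1)" "norm (T b - T a) powr p" "E b - E a"]
      unfolding l_def cl_def by fastforce
    finally show ?thesis using l by (simp add: l_def)
  qed
  \<comment> \<open>The slope 1 shows that the variation of T is dominated by dK, the reference
    measure \<open>\<nu>\<close> below.\<close>
  have TK: "norm (T b - T a) \<le> K b - K a" if ab: "a \<le> b" for a b
  proof -
    have "p * norm (T b - T a) \<le> (E b - E a) + (p - 1) * (cl b - cl a)"
      using key[OF ab, of 1] by simp
    also have "\<dots> \<le> p * (E b - E a) + p * (cl b - cl a)"
    proof (rule add_mono)
      show "E b - E a \<le> p * (E b - E a)"
        using p Em[OF ab] mult_right_mono[of 1 p "E b - E a"] by simp
      show "(p - 1) * (cl b - cl a) \<le> p * (cl b - cl a)"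
        using clm[OF ab] by (intro mult_right_mono) auto
    qed
    also have "\<dots> = p * (K b - K a)" by (simp add: K_def algebra_simps)
    finally show ?thesis using p by simp
  qed
  have Trc: "continuous (at_right a) T" for a
  proof -
    have "((\<lambda>x. K x - K a) \<longlongrightarrow> 0) (at_right a)"
      using K by (auto simp: distribution_like_def continuous_within LIM_zero_iff)
    moreover have "eventually (\<lambda>x. norm (T x - T a) \<le> K x - K a) (at_right a)"
      by (auto simp: eventually_at_filter TK)
    ultimately have "((\<lambda>x. T x - T a) \<longlongrightarrow> 0) (at_right a)"
      by (rule Lim_null_comparison[rotated])
    then show ?thesis by (simp add: continuous_within LIM_zero_iff)
  qed
  obtain B where B: "\<And>x. \<bar>K x\<bar> \<le> B" using K by (auto simp: distribution_like_def bounded_iff)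
  have Tbd: "bounded (range T)"
  proof (rule boundedI[of _ "norm (T 0) + 2 * B"], clarify)
    fix x
    have "norm (T x - T 0) \<le> 2 * B"
      using TK[of 0 x] TK[of x 0] B[of 0] B[of x] by (cases "0 \<le> x") (auto simp: norm_minus_commute)
    then show "norm (T x) \<le> norm (T 0) + 2 * B" by (smt (verit) norm_triangle_sub)
  qed
  define \<nu> where "\<nu> = interval_measure K"
  have sets[measurable_cong]: "sets \<nu> = sets borel" by (simp add: \<nu>_def)
  interpret \<nu>: finite_measure \<nu> unfolding \<nu>_def by (rule finite_interval_measure[OF K])
  obtain e where e[measurable]: "e \<in> borel_measurable borel" and e0: "\<And>x. 0 \<le> e x"
    and ed: "density \<nu> (\<lambda>x. ennreal (e x)) = interval_measure E"
  proof (rule distribution_like_density[OF K E])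
    show "mono (\<lambda>x. K x + K x - E x)" using Em clm unfolding K_def by (intro monoI) (smt (verit))
  qed (auto simp: \<nu>_def intro: that)
  obtain k where k[measurable]: "k \<in> borel_measurable borel" and k0: "\<And>x. 0 \<le> k x"
    and kd: "density \<nu> (\<lambda>x. ennreal (k x)) = interval_measure cl"
  proof (rule distribution_like_density[OF K cl])
    show "mono (\<lambda>x. K x + K x - cl x)" using Em clm unfolding K_def by (intro monoI) (smt (verit))
  qed (auto simp: \<nu>_def intro: that)
  \<comment> \<open>A coordinate of T becomes monotone when K is added to it. As dK has density 1
    with respect to itself, subtracting 1 from the density so obtained leaves that of the
    coordinate.\<close>
  have "\<forall>b\<in>Basis. \<exists>D. D \<in> borel_measurable borel \<and> (\<forall>x. 0 \<le> D x) \<and>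
      density \<nu> (\<lambda>x. ennreal (D x)) = interval_measure (\<lambda>x. T x \<bullet> b + K x)
      \<and> distribution_like (\<lambda>x. T x \<bullet> b + K x)"
  proof
    fix b :: 'a assume b: "b \<in> Basis"
    have Tb: "\<bar>T y \<bullet> b - T x \<bullet> b\<bar> \<le> K y - K x" if "x \<le> y" for x y
      using TK[OF that] Basis_le_norm[OF b, of "T y - T x"] by (simp add: inner_diff_left)
    have H: "distribution_like (\<lambda>x. T x \<bullet> b + K x)"
      unfolding distribution_like_def
    proof safe
      show "mono (\<lambda>x. T x \<bullet> b + K x)" using Tb by (intro monoI) (smt (verit))
      show "continuous (at_right a) (\<lambda>x. T x \<bullet> b + K x)" for a
        using Trc[of a] K by (auto simp: distribution_like_def intro!: continuous_intros)
      have "bounded ((\<lambda>x. x \<bullet> b) ` range T)"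
        by (rule bounded_linear_image[OF Tbd bounded_linear_inner_left])
      then have "bounded (range (\<lambda>x. T x \<bullet> b))" by (simp add: image_image)
      then show "bounded (range (\<lambda>x. T x \<bullet> b + K x))"
        using K by (auto simp: distribution_like_def intro!: bounded_plus_comp)
    qed
    have "mono (\<lambda>x. K x + K x - (T x \<bullet> b + K x))" using Tb by (intro monoI) (smt (verit))
    from distribution_like_density[OF K H this] H
    show "\<exists>D. D \<in> borel_measurable borel \<and> (\<forall>x. 0 \<le> D x) \<and>
      density \<nu> (\<lambda>x. ennreal (D x)) = interval_measure (\<lambda>x. T x \<bullet> b + K x)
      \<and> distribution_like (\<lambda>x. T x \<bullet> b + K x)" unfolding \<nu>_def by blast
  qed
  then have "\<exists>D. \<forall>b\<in>Basis. D b \<in> borel_measurable borel \<and> (\<forall>x. 0 \<le> D b x) \<and>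
      density \<nu> (\<lambda>x. ennreal (D b x)) = interval_measure (\<lambda>x. T x \<bullet> b + K x)
      \<and> distribution_like (\<lambda>x. T x \<bullet> b + K x)" by (rule bchoice)
  then obtain D where D: "\<And>b. b \<in> Basis \<Longrightarrow> D b \<in> borel_measurable borel" "\<And>b x. b \<in> Basis \<Longrightarrow> 0 \<le> D b x"
      "\<And>b. b \<in> Basis \<Longrightarrow> density \<nu> (\<lambda>x. ennreal (D b x)) = interval_measure (\<lambda>x. T x \<bullet> b + K x)"
      "\<And>b. b \<in> Basis \<Longrightarrow> distribution_like (\<lambda>x. T x \<bullet> b + K x)"
    by blast
  note ei = density_interval_measure_integral[OF E e e0 ed sets]
  note ki = density_interval_measure_integral[OF cl k k0 kd sets]
  have Di: "integrable \<nu> (D b)"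
    "a \<le> c \<Longrightarrow> (LINT x:{a<..c}|\<nu>. D b x) = T c \<bullet> b + K c - (T a \<bullet> b + K a)" if "b \<in> Basis" for b a c
    using density_interval_measure_integral[OF D(4)[OF that] D(1)[OF that] D(2)[OF that] D(3)[OF that] sets] by auto
  have one: "(LINT x:{a<..b}|\<nu>. (1::real)) = K b - K a" if "a \<le> b" for a b
    using K that sets by (simp add: set_lebesgue_integral_def \<nu>_def measure_interval_measure_Ioc distribution_like_def mono_def)
  define f :: "real \<Rightarrow> 'a" where "f x = (\<Sum>b\<in>Basis. (D b x - 1) *\<^sub>R b)" for x
  have fi: "integrable \<nu> f" unfolding f_def
    by (intro Bochner_Integration.integrable_sum integrable_scaleR_left Bochner_Integration.integrable_diff Di) auto
  have f[measurable]: "f \<in> borel_measurable borel" using fi sets by (simp cong: measurable_cong_sets)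
  have SI: "set_integrable \<nu> A h" if "integrable \<nu> h" "A \<in> sets borel" for A and h :: "real \<Rightarrow> 'b::{banach, second_countable_topology}"
    using integrable_mult_indicator[of A \<nu> h] that sets unfolding set_integrable_def by simp
  have fint: "(LINT x:{a<..c}|\<nu>. f x) = T c - T a" if ac: "a \<le> c" for a c
  proof -
    have "(LINT x:{a<..c}|\<nu>. f x) = (\<Sum>b\<in>Basis. (LINT x:{a<..c}|\<nu>. (D b x - 1) *\<^sub>R b))"
      unfolding f_def set_lebesgue_integral_def scaleR_sum_right
      by (rule Bochner_Integration.integral_sum, unfold set_integrable_def[symmetric], rule SI)
         (auto intro!: integrable_scaleR_left Bochner_Integration.integrable_diff Di)
    also have "\<dots> = (\<Sum>b\<in>Basis. ((T c - T a) \<bullet> b) *\<^sub>R b)"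
    proof (rule sum.cong)
      fix b :: 'a assume b: "b \<in> Basis"
      have "(LINT x:{a<..c}|\<nu>. (D b x - 1) *\<^sub>R b) = (LINT x:{a<..c}|\<nu>. D b x - 1) *\<^sub>R b"
        using SI[OF Bochner_Integration.integrable_diff[OF Di(1)[OF b] \<nu>.integrable_const[of 1]], of "{a<..c}"]
        unfolding set_lebesgue_integral_def set_integrable_def by simp
      also have "(LINT x:{a<..c}|\<nu>. D b x - 1) = (LINT x:{a<..c}|\<nu>. D b x) - (LINT x:{a<..c}|\<nu>. 1)"
        by (intro set_integral_diff SI Di b) auto
      also have "\<dots> = (T c - T a) \<bullet> b" using Di(2)[OF b ac] one[OF ac] by (simp add: inner_diff_left)
      finally show "(LINT x:{a<..c}|\<nu>. (D b x - 1) *\<^sub>R b) = ((T c - T a) \<bullet> b) *\<^sub>R b" .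
    qed simp
    finally show ?thesis by (simp add: euclidean_representation)
  qed
  \<comment> \<open>The gradient of |z|^p; since \<open>W z\<close> multiplies the vector z, it
    vanishes at 0 whatever the value of \<open>0 powr (p - 2)\<close>.\<close>
  define W :: "'a \<Rightarrow> 'a" where "W z = (p * norm z powr (p - 2)) *\<^sub>R z" for z
  have nW: "norm (W z) = p * norm z powr (p - 1)" for z
    using p by (cases "z = 0") (auto simp: W_def powr_diff power2_eq_square field_simps)
  have AEz: "AE x in \<nu>. 0 \<le> e x + (p - 1) * norm z powr p * k x - W z \<bullet> f x" for z
  proof (rule AE_nonneg_if_integral_Ioc_nonneg[OF \<nu>.finite_measure_axioms sets])
    show i: "integrable \<nu> (\<lambda>x. e x + (p - 1) * norm z powr p * k x - W z \<bullet> f x)"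
      using ei(1) ki(1) fi by auto
    fix a b :: real assume ab: "a \<le> b"
    have "(LINT x:{a<..b}|\<nu>. e x + (p - 1) * norm z powr p * k x - W z \<bullet> f x)
       = (LINT x:{a<..b}|\<nu>. e x) + (p - 1) * norm z powr p * (LINT x:{a<..b}|\<nu>. k x) - (LINT x:{a<..b}|\<nu>. W z \<bullet> f x)"
      using ei(1) ki(1) fi by (subst set_integral_diff set_integral_add, auto intro!: SI)+
    moreover have "(LINT x:{a<..b}|\<nu>. W z \<bullet> f x) = W z \<bullet> (LINT x:{a<..b}|\<nu>. f x)"
      using SI[OF fi, of "{a<..b}"] unfolding set_lebesgue_integral_def set_integrable_def
      by (subst integral_inner_right[symmetric]) auto
    moreover have "W z \<bullet> (LINT x:{a<..b}|\<nu>. f x) \<le> norm (W z) * norm (T b - T a)"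
      using fint[OF ab] by (simp add: norm_cauchy_schwarz)
    moreover have "norm (W z) * norm (T b - T a) \<le> E b - E a + (p - 1) * norm z powr p * (cl b - cl a)"
      using key[OF ab, of "norm z"] by (simp add: nW)
    ultimately show "0 \<le> (LINT x:{a<..b}|\<nu>. e x + (p - 1) * norm z powr p * k x - W z \<bullet> f x)"
      unfolding ei(2)[OF ab] ki(2)[OF ab] by linarith
  qed
  obtain Q :: "'a set" where Q: "countable Q" "\<And>X. open X \<Longrightarrow> X \<noteq> {} \<Longrightarrow> \<exists>d\<in>Q. d \<in> X"
    by (rule countable_dense_setE) auto
  have "AE x in \<nu>. \<forall>z\<in>Q. 0 \<le> e x + (p - 1) * norm z powr p * k x - W z \<bullet> f x"
    using Q(1) AEz by (simp add: AE_ball_countable)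
  then have pt: "AE x in \<nu>. (k x = 0 \<longrightarrow> f x = 0) \<and> (k x > 0 \<longrightarrow> norm (f x) powr p / k x powr (p - 1) \<le> e x)"
  proof eventually_elim
    case (elim x)
    have all: "0 \<le> e x + (p - 1) * norm z powr p * k x - W z \<bullet> f x" if "z \<noteq> 0" for z
    proof (rule ccontr)
      assume neg: "\<not> ?thesis"
      \<comment> \<open>The origin is cut out because the factor \<open>norm z powr (p - 2)\<close>
        is discontinuous there for p \<le> 2; only nonzero multiples of \<open>f x\<close> are
        tested later.\<close>
      define X where "X = (- {0}) \<inter> (\<lambda>z. e x + (p - 1) * norm z powr p * k x - W z \<bullet> f x) -` {..<0}"
      have "continuous_on (- {0}) (\<lambda>z. e x + (p - 1) * norm z powr p * k x - W z \<bullet> f x)"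
        unfolding W_def by (auto intro!: continuous_intros)
      then have "open X" unfolding X_def
        by (rule continuous_open_preimage) auto
      moreover have "z \<in> X" using neg that by (auto simp: X_def)
      ultimately obtain d where "d \<in> Q" "d \<in> X" using Q(2) by blast
      then show False using elim by (auto simp: X_def)
    qed
    have s: "p * s powr (p - 1) * norm (f x) powr p \<le> e x + (p - 1) * s powr p * norm (f x) powr p * k x"
      if s: "s > 0" and f0: "f x \<noteq> 0" for s
    proof -
      have "W (s *\<^sub>R f x) \<bullet> f x = p * (s powr (p - 2) * s) * (norm (f x) powr (p - 2) * (norm (f x))\<^sup>2)"
        using s by (simp add: W_def powr_mult dot_square_norm)
      also have "s powr (p - 2) * s = s powr (p - 1)" using s by (simp add: powr_diff power2_eq_square)
      also have "norm (f x) powr (p - 2) * (norm (f x))\<^sup>2 = norm (f x) powr p" using f0 by (simp add: powr_diff)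
      finally show ?thesis using all[of "s *\<^sub>R f x"] s f0 by (simp add: powr_mult mult_ac)
    qed
    show ?case
    proof (intro conjI impI)
      assume k0: "k x = 0"
      show "f x = 0"
      proof (rule ccontr)
        assume f0: "f x \<noteq> 0"
        \<comment> \<open>Chosen so that testing with s = y^(1/(p-1)) yields e x + 1 \<le> e
          x.\<close>
        define y where "y = (e x + 1) / (p * norm (f x) powr p)"
        have y: "y > 0" using f0 p e0[of x] by (simp add: y_def)
        have "p * (y powr (1 / (p - 1))) powr (p - 1) * norm (f x) powr p \<le> e x"
          using s[of "y powr (1 / (p - 1))"] y f0 k0 by simp
        also have "(y powr (1 / (p - 1))) powr (p - 1) = y" using p y by (simp add: powr_powr)
        also have "p * y * norm (f x) powr p = e x + 1" using p f0 by (simp add: y_def)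
        finally show False by simp
      qed
    next
      assume kp: "k x > 0"
      show "norm (f x) powr p / k x powr (p - 1) \<le> e x"
      proof (cases "f x = 0")
        case False
        have "p * (1 / k x) powr (p - 1) * norm (f x) powr p \<le> e x + (p - 1) * ((1 / k x) powr p * k x) * norm (f x) powr p"
          using s[of "1 / k x"] False kp by (simp add: mult_ac)
        also have "(1 / k x) powr p * k x = (1 / k x) powr (p - 1)"
          using kp by (simp add: powr_diff powr_divide)
        finally have "(1 / k x) powr (p - 1) * norm (f x) powr p \<le> e x" by (simp add: algebra_simps)
        then show ?thesis using kp by (simp add: powr_divide)
      qed (use e0 in auto)
    qed
  qed
  define g where "g x = (if k x > 0 then f x /\<^sub>R k x else 0)" for x
  have g[measurable]: "g \<in> borel_measurable borel" unfolding g_def by measurable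
  have kg: "AE x in \<nu>. k x *\<^sub>R g x = f x"
    using pt by eventually_elim (use k0 in \<open>auto simp: g_def less_le\<close>)
  have dens: "density \<nu> (\<lambda>x. ennreal (k x)) = density lborel (\<lambda>x. ennreal (indicator {0..L} x))"
    unfolding kd interval_measure_clamp[OF L, symmetric] by (simp add: cl_def[abs_def])
  have "integrable \<nu> (\<lambda>x. k x *\<^sub>R g x)"
    using fi kg sets by (subst integrable_cong_AE[of _ _ f]) auto
  then have "integrable (density lborel (\<lambda>x. ennreal (indicator {0..L} x))) g"
    unfolding dens[symmetric] by (subst integrable_density) (use k0 sets in auto)
  then have gi: "set_integrable lborel {0..L} g"
    unfolding set_integrable_def by (subst (asm) integrable_density) auto
  show thesis
  proof (rule that[OF g gi])
    fix a b assume ab: "0 \<le> a" "a \<le> b" "b \<le> L"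
    have "T b - T a = (LINT x:{a<..b}|\<nu>. f x)" using fint ab by simp
    also have "\<dots> = (LINT x|\<nu>. k x *\<^sub>R (indicator {a<..b} x *\<^sub>R g x))"
      unfolding set_lebesgue_integral_def using sets fi kg
      by (intro integral_cong_AE) (auto simp: indicator_def)
    also have "\<dots> = (LINT x|density \<nu> (\<lambda>x. ennreal (k x)). indicator {a<..b} x *\<^sub>R g x)"
      using sets k0 by (subst integral_density) auto
    also have "\<dots> = (LINT x|lborel. indicator {0..L} x *\<^sub>R (indicator {a<..b} x *\<^sub>R g x))"
      unfolding dens by (subst integral_density) auto
    also have "\<dots> = (LINT x:{a..b}|lborel. g x)"
      unfolding set_lebesgue_integral_def
      by (rule integral_cong_AE; (measurable)?) (use AE_lborel_singleton[of a] in \<open>eventually_elim\<close>, use ab in \<open>auto simp: indicator_def\<close>)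
    finally show "T b - T a = (LINT x:{a..b}|lborel. g x)" .
  next
    have "(\<integral>\<^sup>+x\<in>{0..L}. ennreal (norm (g x) powr p) \<partial>lborel)
       = (\<integral>\<^sup>+x. ennreal (norm (g x) powr p) \<partial>density lborel (\<lambda>x. ennreal (indicator {0..L} x)))"
      by (subst nn_integral_density) (auto simp: mult.commute indicator_def intro!: nn_integral_cong)
    also have "\<dots> = (\<integral>\<^sup>+x. ennreal (k x) * ennreal (norm (g x) powr p) \<partial>\<nu>)"
      unfolding dens[symmetric] by (subst nn_integral_density) (use sets in auto)
    also have "\<dots> \<le> (\<integral>\<^sup>+x. ennreal (e x) \<partial>\<nu>)"
    proof (rule nn_integral_mono_AE, use pt in eventually_elim)
      case (elim x)
      show ?case
      proof (cases "k x > 0")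
        case True
        then have "norm (g x) = norm (f x) / k x" by (simp add: g_def divide_inverse mult.commute)
        then have "k x * norm (g x) powr p = norm (f x) powr p / k x powr (p - 1)"
          using True by (simp add: powr_diff powr_divide)
        then show ?thesis using elim True e0 by (simp flip: ennreal_mult)
      qed (use p in \<open>simp add: g_def\<close>)
    qed
    also have "\<dots> = emeasure (interval_measure E) UNIV"
      unfolding ed[symmetric] using sets by (subst emeasure_density) auto
    also have "\<dots> \<le> ennreal M" by (rule emeasure_interval_measure_UNIV_le[OF E M])
    finally show "(\<integral>\<^sup>+x\<in>{0..L}. ennreal (norm (g x) powr p) \<partial>lborel) \<le> ennreal M" .
  qed
qed

text \<open>The supremum of the sums over partitions ending at s is a superadditive energy E0, and
  one step of it bounds one increment of T. Clamping extends everything to the real line, and a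
  right-continuous version of E0 is the distribution function handed to
  \<open>Riesz_density\<close>.\<close>

lemma Riesz_representation:
  fixes T :: "real \<Rightarrow> 'a::euclidean_space"
  assumes p: "p > 1" and L: "0 < L" and M: "0 \<le> M"
    and sums: "\<And>k y. (\<And>j. j < k \<Longrightarrow> y j < y (Suc j)) \<Longrightarrow> 0 \<le> y 0 \<Longrightarrow> y k \<le> L \<Longrightarrow>
      (\<Sum>j<k. norm (T (y (Suc j)) - T (y j)) powr p / (y (Suc j) - y j) powr (p - 1)) \<le> M"
  obtains g where "g \<in> borel_measurable borel" "set_integrable lborel {0..L} g"
    "\<And>a b. 0 \<le> a \<Longrightarrow> a \<le> b \<Longrightarrow> b \<le> L \<Longrightarrow> T b - T a = (LINT x:{a..b}|lborel. g x)"
    "(\<integral>\<^sup>+x\<in>{0..L}. ennreal (norm (g x) powr p) \<partial>lborel) \<le> ennreal M"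
proof -
  define cl where "cl x = max 0 (min L x)" for x
  have cl: "0 \<le> cl x" "cl x \<le> L" for x using L by (auto simp: cl_def)
  have clm: "a \<le> b \<Longrightarrow> cl a \<le> cl b" for a b by (auto simp: cl_def)
  have clc: "isCont cl x" for x unfolding cl_def by (intro continuous_intros)
  define \<phi> where "\<phi> a b = norm (T b - T a) powr p / (b - a) powr (p - 1)" for a b
  have \<phi>0: "0 \<le> \<phi> a b" for a b by (simp add: \<phi>_def)
  \<comment> \<open>The first point is free and the last one fixed, so a partition for a becomes one
    for b by appending a point. The choice k = 0 contributes the empty sum.\<close>
  define A where "A s = {\<Sum>j<k. \<phi> (y j) (y (Suc j)) | k y.
      (\<forall>j<k. y j < y (Suc j)) \<and> 0 \<le> y (0::nat) \<and> y k = cl s}" for s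
  have A0: "0 \<in> A s" for s
    unfolding A_def using cl[of s] by (auto intro!: exI[of _ 0] exI[of _ "\<lambda>_. cl s"])
  have AM: "z \<le> M" if "z \<in> A s" for z s
    using that sums cl[of s] unfolding A_def \<phi>_def by force
  have bdd: "bdd_above (A s)" for s using AM by (auto simp: bdd_above_def)
  define E0 where "E0 s = Sup (A s)" for s
  have E0: "0 \<le> E0 s" "E0 s \<le> M" for s
    unfolding E0_def using A0 AM bdd by (auto intro: cSup_upper cSup_least)
  have step: "E0 a + \<phi> (cl a) (cl b) \<le> E0 b" if ab: "cl a < cl b" for a b
  proof -
    have "E0 a \<le> E0 b - \<phi> (cl a) (cl b)"
      unfolding E0_def[of a]
    proof (rule cSup_least)
      fix z assume "z \<in> A a"
      then obtain k y where ky: "z = (\<Sum>j<k. \<phi> (y j) (y (Suc j)))" "\<And>j. j < k \<Longrightarrow> y j < y (Suc j)"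
        "0 \<le> y (0::nat)" "y k = cl a" unfolding A_def by blast
      define y' where "y' = y(Suc k := cl b)"
      have "z + \<phi> (cl a) (cl b) = (\<Sum>j<Suc k. \<phi> (y' j) (y' (Suc j)))"
        using ky by (simp add: y'_def)
      moreover have "\<forall>j<Suc k. y' j < y' (Suc j)" using ky ab by (auto simp: y'_def less_Suc_eq)
      moreover have "0 \<le> y' 0" "y' (Suc k) = cl b" using ky by (auto simp: y'_def)
      ultimately have "z + \<phi> (cl a) (cl b) \<in> A b" unfolding A_def by blast
      then have "z + \<phi> (cl a) (cl b) \<le> E0 b" unfolding E0_def using bdd by (intro cSup_upper)
      then show "z \<le> E0 b - \<phi> (cl a) (cl b)" by simp
    qed (use A0 in blast)
    then show ?thesis by simp
  qed
  have E0m: "E0 a \<le> E0 b" if "a \<le> b" for a b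
  proof (cases "cl a = cl b")
    case True
    then show ?thesis by (simp add: E0_def A_def)
  next
    case False
    then show ?thesis using step[of a b] clm[OF that] \<phi>0[of "cl a" "cl b"] by linarith
  qed
  have step': "norm (T (cl b) - T (cl a)) powr p \<le> (E0 b - E0 a) * (cl b - cl a) powr (p - 1)" if ab: "a \<le> b" for a b
  proof (cases "cl a = cl b")
    case False
    then have l: "cl a < cl b" using clm[OF ab] by simp
    have "\<phi> (cl a) (cl b) \<le> E0 b - E0 a" using step[OF l] by simp
    then show ?thesis using l pos_divide_le_eq[of "(cl b - cl a) powr (p - 1)"] by (simp add: \<phi>_def)
  qed simp
  \<comment> \<open>Interval measures are built from right-continuous functions, so E0 is replaced
    by its right limits. The increment bound survives because T and the clamp are
    continuous.\<close>
  define E where "E s = Inf (E0 ` {s<..})" for s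
  have E0bb: "bdd_below (E0 ` X)" for X using E0 by (auto simp: bdd_below_def)
  have Elim: "(E0 \<longlongrightarrow> E s) (at_right s)" for s
    using Lim_right_bound[of UNIV s E0 0] E0 E0m by (simp add: E_def)
  have Ele: "E s \<le> E0 u" if "s < u" for s u
    unfolding E_def using that E0bb by (intro cInf_lower) auto
  have E0E: "E0 s \<le> E s" for s
    unfolding E_def using E0m by (intro cInf_greatest) auto
  have Ebd: "0 \<le> E s" "E s \<le> M" for s
    using E0E[of s] E0(1)[of s] Ele[of s "s+1"] E0(2)[of "s+1"] by auto
  have Em: "E a \<le> E b" if "a \<le> b" for a b
    using that Ele[of a b] E0E[of b] by (cases "a = b") auto
  have E: "distribution_like E"
    unfolding distribution_like_def
  proof safe
    show "mono E" using Em by (intro monoI)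
    show "bounded (range E)" using Ebd by (intro boundedI[of _ M]) auto
    show "continuous (at_right s) E" for s
      unfolding continuous_within
    proof (rule order_tendstoI)
      fix l assume "l < E s"
      then have "l < E y" if "y > s" for y using Em[of s y] that by simp
      then show "\<forall>\<^sub>F y in at_right s. l < E y" by (simp add: eventually_at_filter)
    next
      fix u assume "E s < u"
      then have "\<forall>\<^sub>F y in at_right s. E0 y < u" using order_tendstoD(2)[OF Elim] by blast
      then obtain w where w: "w > s" "\<And>y. s < y \<Longrightarrow> y < w \<Longrightarrow> E0 y < u"
        unfolding eventually_at_right[OF less_add_one[of s]] by blast
      have "E y < u" if "s < y" "y < w" for y
        using Ele[of y "(y + w) / 2"] w(2)[of "(y + w) / 2"] that by simp
      then show "\<forall>\<^sub>F y in at_right s. E y < u"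
        by (intro eventually_at_rightI[OF _ w(1)]) simp
    qed
  qed
  have shift: "((\<lambda>h. E0 (s + h)) \<longlongrightarrow> E s) (at_right 0)" for s
    using Elim[of s] by (subst (asm) filterlim_at_right_to_0) (simp add: add.commute)
  \<comment> \<open>Increments of E0 are at most M, so the increment bound makes T Hoelder
    continuous with exponent (p - 1) / p.\<close>
  have Tcl: "isCont (\<lambda>x. T (cl x)) s" for s
  proof -
    have lim0: "((\<lambda>x. M powr (1 / p) * \<bar>cl x - cl s\<bar> powr ((p - 1) / p)) \<longlongrightarrow> 0) (at s)"
    proof -
      have "((\<lambda>x. \<bar>cl x - cl s\<bar>) \<longlongrightarrow> 0) (at s)"
        by (rule tendsto_rabs_zero[OF LIM_zero[OF clc[unfolded isCont_def]]])
      then have "((\<lambda>x. \<bar>cl x - cl s\<bar> powr ((p - 1) / p)) \<longlongrightarrow> 0 powr ((p - 1) / p)) (at s)"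
        by (rule tendsto_powr'[OF _ tendsto_const]) (use p in simp)
      then show ?thesis by (intro tendsto_mult_right_zero) (simp only: powr_0)
    qed
    have bound: "norm (T (cl x) - T (cl s)) \<le> M powr (1 / p) * \<bar>cl x - cl s\<bar> powr ((p - 1) / p)" for x
    proof -
      have *: "norm (T (cl b) - T (cl a)) \<le> M powr (1 / p) * (cl b - cl a) powr ((p - 1) / p)" if "a \<le> b" for a b
      proof -
        have "norm (T (cl b) - T (cl a)) powr p \<le> M * (cl b - cl a) powr (p - 1)"
          by (rule order_trans[OF step'[OF that] mult_right_mono]) (use E0(1)[of a] E0(2)[of b] in simp_all)
        then have "(norm (T (cl b) - T (cl a)) powr p) powr (1 / p) \<le> (M * (cl b - cl a) powr (p - 1)) powr (1 / p)"
          using p by (intro powr_mono2) auto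
        then show ?thesis using p M by (simp add: powr_powr powr_mult)
      qed
      show ?thesis
      proof (cases "x \<le> s")
        case True
        then have "\<bar>cl x - cl s\<bar> = cl s - cl x" using clm[of x s] by simp
        then show ?thesis using *[OF True] by (simp only: norm_minus_commute)
      next
        case False
        then have "\<bar>cl x - cl s\<bar> = cl x - cl s" using clm[of s x] by simp
        then show ?thesis using *[of s x] False by simp
      qed
    qed
    have "((\<lambda>x. T (cl x) - T (cl s)) \<longlongrightarrow> 0) (at s)"
      by (rule Lim_null_comparison[OF always_eventually[OF allI[OF bound]] lim0])
    then show ?thesis by (simp add: isCont_def LIM_zero_iff)
  qed
  have sh: "((\<lambda>h. s + h) \<longlongrightarrow> s) (at_right 0)" for s :: real
    using tendsto_add[OF tendsto_const tendsto_ident_at[of "0::real" "{0<..}"], of s] by simp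
  have Tshift: "((\<lambda>h. T (cl (s + h))) \<longlongrightarrow> T (cl s)) (at_right 0)" for s
    by (rule isCont_tendsto_compose[OF Tcl sh])
  have clshift: "((\<lambda>h. cl (s + h)) \<longlongrightarrow> cl s) (at_right 0)" for s
    by (rule isCont_tendsto_compose[OF clc sh])
  have TE: "norm (T (cl b) - T (cl a)) powr p \<le> (E b - E a) * (cl b - cl a) powr (p - 1)" if ab: "a \<le> b" for a b
  proof (rule tendsto_le)
    show "((\<lambda>h. norm (T (cl (b + h)) - T (cl (a + h))) powr p) \<longlongrightarrow> norm (T (cl b) - T (cl a)) powr p) (at_right 0)"
      using p by (intro tendsto_powr' tendsto_intros Tshift) auto
    show "((\<lambda>h. (E0 (b + h) - E0 (a + h)) * (cl (b + h) - cl (a + h)) powr (p - 1)) \<longlongrightarrow> (E b - E a) * (cl b - cl a) powr (p - 1)) (at_right 0)"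
      using p clm ab by (intro tendsto_mult tendsto_powr' tendsto_diff tendsto_const shift clshift) auto
    show "\<forall>\<^sub>F h in at_right 0. norm (T (cl (b + h)) - T (cl (a + h))) powr p \<le> (E0 (b + h) - E0 (a + h)) * (cl (b + h) - cl (a + h)) powr (p - 1)"
      using step' ab by (intro always_eventually) auto
  qed simp
  obtain g where g: "g \<in> borel_measurable borel" "set_integrable lborel {0..L} g"
    "\<And>a b. 0 \<le> a \<Longrightarrow> a \<le> b \<Longrightarrow> b \<le> L \<Longrightarrow> T (cl b) - T (cl a) = (LINT x:{a..b}|lborel. g x)"
    "(\<integral>\<^sup>+x\<in>{0..L}. ennreal (norm (g x) powr p) \<partial>lborel) \<le> ennreal M"
  proof (rule Riesz_density[OF p L E, of M "\<lambda>x. T (cl x)"])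
    show "E y - E x \<le> M" for x y using Ebd(1)[of x] Ebd(2)[of y] by linarith
    show "norm (T (cl b) - T (cl a)) powr p \<le> (E b - E a) * (max 0 (min L b) - max 0 (min L a)) powr (p - 1)"
      if "a \<le> b" for a b using TE[OF that] by (simp only: cl_def)
  qed auto
  show thesis
  proof (rule that[OF g(1,2) _ g(4)])
    fix a b assume "0 \<le> a" "a \<le> b" "b \<le> L"
    then show "T b - T a = (LINT x:{a..b}|lborel. g x)" using g(3)[of a b] by (simp add: cl_def)
  qed
qed

section \<open>The lower bound\<close>

lemma tan_ge_self:
  assumes "0 \<le> x" "x < pi / 2"
  shows "x \<le> tan x"
proof -
  have "tan 0 - 0 \<le> tan x - x"
  proof (rule DERIV_nonneg_imp_nondecreasing[OF assms(1)])
    fix y assume y: "0 \<le> y" "y \<le> x"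
    then have c: "0 < cos y" using assms by (intro cos_gt_zero_pi) auto
    then have "cos y * cos y \<le> 1 * 1" by (intro mult_mono) auto
    then have "inverse ((cos y)\<^sup>2) - 1 \<ge> 0" using c by (simp add: power2_eq_square field_simps)
    moreover have "((\<lambda>x. tan x - x) has_real_derivative inverse ((cos y)\<^sup>2) - 1) (at y)"
      using c by (auto intro!: derivative_eq_intros)
    ultimately show "\<exists>d. ((\<lambda>x. tan x - x) has_real_derivative d) (at y) \<and> 0 \<le> d" by blast
  qed
  then show ?thesis by simp
qed

text \<open>For unit vectors at angle \<theta>, |b - a|^2 = 2 - 2 cos \<theta> = (2 sin
  (\<theta>/2))^2, the chord of an arc of the unit circle.\<close>

lemma unit_chord_angle:
  fixes u w :: "'a::real_inner"
  assumes "u \<noteq> 0" "w \<noteq> 0"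
  defines "\<theta> \<equiv> arccos (u \<bullet> w / (norm u * norm w))"
  shows "0 \<le> \<theta>" "\<theta> \<le> pi" "norm (w /\<^sub>R norm w - u /\<^sub>R norm u) = 2 * sin (\<theta> / 2)"
proof -
  have "\<bar>u \<bullet> w\<bar> \<le> norm u * norm w" by (rule Cauchy_Schwarz_ineq2)
  then have b: "-1 \<le> u \<bullet> w / (norm u * norm w)" "u \<bullet> w / (norm u * norm w) \<le> 1"
    using assms by (auto simp: field_simps abs_le_iff)
  then show \<theta>: "0 \<le> \<theta>" "\<theta> \<le> pi" unfolding \<theta>_def by (auto intro: arccos_lbound arccos_ubound)
  have c: "cos \<theta> = u \<bullet> w / (norm u * norm w)" unfolding \<theta>_def using b by (rule cos_arccos)
  define a where "a = u /\<^sub>R norm u"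
  define b where "b = w /\<^sub>R norm w"
  have ab: "a \<bullet> a = 1" "b \<bullet> b = 1" "a \<bullet> b = u \<bullet> w / (norm u * norm w)"
    using assms by (auto simp: a_def b_def dot_square_norm power2_eq_square divide_inverse)
  have "(norm (w /\<^sub>R norm w - u /\<^sub>R norm u))\<^sup>2 = (b - a) \<bullet> (b - a)"
    by (simp add: a_def b_def dot_square_norm)
  also have "\<dots> = 2 - 2 * (u \<bullet> w / (norm u * norm w))"
    using ab by (simp add: inner_diff_left inner_diff_right inner_commute)
  also have "\<dots> = (2 * sin (\<theta> / 2))\<^sup>2"
    using cos_double_sin[of "\<theta> / 2"] c by (simp add: power_mult_distrib)
  finally have sq: "(norm (w /\<^sub>R norm w - u /\<^sub>R norm u))\<^sup>2 = (2 * sin (\<theta> / 2))\<^sup>2" .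
  have "0 \<le> sin (\<theta> / 2)" using \<theta> by (intro sin_ge_zero) auto
  then show "norm (w /\<^sub>R norm w - u /\<^sub>R norm u) = 2 * sin (\<theta> / 2)"
    by (intro power2_eq_imp_eq[OF sq]) auto
qed

text \<open>The chord 2 sin (\<theta>/2) is at most \<theta>, and \<theta>/2 is at most tan
  (\<theta>/2). At \<theta> = pi the second bound breaks down because of the value
  \<open>tan (pi / 2) = 0\<close>.\<close>

lemma p_rotation_term_ge:
  fixes u w :: "'a::real_inner"
  assumes p: "p > 1" and uw: "u \<noteq> 0" "w \<noteq> 0" and r: "r > 0"
  defines "\<theta> \<equiv> arccos (u \<bullet> w / (norm u * norm w))"
  assumes \<theta>: "\<theta> \<noteq> pi"
  shows "norm (w /\<^sub>R norm w - u /\<^sub>R norm u) powr p / r powr (p - 1) \<le> \<theta> * (tan (\<theta> / 2) / (r / 2)) powr (p - 1)"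
proof -
  note a = unit_chord_angle[OF uw, folded \<theta>_def]
  have t: "\<theta> / 2 \<le> tan (\<theta> / 2)" using a \<theta> by (intro tan_ge_self) auto
  have "norm (w /\<^sub>R norm w - u /\<^sub>R norm u) \<le> \<theta>" using a(1,3) sin_x_le_x[of "\<theta> / 2"] by simp
  then have "norm (w /\<^sub>R norm w - u /\<^sub>R norm u) powr p / r powr (p - 1) \<le> \<theta> powr p / r powr (p - 1)"
    using p by (intro divide_right_mono powr_mono2) auto
  also have "\<dots> = \<theta> * (\<theta> / r) powr (p - 1)"
    using a(1) r powr_mult_powr_minus_one[of \<theta> p] by (simp add: powr_divide)
  also have "\<dots> \<le> \<theta> * (tan (\<theta> / 2) / (r / 2)) powr (p - 1)"
  proof (intro mult_left_mono powr_mono2)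
    have "\<theta> / r = (\<theta> / 2) / (r / 2)" by simp
    also have "\<dots> \<le> tan (\<theta> / 2) / (r / 2)" using t r by (intro divide_right_mono) auto
    finally show "\<theta> / r \<le> tan (\<theta> / 2) / (r / 2)" .
  qed (use a p r in auto)
  finally show ?thesis .
qed

lemma p_rotation_ge:
  fixes P :: "'a::real_inner list"
  assumes p: "p > 1" and P: "polygonal P" and M: "p_rotation p P < ennreal M"
  defines "w \<equiv> \<lambda>i. P ! Suc i - P ! i"
  shows "(\<Sum>i<length P - 2. norm (w (Suc i) /\<^sub>R norm (w (Suc i)) - w i /\<^sub>R norm (w i)) powr p
    / min (norm (w i)) (norm (w (Suc i))) powr (p - 1)) \<le> M"
proof -
  have l: "2 \<le> length P" and ne: "\<And>i. i \<in> {1..<length P} \<Longrightarrow> edge P i \<noteq> 0"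
    using P by (auto simp: polygonal_def)
  have w: "edge P (Suc i) = w i" for i by (simp add: edge_def w_def)
  have wne: "w i \<noteq> 0" if "i < length P - 1" for i using ne[of "Suc i"] that w by auto
  let ?\<theta> = "\<lambda>i. turning_angle P i"
  have npi: "?\<theta> i \<noteq> pi" if "i \<in> {1..<length P - 1}" for i
    using M that by (auto simp: p_rotation_def split: if_splits)
  have "p_rotation p P = ennreal (\<Sum>i = 1..<length P - 1. ?\<theta> i * (tan (?\<theta> i / 2) / (min_edge P i / 2)) powr (p - 1))"
    using M by (auto simp: p_rotation_def split: if_splits)
  \<comment> \<open>Interior vertices are numbered from 1 but the edges \<open>w\<close> from 0:
    vertex Suc i lies between \<open>w i\<close> and \<open>w (Suc i)\<close>.\<close>
  also have "(\<Sum>i = 1..<length P - 1. ?\<theta> i * (tan (?\<theta> i / 2) / (min_edge P i / 2)) powr (p - 1))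
     = (\<Sum>i<length P - 2. ?\<theta> (Suc i) * (tan (?\<theta> (Suc i) / 2) / (min_edge P (Suc i) / 2)) powr (p - 1))"
  proof -
    have "length P - 1 = Suc (length P - 2)" using l by simp
    then show ?thesis by (simp only: One_nat_def sum.atLeast_Suc_lessThan_Suc_shift lessThan_atLeast0 o_def)
  qed
  finally have eq: "p_rotation p P = ennreal \<dots>" .
  have term_le: "norm (w (Suc i) /\<^sub>R norm (w (Suc i)) - w i /\<^sub>R norm (w i)) powr p
     / min (norm (w i)) (norm (w (Suc i))) powr (p - 1)
     \<le> ?\<theta> (Suc i) * (tan (?\<theta> (Suc i) / 2) / (min_edge P (Suc i) / 2)) powr (p - 1)"
    if i: "i < length P - 2" for i
    using npi[of "Suc i"] wne[of i] wne[of "Suc i"] i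
      p_rotation_term_ge[OF p, of "w i" "w (Suc i)" "min (norm (w i)) (norm (w (Suc i)))"]
    by (simp add: turning_angle_def min_edge_def w)
  have "(\<Sum>i<length P - 2. norm (w (Suc i) /\<^sub>R norm (w (Suc i)) - w i /\<^sub>R norm (w i)) powr p
    / min (norm (w i)) (norm (w (Suc i))) powr (p - 1))
    \<le> (\<Sum>i<length P - 2. ?\<theta> (Suc i) * (tan (?\<theta> (Suc i) / 2) / (min_edge P (Suc i) / 2)) powr (p - 1))"
    using term_le by (intro sum_mono) auto
  also have "\<dots> \<le> M"
  proof (rule ccontr)
    assume "\<not> ?thesis"
    then have "ennreal M \<le> p_rotation p P" unfolding eq by (intro ennreal_leI) simp
    then show False using M by simp
  qed
  finally show ?thesis .
qed

text \<open>A lower limit below M leaves infinitely many p-rotations below M, and the modulus is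
  eventually small, so some member of the sequence has both properties.\<close>

lemma p_curvature_less_imp_polygons:
  assumes "p_curvature p L c < ennreal M" "0 < \<epsilon>"
  obtains t where "is_partition 0 L t" "polygonal (map c t)" "modulus c t < \<epsilon>" "p_rotation p (map c t) < ennreal M"
proof -
  obtain P t where P: "\<And>h. inscribed L c (t h) (P h)" "(\<lambda>h. modulus c (t h)) \<longlonglongrightarrow> 0"
    "liminf (\<lambda>h. p_rotation p (P h)) < ennreal M"
    using assms(1) unfolding p_curvature_def Inf_less_iff by auto
  have "\<exists>\<^sub>F h in sequentially. p_rotation p (P h) < ennreal M"
  proof (rule ccontr)
    assume "\<not> ?thesis"
    then have "\<forall>\<^sub>F h in sequentially. ennreal M \<le> p_rotation p (P h)" by (simp add: not_frequently not_less)
    then have "ennreal M \<le> liminf (\<lambda>h. p_rotation p (P h))" by (rule Liminf_bounded)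
    then show False using P(3) by simp
  qed
  moreover have "\<forall>\<^sub>F h in sequentially. modulus c (t h) < \<epsilon>"
    using order_tendstoD(2)[OF P(2) assms(2)] .
  ultimately have "\<exists>\<^sub>F h in sequentially. p_rotation p (P h) < ennreal M \<and> modulus c (t h) < \<epsilon>"
    by (rule frequently_eventually_conj[THEN frequently_elim1]) auto
  then obtain h where "p_rotation p (P h) < ennreal M" "modulus c (t h) < \<epsilon>"
    using frequently_ex by blast
  then show thesis using P(1)[of h] by (intro that[of "t h"]) (auto simp: inscribed_def)
qed

lemma p_curvature_less_imp_approximation:
  fixes c :: "real \<Rightarrow> 'a::euclidean_space"
  assumes c: "arclength_curve L c" and L: "0 < L" and p: "p > 1" and M: "p_curvature p L c < ennreal M"
    and \<epsilon>: "0 < \<epsilon>"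
  obtains n x m where "inscribed_approximation c L m n x p M \<epsilon>" "m \<le> \<epsilon>"
proof -
  obtain \<eta> where \<eta>: "0 < \<eta>" "\<And>m n x. curve_partition c L m n x \<Longrightarrow> m \<le> \<eta> \<Longrightarrow>
      L - (\<Sum>i<n. norm (c (x (Suc i)) - c (x i))) \<le> \<epsilon>"
    using small_mesh_polygon_length[OF c L \<epsilon>] by blast
  \<comment> \<open>Tolerances are chosen backwards: the admissible loss of length dictates a mesh,
    and the mesh dictates a modulus.\<close>
  define m where "m = min \<eta> \<epsilon>"
  have m: "0 < m" using \<eta> \<epsilon> by (simp add: m_def)
  obtain \<mu> where \<mu>: "0 < \<mu>" "\<And>t i. is_partition 0 L t \<Longrightarrow> modulus c t < \<mu> \<Longrightarrow> Suc i < length t \<Longrightarrow> t ! Suc i - t ! i \<le> m"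
    using small_modulus_small_mesh[OF c L m] by blast
  obtain t where t: "is_partition 0 L t" "polygonal (map c t)" "modulus c t < \<mu>" "p_rotation p (map c t) < ennreal M"
    using p_curvature_less_imp_polygons[OF M \<mu>(1)] by blast
  define n where "n = length t - 1"
  have l: "2 \<le> length t" using t(2) by (simp add: polygonal_def)
  have CP: "curve_partition c L m n (\<lambda>i. t ! i)"
  proof
    show "0 < n" using l by (simp add: n_def)
    show "t ! 0 = 0" "t ! n = L" using is_partition_nth[OF t(1)] by (auto simp: n_def)
    show "t ! i < t ! Suc i" "t ! Suc i - t ! i \<le> m" if "i < n" for i
      using that is_partition_nth(4)[OF t(1), of i] \<mu>(2)[OF t(1,3), of i] by (auto simp: n_def)
  qed (use arclength_curve_Lipschitz[OF c] in auto)
  have "inscribed_approximation c L m n (\<lambda>i. t ! i) p M \<epsilon>"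
  proof (intro inscribed_approximation.intro[OF CP] inscribed_approximation_axioms.intro)
    show "c (t ! Suc i) - c (t ! i) \<noteq> 0" if "i < n" for i
    proof -
      have "edge (map c t) (Suc i) \<noteq> 0" using t(2) that by (auto simp: polygonal_def n_def)
      then show ?thesis using that by (simp add: edge_def n_def)
    qed
    show "L - (\<Sum>i<n. norm (c (t ! Suc i) - c (t ! i))) \<le> \<epsilon>"
      by (rule \<eta>(2)[OF CP]) (simp add: m_def)
    define w where "w = (\<lambda>i. map c t ! Suc i - map c t ! i)"
    have w: "w i = c (t ! Suc i) - c (t ! i)" if "i < n" for i using that by (simp add: w_def n_def)
    have "(\<Sum>i<n - 1. norm ((c (t ! Suc (Suc i)) - c (t ! Suc i)) /\<^sub>R norm (c (t ! Suc (Suc i)) - c (t ! Suc i)) -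
         (c (t ! Suc i) - c (t ! i)) /\<^sub>R norm (c (t ! Suc i) - c (t ! i))) powr p /
        min (norm (c (t ! Suc i) - c (t ! i))) (norm (c (t ! Suc (Suc i)) - c (t ! Suc i))) powr (p - 1)) = (\<Sum>i<length (map c t) - 2. norm (w (Suc i) /\<^sub>R norm (w (Suc i)) - w i /\<^sub>R norm (w i)) powr p
         / min (norm (w i)) (norm (w (Suc i))) powr (p - 1))"
      by (rule sum.cong) (auto simp: w n_def)
    also have "\<dots> \<le> M" unfolding w_def by (rule p_rotation_ge[OF p t(2,4)])
    finally show "(\<Sum>i<n - 1. norm ((c (t ! Suc (Suc i)) - c (t ! Suc i)) /\<^sub>R norm (c (t ! Suc (Suc i)) - c (t ! Suc i)) -
         (c (t ! Suc i) - c (t ! i)) /\<^sub>R norm (c (t ! Suc i) - c (t ! i))) powr p /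
        min (norm (c (t ! Suc i) - c (t ! i))) (norm (c (t ! Suc (Suc i)) - c (t ! Suc i))) powr (p - 1)) \<le> M" .
  qed (use p in auto)
  then show thesis by (rule that) (simp add: m_def)
qed

text \<open>The tolerance 1 / (h + 1) shrinks along the sequence while the energy bound M stays the
  same, which is why M survives as the bound for the integral.\<close>

lemma p_curvature_less_imp_derivatives:
  fixes c :: "real \<Rightarrow> 'a::euclidean_space"
  assumes c: "arclength_curve L c" and L: "0 < L" and p: "p > 1" and M: "p_curvature p L c < ennreal M"
  obtains T g where "\<And>a. 0 < a \<Longrightarrow> a < L \<Longrightarrow> (c has_vector_derivative T a) (at a)"
    "g \<in> borel_measurable borel" "set_integrable lborel {0..L} g"
    "\<And>a b. 0 \<le> a \<Longrightarrow> a \<le> b \<Longrightarrow> b \<le> L \<Longrightarrow> T b - T a = (LINT x:{a..b}|lborel. g x)"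
    "(\<integral>\<^sup>+x\<in>{0..L}. ennreal (norm (g x) powr p) \<partial>lborel) \<le> ennreal M"
proof -
  define \<epsilon> where "\<epsilon> h = 1 / real (Suc h)" for h
  have \<epsilon>: "0 < \<epsilon> h" "\<epsilon> \<longlonglongrightarrow> 0" for h
    unfolding \<epsilon>_def using LIMSEQ_inverse_real_of_nat by (auto simp: inverse_eq_divide)
  have "\<exists>n x m. inscribed_approximation c L m n x p M (\<epsilon> h) \<and> m \<le> \<epsilon> h" for h
    using p_curvature_less_imp_approximation[OF c L p M \<epsilon>(1)] by blast
  then obtain n x m where A: "\<And>h. inscribed_approximation c L (m h) (n h) (x h) p M (\<epsilon> h)" "\<And>h. m h \<le> \<epsilon> h"
    by metis
  have CP: "curve_partition c L (m h) (n h) (x h)" for h using A(1)[of h] by (simp add: inscribed_approximation_def)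
  define S where "S h = inscribed_approximation.tangent c (x h)" for h
  have m0: "0 < m h" for h by (rule curve_partition.m_pos[OF CP])
  have M0: "0 \<le> M" by (rule inscribed_approximation.M_nonneg[OF A(1)])
  obtain T where T:
    "\<And>k y. (\<And>j. j < k \<Longrightarrow> y j < y (Suc j)) \<Longrightarrow> 0 \<le> y 0 \<Longrightarrow> y k \<le> L \<Longrightarrow>
      (\<Sum>j<k. norm (T (y (Suc j)) - T (y j)) powr p / (y (Suc j) - y j) powr (p - 1)) \<le> M"
    "\<And>a. 0 < a \<Longrightarrow> a < L \<Longrightarrow> (c has_vector_derivative T a) (at a)"
  proof (rule Riesz_sum_limit[OF p L M0])
    show "0 < m h" for h by (rule m0)
    show "m \<longlonglongrightarrow> 0"
      by (rule tendsto_sandwich[OF _ _ tendsto_const \<epsilon>(2)]) (use m0 A(2) less_imp_le in \<open>auto intro!: always_eventually\<close>)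
    show "\<epsilon> \<longlonglongrightarrow> 0" by (rule \<epsilon>)
    show "norm (c b - c a - (b - a) *\<^sub>R S h a)
      \<le> 4 * m h + \<epsilon> h + (b - a + m h) * (M * (b - a + m h) powr (p - 1)) powr (1 / p)"
      if "0 \<le> a" "a \<le> b" "b \<le> L" for h a b
      unfolding S_def by (rule inscribed_approximation.tangent_chord[OF A(1) that])
    show "(\<Sum>j<k. norm (S h (y (Suc j)) - S h (y j)) powr p / (y (Suc j) - y j + m h) powr (p - 1)) \<le> M"
      if "\<And>j. j < k \<Longrightarrow> y j \<le> y (Suc j)" "0 \<le> y 0" "y k \<le> L" for h k and y :: "nat \<Rightarrow> real"
      unfolding S_def by (rule inscribed_approximation.tangent_Riesz_sum[OF A(1) that])
  qed blast
  obtain g where "g \<in> borel_measurable borel" "set_integrable lborel {0..L} g"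
    "\<And>a b. 0 \<le> a \<Longrightarrow> a \<le> b \<Longrightarrow> b \<le> L \<Longrightarrow> T b - T a = (LINT x:{a..b}|lborel. g x)"
    "(\<integral>\<^sup>+x\<in>{0..L}. ennreal (norm (g x) powr p) \<partial>lborel) \<le> ennreal M"
    using Riesz_representation[OF p L M0 T(1)] by blast
  with T(2) show thesis by (rule that)
qed

section \<open>Weak derivatives on an interval\<close>

lemma test_functionD:
  assumes \<phi>: "test_function S \<phi>"
  shows "(\<phi> has_real_derivative deriv \<phi> x) (at x)" "continuous_on A \<phi>" "x \<notin> S \<Longrightarrow> \<phi> x = 0"
proof -
  have "(deriv ^^ 0) \<phi> field_differentiable at x" for x using \<phi> unfolding test_function_def by blast
  then show *: "(\<phi> has_real_derivative deriv \<phi> x) (at x)" for x by (simp add: DERIV_deriv_iff_field_differentiable)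
  show "continuous_on A \<phi>" by (intro continuous_at_imp_continuous_on ballI DERIV_isCont[OF *])
  show "\<phi> x = 0" if "x \<notin> S"
  proof (rule ccontr)
    assume "\<phi> x \<noteq> 0"
    then have "x \<in> closure {x. \<phi> x \<noteq> 0}" by (intro subsetD[OF closure_subset]) simp
    moreover have "closure {x. \<phi> x \<noteq> 0} \<subseteq> S" using \<phi> unfolding test_function_def by blast
    ultimately show False using that by blast
  qed
qed

text \<open>Off the closed support \<phi> vanishes on a neighbourhood, hence so does its derivative.
  This allows integration by parts to be iterated.\<close>

lemma test_function_deriv:
  assumes \<phi>: "test_function S \<phi>"
  shows "test_function S (deriv \<phi>)"
proof -
  have sub: "{x. deriv \<phi> x \<noteq> 0} \<subseteq> closure {x. \<phi> x \<noteq> 0}"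
  proof (rule ccontr)
    assume "\<not> ?thesis"
    then obtain x where x: "deriv \<phi> x \<noteq> 0" "x \<in> - closure {x. \<phi> x \<noteq> 0}" by auto
    have "deriv \<phi> x = 0"
    proof (rule DERIV_unique[OF test_functionD(1)[OF \<phi>]])
      show "(\<phi> has_real_derivative 0) (at x)"
      proof (rule has_field_derivative_transform_within_open[of "\<lambda>_. 0"])
        show "0 = \<phi> y" if "y \<in> - closure {x. \<phi> x \<noteq> 0}" for y
          using subsetD[OF closure_subset, of y "{x. \<phi> x \<noteq> 0}"] that by auto
      qed (use x in auto)
    qed
    with x show False by simp
  qed
  then have "closure {x. deriv \<phi> x \<noteq> 0} \<subseteq> closure {x. \<phi> x \<noteq> 0}"
    by (rule closure_minimal) simp
  moreover have "(deriv ^^ k) (deriv \<phi>) field_differentiable at x" for k x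
  proof -
    have "(deriv ^^ Suc k) \<phi> field_differentiable at x" using \<phi> unfolding test_function_def by blast
    then show ?thesis by (simp only: funpow_Suc_right comp_apply)
  qed
  moreover have "compact (closure {x. deriv \<phi> x \<noteq> 0} \<inter> closure {x. \<phi> x \<noteq> 0})"
    using \<phi> by (intro closed_Int_compact) (auto simp: test_function_def)
  ultimately show ?thesis
    using \<phi> unfolding test_function_def by (auto simp: Int_absorb2)
qed

lemma set_lebesgue_integral_Ioo_Icc:
  fixes f :: "real \<Rightarrow> 'a::euclidean_space"
  shows "(LINT x:{a<..<b}|lebesgue. f x) = (LINT x:{a..b}|lebesgue. f x)"
proof (cases "a \<le> b")
  case True
  then show ?thesis by (intro set_integral_discrete_difference[where X="{a, b}"]) auto
qed simp

lemma absolutely_integrable_Ioo_Icc: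
  fixes f :: "real \<Rightarrow> 'a::euclidean_space"
  shows "f absolutely_integrable_on {a<..<b} \<longleftrightarrow> f absolutely_integrable_on {a..b}"
proof (cases "a \<le> b")
  case True
  then show ?thesis by (intro set_integrable_discrete_difference[where X="{a, b}"]) auto
qed simp

text \<open>Fubini's theorem on the product of \<open>lebesgue\<close> with itself asks for this;
  the covering sets are those of \<open>lborel\<close>.\<close>

lemma sigma_finite_lebesgue: "sigma_finite_measure (lebesgue :: 'a::euclidean_space measure)"
proof
  obtain A :: "'a set set" where A: "countable A" "A \<subseteq> sets lborel" "\<Union>A = space lborel" "\<forall>a\<in>A. emeasure lborel a \<noteq> \<infinity>"
    using lborel.sigma_finite_countable by blast
  then show "\<exists>A::'a set set. countable A \<and> A \<subseteq> sets lebesgue \<and> \<Union>A = space lebesgue \<and> (\<forall>a\<in>A. emeasure lebesgue a \<noteq> \<infinity>)"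
    by (intro exI[of _ A]) auto
qed

lemma set_integral_deriv:
  fixes f :: "real \<Rightarrow> real"
  assumes ab: "a \<le> b" and f: "\<And>x. (f has_real_derivative f' x) (at x)" and f': "continuous_on {a..b} f'"
  shows "(LINT x:{a..b}|lebesgue. f' x) = f b - f a"
proof -
  have "f' absolutely_integrable_on {a..b}" using f' by (rule absolutely_integrable_continuous_real)
  then have "(LINT x:{a..b}|lebesgue. f' x) = integral {a..b} f'" by (rule set_lebesgue_integral_eq_integral)
  also have "\<dots> = f b - f a"
    by (intro integral_unique fundamental_theorem_of_calculus ab)
      (use f in \<open>auto simp: has_real_derivative_iff_has_vector_derivative[symmetric] intro: DERIV_subset\<close>)
  finally show ?thesis .
qed

text \<open>Writing F as F 0 plus the integral of f and exchanging the order of integration over the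
  triangle u \<le> t leaves only a derivative of \<phi> to be integrated, so F is never
  differentiated.\<close>

lemma integral_by_parts_test_function:
  fixes F f :: "real \<Rightarrow> 'a::euclidean_space"
  assumes L: "0 < L" and f: "f absolutely_integrable_on {0..L}"
    and F: "\<And>t. 0 \<le> t \<Longrightarrow> t \<le> L \<Longrightarrow> F t = F 0 + (LINT x:{0..t}|lebesgue. f x)"
    and \<phi>: "test_function {0<..<L} \<phi>"
  shows "(LINT x:{0<..<L}|lebesgue. deriv \<phi> x *\<^sub>R F x) = - (LINT x:{0<..<L}|lebesgue. \<phi> x *\<^sub>R f x)"
proof -
  interpret pair_sigma_finite "lebesgue :: real measure" "lebesgue :: real measure"
    by (intro pair_sigma_finite.intro sigma_finite_lebesgue)
  note \<phi>' = test_functionD[OF \<phi>] test_functionD[OF test_function_deriv[OF \<phi>]]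
  define a where "a t = indicator {0..L} t * deriv \<phi> t" for t :: real
  define b where "b u = indicator {0..L} u *\<^sub>R f u" for u :: real
  have ai: "integrable lebesgue a"
    using absolutely_integrable_continuous_real[OF \<phi>'(5)[of "{0..L}"]]
    by (simp add: set_integrable_def a_def[abs_def])
  have bi: "integrable lebesgue b" using f by (simp add: set_integrable_def b_def[abs_def])
  have [measurable]: "a \<in> borel_measurable lebesgue" "b \<in> borel_measurable lebesgue" using ai bi by auto
  have ab: "integrable (lebesgue \<Otimes>\<^sub>M lebesgue) (\<lambda>(t, u). a t *\<^sub>R b u)"
  proof (rule Fubini_integrable)
    show "integrable lebesgue (\<lambda>t. \<integral>u. norm (case (t, u) of (t, u) \<Rightarrow> a t *\<^sub>R b u) \<partial>lebesgue)"
      using ai bi by simp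
  qed (use bi in auto)
  \<comment> \<open>The triangle must lie in the product of two completed sigma-algebras; the
    projections are measurable into \<open>borel\<close>, which is enough.\<close>
  have meas: "{z. snd z \<le> (fst z :: real)} \<in> sets (lebesgue \<Otimes>\<^sub>M lebesgue)"
  proof -
    have [measurable]: "(\<lambda>x::real. x) \<in> lebesgue \<rightarrow>\<^sub>M borel" by (rule measurable_completion) simp
    have [measurable]: "fst \<in> lebesgue \<Otimes>\<^sub>M lebesgue \<rightarrow>\<^sub>M (borel :: real measure)"
      using measurable_compose[OF measurable_fst, of "\<lambda>x::real. x" lebesgue borel lebesgue] by simp
    have [measurable]: "snd \<in> lebesgue \<Otimes>\<^sub>M lebesgue \<rightarrow>\<^sub>M (borel :: real measure)"
      using measurable_compose[OF measurable_snd, of "\<lambda>x::real. x" lebesgue borel lebesgue] by simp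
    have "{z \<in> space (lebesgue \<Otimes>\<^sub>M lebesgue). snd z \<le> (fst z :: real)} \<in> sets (lebesgue \<Otimes>\<^sub>M lebesgue)"
      by measurable
    then show ?thesis by (simp add: space_pair_measure)
  qed
  define h where "h t u = indicator {z. snd z \<le> fst z} (t, u) *\<^sub>R (a t *\<^sub>R b u)" for t u :: real
  have hi: "integrable (lebesgue \<Otimes>\<^sub>M lebesgue) (case_prod h)"
    using integrable_mult_indicator[OF meas ab] by (simp add: h_def[abs_def] split_beta')
  have inner1: "(\<integral>u. h t u \<partial>lebesgue) = indicator {0..L} t *\<^sub>R (deriv \<phi> t *\<^sub>R F t) - indicator {0..L} t *\<^sub>R (deriv \<phi> t *\<^sub>R F 0)" for t
  proof (cases "t \<in> {0..L}")
    case True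
    have "(\<integral>u. h t u \<partial>lebesgue) = (\<integral>u. deriv \<phi> t *\<^sub>R (indicator {0..t} u *\<^sub>R f u) \<partial>lebesgue)"
      by (intro Bochner_Integration.integral_cong) (use True in \<open>auto simp: h_def a_def b_def indicator_def\<close>)
    also have "\<dots> = deriv \<phi> t *\<^sub>R (LINT u:{0..t}|lebesgue. f u)"
      unfolding set_lebesgue_integral_def by (rule integral_scaleR_right)
    also have "(LINT u:{0..t}|lebesgue. f u) = F t - F 0" using F[of t] True by simp
    finally show ?thesis using True by (simp add: scaleR_diff_right)
  qed (simp add: h_def a_def)
  have inner2: "(\<integral>t. h t u \<partial>lebesgue) = - (indicator {0..L} u *\<^sub>R (\<phi> u *\<^sub>R f u))" for u
  proof (cases "u \<in> {0..L}")
    case True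
    have "(\<integral>t. h t u \<partial>lebesgue) = (\<integral>t. (indicator {u..L} t *\<^sub>R deriv \<phi> t) *\<^sub>R f u \<partial>lebesgue)"
      by (intro Bochner_Integration.integral_cong) (use True in \<open>auto simp: h_def a_def b_def indicator_def\<close>)
    also have "\<dots> = (LINT t:{u..L}|lebesgue. deriv \<phi> t) *\<^sub>R f u"
      using absolutely_integrable_continuous_real[OF \<phi>'(5)[of "{u..L}"]]
      by (simp add: set_lebesgue_integral_def set_integrable_def)
    also have "(LINT t:{u..L}|lebesgue. deriv \<phi> t) = \<phi> L - \<phi> u"
      using True by (intro set_integral_deriv \<phi>') auto
    finally show ?thesis using True \<phi>'(3)[of L] by simp
  qed (simp add: h_def b_def)
  have Fi: "integrable lebesgue (\<lambda>t. indicator {0..L} t *\<^sub>R (deriv \<phi> t *\<^sub>R F 0))"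
    using integrable_scaleR_left[OF ai, of "F 0"] by (simp add: a_def)
  have hi1: "integrable lebesgue (\<lambda>t. \<integral>u. h t u \<partial>lebesgue)" by (rule integrable_fst[OF hi])
  \<comment> \<open>The constant F 0 drops out because \<phi> vanishes at both ends of the
    interval.\<close>
  have F0: "(LINT t|lebesgue. indicator {0..L} t *\<^sub>R (deriv \<phi> t *\<^sub>R F 0)) = 0"
  proof -
    have "(LINT t|lebesgue. indicator {0..L} t *\<^sub>R (deriv \<phi> t *\<^sub>R F 0)) = (LINT t:{0..L}|lebesgue. deriv \<phi> t) *\<^sub>R F 0"
      using integral_scaleR_left[OF ai, of "F 0"] by (simp add: set_lebesgue_integral_def a_def[abs_def])
    also have "(LINT t:{0..L}|lebesgue. deriv \<phi> t) = \<phi> L - \<phi> 0"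
      using L by (intro set_integral_deriv \<phi>') auto
    finally have *: "(LINT t|lebesgue. indicator {0..L} t *\<^sub>R (deriv \<phi> t *\<^sub>R F 0)) = (\<phi> L - \<phi> 0) *\<^sub>R F 0" .
    show ?thesis unfolding * using \<phi>'(3)[of L] \<phi>'(3)[of 0] by simp
  qed
  have "(LINT t|lebesgue. indicator {0..L} t *\<^sub>R (deriv \<phi> t *\<^sub>R F t))
     = (LINT t|lebesgue. (\<integral>u. h t u \<partial>lebesgue) + indicator {0..L} t *\<^sub>R (deriv \<phi> t *\<^sub>R F 0))"
    by (simp add: inner1)
  also have "\<dots> = (LINT t|lebesgue. (\<integral>u. h t u \<partial>lebesgue))"
    unfolding Bochner_Integration.integral_add[OF hi1 Fi] F0 by simp
  also have "\<dots> = (LINT u|lebesgue. (\<integral>t. h t u \<partial>lebesgue))"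
    by (rule Fubini_integral[OF hi, symmetric])
  also have "\<dots> = - (LINT u:{0..L}|lebesgue. \<phi> u *\<^sub>R f u)"
    by (simp add: inner2 set_lebesgue_integral_def)
  finally show ?thesis
    by (simp add: set_lebesgue_integral_Ioo_Icc) (simp add: set_lebesgue_integral_def)
qed

section \<open>Smooth functions of compact support\<close>

text \<open>The classical flat function exp (-1/x), extended by 0, with additional powers of 1/x:
  linear combinations of these are closed under differentiation.\<close>

definition flat_exp :: "nat \<Rightarrow> real \<Rightarrow> real" where
  "flat_exp k x = (if x > 0 then inverse x ^ k * exp (- inverse x) else 0)"

lemma flat_exp_tendsto_0: "(flat_exp k \<longlongrightarrow> 0) (at_right 0)"
proof -
  have "((\<lambda>x. inverse x ^ k / exp (inverse x)) \<longlongrightarrow> (0::real)) (at_right 0)"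
    by (rule filterlim_compose[OF tendsto_power_div_exp_0 filterlim_inverse_at_top_right])
  then show ?thesis
  proof (rule Lim_transform_eventually)
    show "\<forall>\<^sub>F x in at_right 0. inverse x ^ k / exp (inverse x) = flat_exp k x"
      by (auto simp: eventually_at_filter flat_exp_def exp_minus divide_inverse)
  qed
qed

text \<open>The delicate point is 0: from the right the difference quotient is
  \<open>flat_exp (Suc k)\<close>, which tends to 0, and from the left it is 0.\<close>

lemma flat_exp_deriv:
  "(flat_exp k has_real_derivative flat_exp (k + 2) x - real k * flat_exp (k + 1) x) (at x)"
proof -
  consider "x > 0" | "x < 0" | "x = 0" by linarith
  then show ?thesis
  proof cases
    case 1
    have "((\<lambda>x. inverse x ^ k * exp (- inverse x)) has_real_derivative
       flat_exp (k + 2) x - real k * flat_exp (k + 1) x) (at x)"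
      using 1 by (auto intro!: derivative_eq_intros simp: flat_exp_def power2_eq_square)
        (cases k; simp add: algebra_simps)
    then show ?thesis
      by (rule has_field_derivative_transform_within_open[of _ _ _ "{0<..}"]) (use 1 in \<open>auto simp: flat_exp_def\<close>)
  next
    case 2
    have "((\<lambda>x. 0) has_real_derivative flat_exp (k + 2) x - real k * flat_exp (k + 1) x) (at x)"
      using 2 by (simp add: flat_exp_def)
    then show ?thesis
      by (rule has_field_derivative_transform_within_open[of _ _ _ "{..<0}"]) (use 2 in \<open>auto simp: flat_exp_def\<close>)
  next
    case 3
    have "((\<lambda>h. (flat_exp k h - flat_exp k 0) / (h - 0)) \<longlongrightarrow> 0) (at_right 0)"
    proof (rule Lim_transform_eventually[OF flat_exp_tendsto_0[of "Suc k"]])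
      show "\<forall>\<^sub>F x in at_right 0. flat_exp (Suc k) x = (flat_exp k x - flat_exp k 0) / (x - 0)"
        by (auto simp: eventually_at_filter flat_exp_def divide_inverse)
    qed
    moreover have "((\<lambda>h. (flat_exp k h - flat_exp k 0) / (h - 0)) \<longlongrightarrow> 0) (at_left 0)"
    proof (rule Lim_transform_eventually[OF tendsto_const])
      show "\<forall>\<^sub>F x in at_left 0. 0 = (flat_exp k x - flat_exp k 0) / (x - 0)"
        by (auto simp: eventually_at_filter flat_exp_def)
    qed
    ultimately show ?thesis
      unfolding 3 has_field_derivative_iff by (simp add: filterlim_split_at flat_exp_def)
  qed
qed

lemma flat_exp_pos: "x > 0 \<Longrightarrow> flat_exp 0 x > 0" and flat_exp_nonneg: "flat_exp 0 x \<ge> 0"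
  and flat_exp_le_1: "flat_exp 0 x \<le> 1" and flat_exp_nonpos_arg: "x \<le> 0 \<Longrightarrow> flat_exp k x = 0"
  by (auto simp: flat_exp_def)

text \<open>An algebra of functions closed under differentiation, so that its members are smooth without any
  formula for their higher derivatives.\<close>

inductive_set flat_algebra :: "(real \<Rightarrow> real) set" where
  gen: "(\<lambda>x. flat_exp k (a * x + b)) \<in> flat_algebra"
| const: "(\<lambda>x. a) \<in> flat_algebra"
| add: "f \<in> flat_algebra \<Longrightarrow> g \<in> flat_algebra \<Longrightarrow> (\<lambda>x. f x + g x) \<in> flat_algebra"
| mult: "f \<in> flat_algebra \<Longrightarrow> g \<in> flat_algebra \<Longrightarrow> (\<lambda>x. f x * g x) \<in> flat_algebra"

lemma flat_algebra_deriv: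
  assumes "f \<in> flat_algebra"
  shows "\<exists>f'\<in>flat_algebra. \<forall>x. (f has_real_derivative f' x) (at x)"
  using assms
proof induction
  case (gen k a b)
  have m: "(\<lambda>x. (flat_exp (k + 2) (a * x + b) + (- real k) * flat_exp (k + 1) (a * x + b)) * a) \<in> flat_algebra"
    by (intro flat_algebra.intros)
  have d: "((\<lambda>x. flat_exp k (a * x + b)) has_real_derivative
     (flat_exp (k + 2) (a * x + b) + (- real k) * flat_exp (k + 1) (a * x + b)) * a) (at x)" for x
  proof (rule DERIV_chain2[where f="flat_exp k" and g="\<lambda>x. a * x + b"])
    show "(flat_exp k has_real_derivative flat_exp (k + 2) (a * x + b) + (- real k) * flat_exp (k + 1) (a * x + b)) (at (a * x + b))"
      using flat_exp_deriv[of k "a * x + b"] by simp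
    show "((\<lambda>x. a * x + b) has_real_derivative a) (at x)" by (auto intro!: derivative_eq_intros)
  qed
  show ?case by (intro bexI[OF _ m] allI d)
next
  case (const a)
  show ?case by (intro bexI[of _ "\<lambda>x. 0"]) (auto intro: flat_algebra.const)
next
  case (add f g)
  then obtain f' g' where "f' \<in> flat_algebra" "g' \<in> flat_algebra"
    "\<forall>x. (f has_real_derivative f' x) (at x)" "\<forall>x. (g has_real_derivative g' x) (at x)" by blast
  then show ?case
    by (intro bexI[of _ "\<lambda>x. f' x + g' x"]) (auto intro!: derivative_intros flat_algebra.add)
next
  case (mult f g)
  then obtain f' g' where fg: "f' \<in> flat_algebra" "g' \<in> flat_algebra"
    "\<forall>x. (f has_real_derivative f' x) (at x)" "\<forall>x. (g has_real_derivative g' x) (at x)" by blast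
  then have d: "\<forall>x. ((\<lambda>x. f x * g x) has_real_derivative f' x * g x + g' x * f x) (at x)"
    by (auto intro!: DERIV_mult)
  have m: "(\<lambda>x. f' x * g x + g' x * f x) \<in> flat_algebra"
    using fg mult by (intro flat_algebra.intros)
  show ?case by (intro bexI[OF _ m] d)
qed

lemma flat_algebra_smooth:
  assumes "f \<in> flat_algebra"
  shows "(deriv ^^ k) f field_differentiable at x"
proof -
  have d: "deriv f \<in> flat_algebra" if "f \<in> flat_algebra" for f
  proof -
    from flat_algebra_deriv[OF that]
    obtain f' where f': "f' \<in> flat_algebra" "\<forall>x. (f has_real_derivative f' x) (at x)" by blast
    then have "deriv f = f'" using DERIV_imp_deriv by blast
    with f' show ?thesis by simp
  qed
  have "(deriv ^^ k) f \<in> flat_algebra" by (induction k) (use assms d in auto)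
  from flat_algebra_deriv[OF this] show ?thesis by (auto simp: field_differentiable_def)
qed

lemma test_functionI:
  assumes "\<And>k x. (deriv ^^ k) f field_differentiable at x"
    and supp: "\<And>x. f x \<noteq> 0 \<Longrightarrow> x \<in> {a..b}" and sub: "{a..b} \<subseteq> S"
  shows "test_function S f"
proof -
  have "closure {x. f x \<noteq> 0} \<subseteq> {a..b}" using supp by (intro closure_minimal) auto
  moreover have "compact ({a..b} \<inter> closure {x. f x \<noteq> 0})" by (intro compact_Int_closed) auto
  ultimately have "compact (closure {x. f x \<noteq> 0})" by (simp add: Int_absorb1)
  with \<open>closure {x. f x \<noteq> 0} \<subseteq> {a..b}\<close> sub show ?thesis
    unfolding test_function_def using assms(1) by blast
qed

section \<open>Fundamental lemma and uniqueness of weak derivatives\<close>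

text \<open>Smooth cutoffs bounded by 1 converge to 1 on the open interval and vanish outside it, so
  dominated convergence replaces \<phi> by the indicator of the interval.\<close>

lemma integral_zero_if_orthogonal:
  fixes f :: "real \<Rightarrow> 'a::euclidean_space"
  assumes f: "f absolutely_integrable_on {a..b}" and ab: "a < b" "{a..b} \<subseteq> S"
    and orth: "\<And>\<phi>. test_function S \<phi> \<Longrightarrow> (\<And>x. \<phi> x \<noteq> 0 \<Longrightarrow> x \<in> {a..b}) \<Longrightarrow> (LINT x:{a..b}|lebesgue. \<phi> x *\<^sub>R f x) = 0"
  shows "(LINT x:{a..b}|lebesgue. f x) = 0"
proof -
  \<comment> \<open>For a < x < b and n > 0 this is exp (-1/(n (x - a))) exp (-1/(n (b - x))), which
    tends to 1. The arguments are spelled out as affine functions to match the generators of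
    \<open>flat_algebra\<close>.\<close>
  define \<phi> where "\<phi> n x = flat_exp 0 (real n * x + (- (real n * a))) * flat_exp 0 ((- real n) * x + real n * b)" for n x
  have \<phi>A: "\<phi> n \<in> flat_algebra" for n unfolding \<phi>_def[abs_def] by (intro flat_algebra.intros)
  have supp: "x \<in> {a..b}" if "\<phi> n x \<noteq> 0" for n x
  proof (rule ccontr)
    assume "x \<notin> {a..b}"
    then consider "x < a" | "b < x" by force
    then show False
    proof cases
      case 1
      then have "real n * x + (- (real n * a)) \<le> 0" by (simp add: mult_left_mono)
      then show False using that flat_exp_nonpos_arg by (simp add: \<phi>_def)
    next
      case 2
      then have "(- real n) * x + real n * b \<le> 0" by (simp add: mult_left_mono)
      then show False using that flat_exp_nonpos_arg by (simp add: \<phi>_def)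
    qed
  qed
  have test: "test_function S (\<phi> n)" for n
    by (rule test_functionI[OF flat_algebra_smooth[OF \<phi>A] supp ab(2)])
  have [measurable]: "\<phi> n \<in> borel_measurable lebesgue" for n
    using continuous_imp_measurable_on_sets_lebesgue[OF test_functionD(2)[OF test, of UNIV n]] by simp
  have lim: "(\<lambda>n. \<phi> n x) \<longlonglongrightarrow> 1" if x: "a < x" "x < b" for x
  proof -
    have inv: "(\<lambda>n. inverse (real n * y)) \<longlonglongrightarrow> 0" for y
      using tendsto_mult_right_zero[OF lim_inverse_n[where 'a=real], of "inverse y"] by (simp add: mult.commute)
    have "(\<lambda>n. exp (- inverse (real n * (x - a))) * exp (- inverse (real n * (b - x)))) \<longlonglongrightarrow> exp (- 0) * exp (- 0)"
      by (intro tendsto_mult tendsto_exp tendsto_minus inv)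
    then have "(\<lambda>n. exp (- inverse (real n * (x - a))) * exp (- inverse (real n * (b - x)))) \<longlonglongrightarrow> 1" by simp
    then show ?thesis
    proof (rule Lim_transform_eventually)
      show "\<forall>\<^sub>F n in sequentially. exp (- inverse (real n * (x - a))) * exp (- inverse (real n * (b - x))) = \<phi> n x"
        using eventually_gt_at_top[of 0]
      proof eventually_elim
        case (elim n)
        have "real n * x + (- (real n * a)) = real n * (x - a)" "(- real n) * x + real n * b = real n * (b - x)"
          by (simp_all add: algebra_simps)
        then show ?case using elim x by (simp only: \<phi>_def flat_exp_def) simp
      qed
    qed
  qed
  have bound: "\<bar>\<phi> n x\<bar> \<le> 1" for n x
    unfolding \<phi>_def using flat_exp_nonneg flat_exp_le_1 by (simp add: abs_mult mult_le_one)
  have fi: "integrable lebesgue (\<lambda>x. indicator {a..b} x *\<^sub>R f x)" using f by (simp add: set_integrable_def)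
  have "(\<lambda>n. LINT x|lebesgue. \<phi> n x *\<^sub>R (indicator {a..b} x *\<^sub>R f x)) \<longlonglongrightarrow> (LINT x|lebesgue. indicator {a..b} x *\<^sub>R f x)"
  proof (rule integral_dominated_convergence[where w="\<lambda>x. norm (indicator {a..b} x *\<^sub>R f x)"])
    have "AE x in lebesgue. x \<noteq> a" "AE x in lebesgue. x \<noteq> b"
      by (auto intro!: AE_completion AE_lborel_singleton)
    then show "AE x in lebesgue. (\<lambda>n. \<phi> n x *\<^sub>R (indicator {a..b} x *\<^sub>R f x)) \<longlonglongrightarrow> indicator {a..b} x *\<^sub>R f x"
    proof eventually_elim
      case (elim x)
      show ?case
      proof (cases "a < x \<and> x < b")
        case True
        then show ?thesis using tendsto_scaleR[OF lim[of x] tendsto_const] by simp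
      next
        case False
        then have "indicator {a..b} x = (0::real)" using elim by (auto simp: indicator_def)
        then show ?thesis by simp
      qed
    qed
    show "AE x in lebesgue. norm (\<phi> n x *\<^sub>R (indicator {a..b} x *\<^sub>R f x)) \<le> norm (indicator {a..b} x *\<^sub>R f x)" for n
    proof (rule AE_I2)
      fix x
      show "norm (\<phi> n x *\<^sub>R (indicator {a..b} x *\<^sub>R f x)) \<le> norm (indicator {a..b} x *\<^sub>R f x)"
        using mult_left_le_one_le[OF norm_ge_zero[of "indicator {a..b} x *\<^sub>R f x"] abs_ge_zero bound[of n x]]
        by (simp only: norm_scaleR)
    qed
    show "integrable lebesgue (\<lambda>x. norm (indicator {a..b} x *\<^sub>R f x))" by (rule integrable_norm[OF fi])
    show "(\<lambda>x. indicator {a..b} x *\<^sub>R f x) \<in> borel_measurable lebesgue"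
      by (rule borel_measurable_integrable[OF fi])
    show "(\<lambda>x. \<phi> n x *\<^sub>R (indicator {a..b} x *\<^sub>R f x)) \<in> borel_measurable lebesgue" for n
      by (rule borel_measurable_scaleR[OF _ borel_measurable_integrable[OF fi]]) simp
  qed
  moreover have "(LINT x|lebesgue. \<phi> n x *\<^sub>R (indicator {a..b} x *\<^sub>R f x)) = 0" for n
    using orth[OF test supp, of n] by (simp add: set_lebesgue_integral_def mult.commute)
  ultimately have "(\<lambda>n::nat. 0) \<longlonglongrightarrow> (LINT x|lebesgue. indicator {a..b} x *\<^sub>R f x)" by simp
  from LIMSEQ_unique[OF tendsto_const this] show ?thesis by (simp add: set_lebesgue_integral_def)
qed

text \<open>The sign criterion for integrals over half-open intervals, applied to each coordinate
  and to its negative. Restricting Lebesgue measure to [a, b] provides the finite measure it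
  needs.\<close>

lemma AE_zero_if_integrals_zero:
  fixes f :: "real \<Rightarrow> 'a::euclidean_space"
  assumes f: "f absolutely_integrable_on {a..b}"
    and zero: "\<And>c d. a \<le> c \<Longrightarrow> c < d \<Longrightarrow> d \<le> b \<Longrightarrow> (LINT x:{c..d}|lebesgue. f x) = 0"
  shows "AE x in lebesgue. x \<in> {a..b} \<longrightarrow> f x = 0"
proof -
  have "AE x in lebesgue. x \<in> {a..b} \<longrightarrow> f x \<bullet> i = 0" if i: "i \<in> Basis" for i
  proof -
    define h where "h x = indicator {a..b} x * (f x \<bullet> i)" for x
    have fi: "integrable lebesgue (\<lambda>x. indicator {a..b} x *\<^sub>R f x)" using f by (simp add: set_integrable_def)
    have hi: "integrable lebesgue h"
      using integrable_inner_left[OF fi, of i] by (simp add: h_def[abs_def])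
    \<comment> \<open>The sign criterion lives on Borel sets while f is only Lebesgue measurable,
      hence the Borel representative.\<close>
    obtain h' where h'[measurable]: "h' \<in> borel_measurable lborel" and hh: "AE x in lborel. h x = h' x"
      using completion_ex_borel_measurable_real[of h lborel] hi by auto
    have [measurable]: "h' \<in> borel_measurable lebesgue" by (rule measurable_completion) simp
    have hh': "AE x in lebesgue. h x = h' x" by (rule AE_completion[OF hh])
    have h'i: "integrable lborel h'"
    proof -
      have "integrable lebesgue h'" using hi hh' by (subst integrable_cong_AE[of _ _ h]) auto
      then show ?thesis by (simp add: integrable_completion)
    qed
    define \<nu> where "\<nu> = density lborel (\<lambda>x. ennreal (indicator {a..b} x))"
    have sets: "sets \<nu> = sets borel" by (simp add: \<nu>_def)
    have fin: "finite_measure \<nu>"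
    proof (rule finite_measureI)
      have "emeasure \<nu> (space \<nu>) = (\<integral>\<^sup>+x. indicator {a..b} x \<partial>lborel)"
        unfolding \<nu>_def by (subst emeasure_density) (auto simp: ennreal_indicator)
      also have "\<dots> = emeasure lborel {a..b}" by (rule nn_integral_indicator) simp
      finally show "emeasure \<nu> (space \<nu>) \<noteq> \<infinity>" by (simp add: emeasure_lborel_Icc_eq)
    qed
    have ui: "integrable \<nu> h'"
      unfolding \<nu>_def using integrable_mult_indicator[OF _ h'i, of "{a..b}"]
      by (subst integrable_density) auto
    have ui0: "(LINT x:{c<..d}|\<nu>. h' x) = 0" for c d
    proof -
      have "(LINT x:{c<..d}|\<nu>. h' x) = (LINT x|lborel. indicator {a..b} x *\<^sub>R (indicator {c<..d} x *\<^sub>R h' x))"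
        unfolding \<nu>_def set_lebesgue_integral_def by (subst integral_density) auto
      also have "\<dots> = (LINT x|lebesgue. indicator {a..b} x *\<^sub>R (indicator {c<..d} x *\<^sub>R h' x))"
        by (subst integral_completion) auto
      also have "\<dots> = (LINT x|lebesgue. (indicator {max a c..min b d} x *\<^sub>R f x) \<bullet> i)"
      proof (rule integral_cong_AE)
        have "AE x in lebesgue. x \<noteq> c" by (auto intro!: AE_completion AE_lborel_singleton)
        with hh' show "AE x in lebesgue. indicator {a..b} x *\<^sub>R (indicator {c<..d} x *\<^sub>R h' x) = (indicator {max a c..min b d} x *\<^sub>R f x) \<bullet> i"
        proof eventually_elim
          case (elim x)
          then show ?case by (auto simp: h_def indicator_def split: if_splits)
        qed
        have "f absolutely_integrable_on {max a c..min b d}"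
          by (rule set_integrable_subset[OF f]) auto
        then have "(\<lambda>x. indicator {max a c..min b d} x *\<^sub>R f x) \<in> borel_measurable lebesgue"
          unfolding set_integrable_def by (rule borel_measurable_integrable)
        then show "(\<lambda>x. (indicator {max a c..min b d} x *\<^sub>R f x) \<bullet> i) \<in> borel_measurable lebesgue"
          by (rule borel_measurable_inner) simp
        show "(\<lambda>x. indicator {a..b} x *\<^sub>R (indicator {c<..d} x *\<^sub>R h' x)) \<in> borel_measurable lebesgue"
          by (intro borel_measurable_scaleR borel_measurable_indicator) simp_all
      qed
      also have "\<dots> = (LINT x:{max a c..min b d}|lebesgue. f x) \<bullet> i"
      proof -
        have *: "f absolutely_integrable_on {max a c..min b d}"
          by (rule set_integrable_subset[OF f]) auto
        show ?thesis unfolding set_lebesgue_integral_def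
          by (rule integral_inner_left) (rule *[unfolded set_integrable_def])
      qed
      also have "(LINT x:{max a c..min b d}|lebesgue. f x) = 0"
      proof (cases "max a c < min b d")
        case True
        then show ?thesis by (intro zero) auto
      next
        case False
        show ?thesis
        proof (cases "max a c = min b d")
          case True
          have "AE x in lebesgue. x \<noteq> max a c" by (auto intro!: AE_completion AE_lborel_singleton)
          then have "AE x in lebesgue. indicator {max a c..min b d} x *\<^sub>R f x = 0"
            unfolding True by eventually_elim (auto simp: indicator_def)
          then show ?thesis unfolding set_lebesgue_integral_def by (rule integral_eq_zero_AE)
        next
          case False
          with \<open>\<not> max a c < min b d\<close> have e: "{max a c..min b d} = {}" by auto
          show ?thesis unfolding e set_lebesgue_integral_def by simp
        qed
      qed
      finally show ?thesis by simp
    qed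
    have "AE x in \<nu>. 0 \<le> h' x"
      by (rule AE_nonneg_if_integral_Ioc_nonneg[OF fin sets ui]) (simp add: ui0)
    moreover have "AE x in \<nu>. 0 \<le> - h' x"
    proof (rule AE_nonneg_if_integral_Ioc_nonneg[OF fin sets])
      show "integrable \<nu> (\<lambda>x. - h' x)" using ui by simp
      show "0 \<le> (LINT x:{c<..d}|\<nu>. - h' x)" for c d
        using ui0[of c d] by (simp add: set_lebesgue_integral_def)
    qed
    ultimately have "AE x in \<nu>. h' x = 0" by eventually_elim simp
    then have "AE x in lborel. x \<in> {a..b} \<longrightarrow> h' x = 0"
      unfolding \<nu>_def by (subst (asm) AE_density) (auto simp: indicator_def)
    then have "AE x in lebesgue. x \<in> {a..b} \<longrightarrow> h' x = 0" by (rule AE_completion)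
    with hh' show ?thesis by eventually_elim (auto simp: h_def)
  qed
  then have "AE x in lebesgue. \<forall>i\<in>Basis. x \<in> {a..b} \<longrightarrow> f x \<bullet> i = 0"
    by (intro AE_ball_countable[THEN iffD2] countable_finite) auto
  then show ?thesis by eventually_elim (auto intro: euclidean_eqI)
qed

text \<open>The difference is orthogonal to all test functions, hence zero almost everywhere on
  every compact subinterval. Local integrability gives no control up to 0 and L, so the interval is
  exhausted by [1/(n+1), L - 1/(n+1)].\<close>

lemma weak_derivative_unique:
  fixes f g1 g2 :: "real \<Rightarrow> 'a::euclidean_space"
  assumes g1: "has_weak_derivative {0<..<L} k f g1" and g2: "has_weak_derivative {0<..<L} k f g2"
  shows "AE x in lebesgue. x \<in> {0<..<L} \<longrightarrow> g1 x = g2 x"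
proof -
  have *: "AE x in lebesgue. x \<in> {a..b} \<longrightarrow> g1 x - g2 x = 0" if ab: "0 < a" "b < L" for a b
  proof (rule AE_zero_if_integrals_zero)
    have i: "g1 absolutely_integrable_on {c..d}" "g2 absolutely_integrable_on {c..d}" if "0 < c" "d < L" for c d
    proof -
      have "g1 locally_integrable_on {0<..<L}" "g2 locally_integrable_on {0<..<L}"
        using g1 g2 by (simp_all only: has_weak_derivative_def)
      moreover have "{c..d} \<subseteq> {0<..<L}" using that by auto
      ultimately show "g1 absolutely_integrable_on {c..d}" "g2 absolutely_integrable_on {c..d}"
        unfolding locally_integrable_on_def using compact_Icc by blast+
    qed
    show "(\<lambda>x. g1 x - g2 x) absolutely_integrable_on {a..b}" using i[OF ab] by (rule set_integral_diff(1))
    fix c d assume cd: "a \<le> c" "c < d" "d \<le> b"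
    then have cd': "0 < c" "d < L" using ab by auto
    show "(LINT x:{c..d}|lebesgue. g1 x - g2 x) = 0"
    proof (rule integral_zero_if_orthogonal[where S="{0<..<L}"])
      show "(\<lambda>x. g1 x - g2 x) absolutely_integrable_on {c..d}" using i[OF cd'] by (rule set_integral_diff(1))
      fix \<phi> assume \<phi>: "test_function {0<..<L} \<phi>" and supp: "\<And>x. \<phi> x \<noteq> 0 \<Longrightarrow> x \<in> {c..d}"
      have restr: "(LINT x:{0<..<L}|lebesgue. \<phi> x *\<^sub>R g x) = (LINT x:{c..d}|lebesgue. \<phi> x *\<^sub>R g x)" for g :: "real \<Rightarrow> 'a"
        unfolding set_lebesgue_integral_def using supp cd' by (intro Bochner_Integration.integral_cong) (auto simp: indicator_def)
      have pi: "(\<lambda>x. \<phi> x *\<^sub>R g x) absolutely_integrable_on {c..d}" if "g absolutely_integrable_on {c..d}" for g :: "real \<Rightarrow> 'a"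
      proof (rule absolutely_integrable_bounded_measurable_product[OF bilinear_conv_bounded_bilinear[THEN iffD2, OF bounded_bilinear_scaleR]])
        show "\<phi> \<in> borel_measurable (lebesgue_on {c..d})"
          using test_functionD(2)[OF \<phi>] by (intro continuous_imp_measurable_on_sets_lebesgue) auto
        show "bounded (\<phi> ` {c..d})"
          by (intro compact_imp_bounded compact_continuous_image test_functionD(2)[OF \<phi>]) auto
      qed (use that in auto)
      have w: "(LINT x:{0<..<L}|lebesgue. (deriv ^^ k) \<phi> x *\<^sub>R f x) = (- 1) ^ k *\<^sub>R (LINT x:{0<..<L}|lebesgue. \<phi> x *\<^sub>R g x)"
        if "has_weak_derivative {0<..<L} k f g" for g
        using that \<phi> unfolding has_weak_derivative_def by blast
      have "(- 1) ^ k *\<^sub>R (LINT x:{0<..<L}|lebesgue. \<phi> x *\<^sub>R g1 x) = (- 1) ^ k *\<^sub>R (LINT x:{0<..<L}|lebesgue. \<phi> x *\<^sub>R g2 x)"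
        by (rule trans[OF w[OF g1, symmetric] w[OF g2]])
      then have "(LINT x:{c..d}|lebesgue. \<phi> x *\<^sub>R g1 x) = (LINT x:{c..d}|lebesgue. \<phi> x *\<^sub>R g2 x)"
        by (simp add: restr)
      moreover have "(LINT x:{c..d}|lebesgue. \<phi> x *\<^sub>R (g1 x - g2 x)) = (LINT x:{c..d}|lebesgue. \<phi> x *\<^sub>R g1 x) - (LINT x:{c..d}|lebesgue. \<phi> x *\<^sub>R g2 x)"
        using set_integral_diff(2)[OF pi[OF i(1)[OF cd']] pi[OF i(2)[OF cd']]] by (simp add: scaleR_diff_right)
      ultimately show "(LINT x:{c..d}|lebesgue. \<phi> x *\<^sub>R (g1 x - g2 x)) = 0" by simp
    qed (use cd cd' in auto)
  qed
  have "AE x in lebesgue. \<forall>n. x \<in> {1 / real (Suc n)..L - 1 / real (Suc n)} \<longrightarrow> g1 x - g2 x = 0"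
    unfolding AE_all_countable by (intro allI *) auto
  then show ?thesis
  proof eventually_elim
    case (elim x)
    show ?case
    proof
      assume x: "x \<in> {0<..<L}"
      obtain n where n: "inverse (real (Suc n)) < min x (L - x)"
        using reals_Archimedean[of "min x (L - x)"] x by auto
      then have "x \<in> {1 / real (Suc n)..L - 1 / real (Suc n)}" by (auto simp: inverse_eq_divide)
      then show "g1 x = g2 x" using elim by auto
    qed
  qed
qed

section \<open>Vanishing weak second derivative and affine functions\<close>

text \<open>Integration starts at \<alpha> - 1, strictly left of the points that matter, so the
  lower limit causes no trouble at \<alpha>. Applied twice, it builds a test function from its
  second derivative.\<close>

lemma antiderivative_zero_left:
  fixes \<psi> :: "real \<Rightarrow> real"
  assumes c: "continuous_on UNIV \<psi>" and z: "\<And>x. x \<le> \<alpha> \<Longrightarrow> \<psi> x = 0"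
  obtains G where "\<And>x. (G has_real_derivative \<psi> x) (at x)" "\<And>x. x \<le> \<alpha> \<Longrightarrow> G x = 0"
proof -
  define G where "G x = integral {\<alpha> - 1..x} \<psi>" for x
  have G0: "G x = 0" if "x \<le> \<alpha>" for x
  proof -
    have "integral {\<alpha> - 1..x} \<psi> = integral {\<alpha> - 1..x} (\<lambda>_. 0)" using that z by (intro integral_cong) auto
    then show ?thesis by (simp add: G_def)
  qed
  have "(G has_real_derivative \<psi> x) (at x)" for x
  proof (cases "x < \<alpha>")
    case True
    have "((\<lambda>_. 0) has_real_derivative \<psi> x) (at x)" using z[of x] True by simp
    then show ?thesis
      by (rule has_field_derivative_transform_within_open[of _ _ _ "{..<\<alpha>}"]) (use True G0 in auto)
  next
    case False
    have "((\<lambda>u. integral {\<alpha> - 1..u} \<psi>) has_vector_derivative \<psi> x) (at x within {\<alpha> - 1..x + 1})"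
      by (rule integral_has_vector_derivative) (use c False in \<open>auto intro: continuous_on_subset\<close>)
    moreover have "at x within {\<alpha> - 1..x + 1} = at x"
      using False by (intro at_within_interior) auto
    ultimately show ?thesis by (simp add: G_def[abs_def] has_real_derivative_iff_has_vector_derivative)
  qed
  with G0 show thesis by (rule that[rotated])
qed

text \<open>Tested with \<open>\<phi>\<close> whose second derivative is \<open>(1 - l) \<psi>\<^sub>a - \<psi>\<^sub>z + l \<psi>\<^sub>b\<close>, where \<open>\<psi>\<^sub>s\<close> is a bump
  concentrated at \<open>s\<close>; the second primitive \<open>\<phi>\<close> has compact support because \<open>z = (1 - l) a + l b\<close>.\<close>

lemma affine_combination_if_weak_second_derivative_zero:
  fixes w :: "real \<Rightarrow> 'a::euclidean_space"
  assumes w: "continuous_on {0..L} w"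
    and orth: "\<And>\<phi>. test_function {0<..<L} \<phi> \<Longrightarrow> (LINT x:{0<..<L}|lebesgue. (deriv ^^ 2) \<phi> x *\<^sub>R w x) = 0"
    and ab: "0 < a" "a < b" "b < L" and l: "0 \<le> l" "l \<le> 1"
  shows "(1 - l) *\<^sub>R w a - w ((1 - l) * a + l * b) + l *\<^sub>R w b = 0"
proof -
  define z where "z = (1 - l) * a + l * b"
  have z: "a \<le> z" "z \<le> b"
    using ab l mult_left_mono[of a b l] mult_left_mono[of a b "1 - l"] by (auto simp: z_def algebra_simps)
  have "norm ((1 - l) *\<^sub>R w a - w z + l *\<^sub>R w b) \<le> 2 * \<eta>" if \<eta>: "\<eta> > 0" for \<eta>
  proof -
    have "uniformly_continuous_on {0..L} w" using w by (intro compact_uniformly_continuous) auto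
    then obtain d where d: "d > 0" "\<And>x y. x \<in> {0..L} \<Longrightarrow> y \<in> {0..L} \<Longrightarrow> dist y x < d \<Longrightarrow> dist (w y) (w x) < \<eta>"
      using \<eta> unfolding uniformly_continuous_on_def by blast
    \<comment> \<open>Half the available room: bumps of half-width \<epsilon> around points of
      [a, b] stay inside (0, L), and w varies by less than \<eta> on them.\<close>
    define \<epsilon> where "\<epsilon> = min (min a (L - b)) d / 2"
    have \<epsilon>: "0 < \<epsilon>" "\<epsilon> < a" "b + \<epsilon> < L" "\<epsilon> < d"
    proof -
      define m where "m = min (min a (L - b)) d"
      have "m \<le> a" "m \<le> L - b" "m \<le> d" "0 < m" using ab d(1) by (auto simp: m_def)
      then show "0 < \<epsilon>" "\<epsilon> < a" "b + \<epsilon> < L" "\<epsilon> < d" unfolding \<epsilon>_def m_def[symmetric] by linarith+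
    qed
    define \<psi> where "\<psi> x = flat_exp 0 (x + \<epsilon>) * flat_exp 0 (\<epsilon> - x)" for x
    have \<psi>A: "(\<lambda>x. \<psi> (x - s)) \<in> flat_algebra" for s
    proof -
      have "(\<lambda>x. flat_exp 0 (1 * x + (\<epsilon> - s)) * flat_exp 0 ((-1) * x + (\<epsilon> + s))) \<in> flat_algebra"
        by (intro flat_algebra.intros)
      then show ?thesis by (simp add: \<psi>_def algebra_simps)
    qed
    have \<psi>c: "continuous_on A (\<lambda>x. \<psi> (x - s))" for A s
      using flat_algebra_deriv[OF \<psi>A[of s]] by (meson DERIV_isCont continuous_at_imp_continuous_on)
    have \<psi>0: "\<psi> x \<ge> 0" for x by (simp add: \<psi>_def flat_exp_nonneg)
    have \<psi>z: "\<psi> x = 0" if "x \<le> - \<epsilon> \<or> \<epsilon> \<le> x" for x using that by (auto simp: \<psi>_def flat_exp_nonpos_arg)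
    \<comment> \<open>First and second primitives of the bump. Left of -\<epsilon> both vanish;
      right of \<epsilon> the first is the constant I, the mass of the bump, and the second is
      affine with slope I.\<close>
    obtain G1 where G1: "\<And>x. (G1 has_real_derivative \<psi> x) (at x)" "\<And>x. x \<le> - \<epsilon> \<Longrightarrow> G1 x = 0"
      using antiderivative_zero_left[of \<psi> "- \<epsilon>"] \<psi>c[of UNIV 0] \<psi>z by auto
    have G1c: "continuous_on UNIV G1" using G1(1) by (meson DERIV_isCont continuous_at_imp_continuous_on)
    obtain G2 where G2: "\<And>x. (G2 has_real_derivative G1 x) (at x)" "\<And>x. x \<le> - \<epsilon> \<Longrightarrow> G2 x = 0"
      using antiderivative_zero_left[OF G1c G1(2)] by auto
    define I where "I = G1 \<epsilon>"
    have G1I: "G1 x = I" if "\<epsilon> \<le> x" for x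
    proof (cases "x = \<epsilon>")
      case False
      then show ?thesis unfolding I_def using that G1(1) \<psi>z
        by (intro DERIV_isconst2[of \<epsilon> x G1 x]) (auto intro: continuous_on_subset[OF G1c] simp: less_imp_le, metis less_imp_le)
    qed (simp add: I_def)
    have G2I: "G2 x = G2 \<epsilon> + I * (x - \<epsilon>)" if "\<epsilon> \<le> x" for x
    proof (cases "x = \<epsilon>")
      case False
      have D: "((\<lambda>y. G2 y - I * y) has_real_derivative G1 y - I) (at y)" for y
        by (auto intro!: derivative_eq_intros G2(1))
      have "G2 x - I * x = G2 \<epsilon> - I * \<epsilon>"
      proof (rule DERIV_isconst2[of \<epsilon> x "\<lambda>y. G2 y - I * y" x])
        show "continuous_on {\<epsilon>..x} (\<lambda>y. G2 y - I * y)"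
          using D by (meson DERIV_isCont continuous_at_imp_continuous_on)
        show "((\<lambda>y. G2 y - I * y) has_real_derivative 0) (at y)" if "\<epsilon> < y" "y < x" for y
          using D[of y] G1I[of y] that by simp
      qed (use that False in auto)
      then show ?thesis by (simp add: algebra_simps)
    qed simp
    have I: "I > 0"
    proof -
      have mono: "G1 x \<le> G1 y" if "x \<le> y" for x y
        using G1(1) \<psi>0 by (intro DERIV_nonneg_imp_nondecreasing[OF that]) blast
      have "\<psi> 0 > 0" using \<epsilon> by (simp add: \<psi>_def flat_exp_pos)
      from DERIV_pos_inc_right[OF G1(1) this] obtain h where h: "h > 0" "\<And>k. 0 < k \<Longrightarrow> k < h \<Longrightarrow> G1 0 < G1 (0 + k)" by auto
      have "0 \<le> G1 0" using mono[of "- \<epsilon>" 0] G1(2)[of "- \<epsilon>"] \<epsilon> by simp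
      also have "G1 0 < G1 (min (h / 2) \<epsilon>)" using h(2)[of "min (h / 2) \<epsilon>"] h(1) \<epsilon> by simp
      also have "\<dots> \<le> I" unfolding I_def by (intro mono) simp
      finally show ?thesis .
    qed
    define \<phi> where "\<phi> x = (1 - l) * G2 (x - a) - G2 (x - z) + l * G2 (x - b)" for x
    define \<phi>1 where "\<phi>1 x = (1 - l) * G1 (x - a) - G1 (x - z) + l * G1 (x - b)" for x
    define \<phi>2 where "\<phi>2 x = (1 - l) * \<psi> (x - a) + (-1) * \<psi> (x - z) + l * \<psi> (x - b)" for x
    have sh: "((\<lambda>x. G (x - s)) has_real_derivative G' (x - s)) (at x)"
      if "\<And>x. (G has_real_derivative G' x) (at x)" for G G' :: "real \<Rightarrow> real" and s x
    proof -
      have "((\<lambda>x. x - s) has_real_derivative 1) (at x)" by (auto intro!: derivative_eq_intros)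
      from DERIV_chain2[where f=G and g="\<lambda>x. x - s", OF that this] show ?thesis by simp
    qed
    have d\<phi>: "(\<phi> has_real_derivative \<phi>1 x) (at x)" for x
      unfolding \<phi>_def[abs_def] \<phi>1_def
      by (auto intro!: derivative_eq_intros sh[OF G2(1)])
    have d\<phi>1: "(\<phi>1 has_real_derivative \<phi>2 x) (at x)" for x
      unfolding \<phi>1_def[abs_def] \<phi>2_def
      by (auto intro!: derivative_eq_intros sh[OF G1(1)])
    have \<phi>2A: "\<phi>2 \<in> flat_algebra"
      unfolding \<phi>2_def[abs_def] by (intro flat_algebra.intros(2-4) \<psi>A)
    have der1: "deriv \<phi> = \<phi>1" using d\<phi> DERIV_imp_deriv by blast
    have der2: "deriv \<phi>1 = \<phi>2" using d\<phi>1 DERIV_imp_deriv by blast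
    have test: "test_function {0<..<L} \<phi>"
    proof (rule test_functionI[of _ "a - \<epsilon>" "b + \<epsilon>"])
      fix k x
      \<comment> \<open>\<phi> and its first derivative come from primitives and are differentiated
        directly; from the second derivative on \<open>flat_algebra\<close> takes over.\<close>
      consider "k = 0" | "k = 1" | j where "k = Suc (Suc j)" by (metis One_nat_def not0_implies_Suc)
      then show "(deriv ^^ k) \<phi> field_differentiable at x"
      proof cases
        case 1
        then show ?thesis using d\<phi> by (auto simp: field_differentiable_def)
      next
        case 2
        then show ?thesis using d\<phi>1 der1 by (auto simp: field_differentiable_def)
      next
        case (3 j)
        have "(deriv ^^ k) \<phi> = (deriv ^^ j) \<phi>2" unfolding 3 funpow_Suc_right comp_apply der1 der2 ..
        then show ?thesis using flat_algebra_smooth[OF \<phi>2A] by simp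
      qed
    next
      fix x assume "\<phi> x \<noteq> 0"
      show "x \<in> {a - \<epsilon>..b + \<epsilon>}"
      proof (rule ccontr)
        assume "x \<notin> {a - \<epsilon>..b + \<epsilon>}"
        then consider "x < a - \<epsilon>" | "b + \<epsilon> < x" by force
        then have "\<phi> x = 0"
        proof cases
          case 1
          then show ?thesis using z ab by (simp add: \<phi>_def G2(2))
        next
          case 2
          \<comment> \<open>Beyond all bumps each summand is on its affine branch. The coefficients
            1 - l, -1, l add up to 0, which removes the terms common to the three branches; the
            choice of z removes the shifts.\<close>
          then have "\<phi> x = (1 - l) * (G2 \<epsilon> + I * (x - a - \<epsilon>)) - (G2 \<epsilon> + I * (x - z - \<epsilon>)) + l * (G2 \<epsilon> + I * (x - b - \<epsilon>))"
            unfolding \<phi>_def using z ab by (subst (1 2 3) G2I) auto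
          also have "\<dots> = 0" unfolding z_def by (simp add: algebra_simps)
          finally show ?thesis .
        qed
        then show False using \<open>\<phi> x \<noteq> 0\<close> by simp
      qed
    next
      show "{a - \<epsilon>..b + \<epsilon>} \<subseteq> {0<..<L}" using \<epsilon> by auto
    qed
    define W where "W s = (LINT x:{0..L}|lebesgue. \<psi> (x - s) *\<^sub>R w x)" for s
    have Wi: "(\<lambda>x. \<psi> (x - s) *\<^sub>R w x) absolutely_integrable_on {0..L}" for s
      by (intro absolutely_integrable_continuous_real continuous_on_scaleR \<psi>c w)
    have "0 = (LINT x:{0..L}|lebesgue. \<phi>2 x *\<^sub>R w x)"
      using orth[OF test] by (simp add: numeral_2_eq_2 der1 der2 set_lebesgue_integral_Ioo_Icc)
    also have "\<dots> = (LINT x:{0..L}|lebesgue. (1 - l) *\<^sub>R (\<psi> (x - a) *\<^sub>R w x) - \<psi> (x - z) *\<^sub>R w x + l *\<^sub>R (\<psi> (x - b) *\<^sub>R w x))"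
      unfolding \<phi>2_def by (intro arg_cong[where f="\<lambda>h. set_lebesgue_integral lebesgue {0..L} h"] ext) (simp add: algebra_simps)
    also have "\<dots> = (1 - l) *\<^sub>R W a - W z + l *\<^sub>R W b"
      unfolding W_def
      by (subst set_integral_add(2), (intro set_integral_diff set_integrable_scaleR_right Wi)+,
          subst set_integral_diff(2), (intro set_integrable_scaleR_right Wi)+) (simp only: set_integral_scaleR_right)
    finally have Weq: "(1 - l) *\<^sub>R W a - W z + l *\<^sub>R W b = 0" by simp
    \<comment> \<open>W s / I is the mean of w with the bump around s as weight, so it differs from
      w s by at most the oscillation of w there.\<close>
    have near: "norm (I *\<^sub>R w s - W s) \<le> \<eta> * I" if s: "a \<le> s" "s \<le> b" for s
    proof -
      have \<psi>i: "(\<lambda>x. \<psi> (x - s)) absolutely_integrable_on {0..L}"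
        by (intro absolutely_integrable_continuous_real \<psi>c)
      have Ii: "(LINT x:{0..L}|lebesgue. \<psi> (x - s)) = I"
      proof -
        have "(LINT x:{0..L}|lebesgue. \<psi> (x - s)) = G1 (L - s) - G1 (0 - s)"
          using ab s by (intro set_integral_deriv[where f="\<lambda>x. G1 (x - s)"] sh[OF G1(1)] \<psi>c) auto
        then show ?thesis using G1I[of "L - s"] G1(2)[of "0 - s"] \<epsilon> s by simp
      qed
      have "I *\<^sub>R w s - W s = (LINT x:{0..L}|lebesgue. \<psi> (x - s) *\<^sub>R w s) - (LINT x:{0..L}|lebesgue. \<psi> (x - s) *\<^sub>R w x)"
        unfolding W_def Ii[symmetric] using \<psi>i
        by (simp add: set_lebesgue_integral_def set_integrable_def flip: integral_scaleR_left)
      also have "\<dots> = (LINT x:{0..L}|lebesgue. \<psi> (x - s) *\<^sub>R w s - \<psi> (x - s) *\<^sub>R w x)"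
        by (intro set_integral_diff(2)[symmetric] set_integrable_scaleR_left \<psi>i Wi)
      finally have eq: "I *\<^sub>R w s - W s = (LINT x:{0..L}|lebesgue. \<psi> (x - s) *\<^sub>R w s - \<psi> (x - s) *\<^sub>R w x)" .
      have "norm (I *\<^sub>R w s - W s) \<le> (LINT x:{0..L}|lebesgue. norm (\<psi> (x - s) *\<^sub>R w s - \<psi> (x - s) *\<^sub>R w x))"
        unfolding eq by (intro set_integral_norm_bound set_integral_diff(1) set_integrable_scaleR_left \<psi>i Wi)
      also have "\<dots> \<le> (LINT x:{0..L}|lebesgue. \<eta> * \<psi> (x - s))"
      proof (rule set_integral_mono)
        show "(\<lambda>x. norm (\<psi> (x - s) *\<^sub>R w s - \<psi> (x - s) *\<^sub>R w x)) absolutely_integrable_on {0..L}"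
          by (intro set_integrable_norm set_integral_diff(1) set_integrable_scaleR_left \<psi>i Wi)
        show "(\<lambda>x. \<eta> * \<psi> (x - s)) absolutely_integrable_on {0..L}" by (intro set_integrable_mult_right \<psi>i)
        show "norm (\<psi> (x - s) *\<^sub>R w s - \<psi> (x - s) *\<^sub>R w x) \<le> \<eta> * \<psi> (x - s)" if x: "x \<in> {0..L}" for x
        proof (cases "\<psi> (x - s) = 0")
          case False
          then have "\<bar>x - s\<bar> < d" using \<psi>z[of "x - s"] \<epsilon> by linarith
          then have "norm (w s - w x) \<le> \<eta>"
            using d(2)[of x s] x s ab by (simp add: dist_norm abs_minus_commute)
          then show ?thesis using \<psi>0[of "x - s"]
            by (simp add: mult.commute[of \<eta>] mult_left_mono flip: scaleR_diff_right)
        qed simp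
      qed
      also have "\<dots> = \<eta> * I" by (simp add: Ii)
      finally show ?thesis .
    qed
    have tri: "norm (x - y + z) \<le> norm x + norm y + norm z" for x y z :: 'a
      by (rule order_trans[OF norm_triangle_ineq]) (simp add: norm_triangle_ineq4)
    have "I *\<^sub>R ((1 - l) *\<^sub>R w a - w z + l *\<^sub>R w b)
       = (1 - l) *\<^sub>R (I *\<^sub>R w a - W a) - (I *\<^sub>R w z - W z) + l *\<^sub>R (I *\<^sub>R w b - W b)
         + ((1 - l) *\<^sub>R W a - W z + l *\<^sub>R W b)"
      by (simp add: algebra_simps)
    also have "\<dots> = (1 - l) *\<^sub>R (I *\<^sub>R w a - W a) - (I *\<^sub>R w z - W z) + l *\<^sub>R (I *\<^sub>R w b - W b)"
      unfolding Weq by simp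
    finally have "norm (I *\<^sub>R ((1 - l) *\<^sub>R w a - w z + l *\<^sub>R w b))
      \<le> norm ((1 - l) *\<^sub>R (I *\<^sub>R w a - W a)) + norm (I *\<^sub>R w z - W z) + norm (l *\<^sub>R (I *\<^sub>R w b - W b))"
      by (simp only: tri)
    also have "\<dots> \<le> (1 - l) * (\<eta> * I) + \<eta> * I + l * (\<eta> * I)"
      using near[of a] near[of z] near[of b] z ab l by (intro add_mono) (auto intro!: mult_left_mono)
    also have "\<dots> = I * (2 * \<eta>)" by (simp add: algebra_simps)
    finally show ?thesis using I by simp
  qed
  note bound = this
  have "norm ((1 - l) *\<^sub>R w a - w z + l *\<^sub>R w b) \<le> 0"
  proof (rule field_le_epsilon)
    fix \<epsilon> :: real assume "0 < \<epsilon>"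
    then show "norm ((1 - l) *\<^sub>R w a - w z + l *\<^sub>R w b) \<le> 0 + \<epsilon>" using bound[of "\<epsilon> / 2"] by simp
  qed
  then show ?thesis by (simp add: z_def)
qed

text \<open>The three-point identity is available only at interior points; it is used at h, t and L
  - h, and h tends to 0 by continuity of w up to the ends.\<close>

lemma affine_if_weak_second_derivative_zero:
  fixes w :: "real \<Rightarrow> 'a::euclidean_space"
  assumes L: "0 < L" and w: "continuous_on {0..L} w"
    and orth: "\<And>\<phi>. test_function {0<..<L} \<phi> \<Longrightarrow> (LINT x:{0<..<L}|lebesgue. (deriv ^^ 2) \<phi> x *\<^sub>R w x) = 0"
    and t: "0 \<le> t" "t \<le> L"
  shows "w t = w 0 + (t / L) *\<^sub>R (w L - w 0)"
proof (cases "t = 0 \<or> t = L")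
  case False
  with t have t: "0 < t" "t < L" by auto
  \<comment> \<open>The solution of (1 - l) h + l (L - h) = t.\<close>
  define l where "l h = (t - h) / (L - 2 * h)" for h
  have ev: "\<forall>\<^sub>F h in at_right 0. (1 - l h) *\<^sub>R w h - w t + l h *\<^sub>R w (L - h) = 0"
  proof -
    have "\<forall>\<^sub>F h in at_right 0. h < min t (L - t) / 2"
      using t by (intro eventually_at_rightI[of 0 "min t (L - t) / 2"]) auto
    moreover have "\<forall>\<^sub>F h in at_right (0::real). 0 < h" by (simp add: eventually_at_filter)
    ultimately show ?thesis
    proof eventually_elim
      case (elim h)
      then have h: "0 < h" "h < t" "h < L - t" "h < L - h" "0 < L - 2 * h" by (auto simp: min_def split: if_splits)
      have "(1 - l h) * h + l h * (L - h) = h + l h * (L - 2 * h)" by (simp add: algebra_simps)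
      also have "\<dots> = t" using h by (simp add: l_def)
      finally have e: "(1 - l h) * h + l h * (L - h) = t" .
      have "0 \<le> l h" "l h \<le> 1" using h by (auto simp: l_def)
      then show ?case
        using affine_combination_if_weak_second_derivative_zero[OF w orth, of h "L - h" "l h"] h e by simp
    qed
  qed
  have w0: "((\<lambda>h. w h) \<longlongrightarrow> w 0) (at_right 0)"
  proof -
    have "(w \<longlongrightarrow> w 0) (at 0 within {0..L})" using w L by (simp add: continuous_on_def)
    then show ?thesis using L by (simp add: at_within_Icc_at_right)
  qed
  have wL: "((\<lambda>h. w (L - h)) \<longlongrightarrow> w L) (at_right 0)"
  proof -
    have "(w \<longlongrightarrow> w L) (at L within {0..L})" using w L by (simp add: continuous_on_def)
    then have "(w \<longlongrightarrow> w L) (at_left L)" using L by (simp add: at_within_Icc_at_left)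
    moreover have "filterlim (\<lambda>h. L - h) (at_left L) (at_right 0)"
      unfolding filterlim_at by (auto intro!: tendsto_eq_intros simp: eventually_at_filter)
    ultimately show ?thesis by (rule filterlim_compose)
  qed
  have ll: "(l \<longlongrightarrow> t / L) (at_right 0)"
    unfolding l_def[abs_def] using L by (auto intro!: tendsto_eq_intros)
  have "((\<lambda>h. (1 - l h) *\<^sub>R w h - w t + l h *\<^sub>R w (L - h)) \<longlongrightarrow> (1 - t / L) *\<^sub>R w 0 - w t + (t / L) *\<^sub>R w L) (at_right 0)"
    by (intro tendsto_intros w0 wL ll)
  moreover have "((\<lambda>h. (1 - l h) *\<^sub>R w h - w t + l h *\<^sub>R w (L - h)) \<longlongrightarrow> 0) (at_right 0)"
    using ev by (rule tendsto_eventually)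
  ultimately have "(1 - t / L) *\<^sub>R w 0 - w t + (t / L) *\<^sub>R w L = 0"
    by (intro tendsto_unique[OF _ _ _]) auto
  then show ?thesis by (simp add: algebra_simps)
qed (use L in auto)

lemma set_integral_diff_Icc:
  fixes f :: "real \<Rightarrow> 'a::euclidean_space"
  assumes f: "f absolutely_integrable_on {l..r}" and ab: "l \<le> a" "a \<le> b" "b \<le> r"
  shows "(LINT x:{l..b}|lebesgue. f x) - (LINT x:{l..a}|lebesgue. f x) = (LINT x:{a..b}|lebesgue. f x)"
proof -
  have i: "f absolutely_integrable_on {c..d}" if "l \<le> c" "d \<le> r" for c d
    by (rule set_integrable_subset[OF f]) (use that in auto)
  have "integral {l..a} f + integral {a..b} f = integral {l..b} f"
    using ab i[of l b] by (intro Henstock_Kurzweil_Integration.integral_combine set_lebesgue_integral_eq_integral(1)) auto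
  then show ?thesis
    using ab by (simp add: set_lebesgue_integral_eq_integral(2)[OF i] algebra_simps)
qed

lemma continuous_on_set_integral:
  fixes f :: "real \<Rightarrow> 'a::euclidean_space"
  assumes f: "f absolutely_integrable_on {l..r}"
  shows "continuous_on {l..r} (\<lambda>t. LINT x:{l..t}|lebesgue. f x)"
proof -
  have "continuous_on {l..r} (\<lambda>t. integral {l..t} f)"
    using f by (intro indefinite_integral_continuous_1 set_lebesgue_integral_eq_integral(1))
  then show ?thesis
  proof (rule continuous_on_eq)
    fix t assume "t \<in> {l..r}"
    then have "f absolutely_integrable_on {l..t}" by (intro set_integrable_subset[OF f]) auto
    then show "integral {l..t} f = (LINT x:{l..t}|lebesgue. f x)"
      by (rule set_lebesgue_integral_eq_integral(2)[symmetric])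
  qed
qed

text \<open>Subtracting from c a double primitive of g leaves a continuous function with vanishing
  weak second derivative, hence an affine one; its slope \<beta> is the constant missing from the
  primitive of g.\<close>

lemma weak_second_derivative_representation:
  fixes c :: "real \<Rightarrow> 'a::euclidean_space"
  assumes L: "0 < L" and c: "continuous_on {0..L} c" and g: "g absolutely_integrable_on {0..L}"
    and weak: "has_weak_derivative {0<..<L} 2 c g"
  obtains T where "continuous_on {0..L} T"
    "\<And>a b. 0 \<le> a \<Longrightarrow> a \<le> b \<Longrightarrow> b \<le> L \<Longrightarrow> T b - T a = (LINT x:{a..b}|lebesgue. g x)"
    "\<And>a b. 0 \<le> a \<Longrightarrow> a \<le> b \<Longrightarrow> b \<le> L \<Longrightarrow> c b - c a = (LINT x:{a..b}|lebesgue. T x)"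
proof -
  define T0 where "T0 t = (LINT x:{0..t}|lebesgue. g x)" for t
  define G where "G t = (LINT x:{0..t}|lebesgue. T0 x)" for t
  have T0c: "continuous_on {0..L} T0" unfolding T0_def by (rule continuous_on_set_integral[OF g])
  then have T0i: "T0 absolutely_integrable_on {0..L}" by (rule absolutely_integrable_continuous_real)
  have Gc: "continuous_on {0..L} G" unfolding G_def by (rule continuous_on_set_integral[OF T0i])
  have at0: "T0 0 = 0" "G 0 = 0"
    using set_integral_diff_Icc[OF g, of 0 0] set_integral_diff_Icc[OF T0i, of 0 0] L by (auto simp: T0_def G_def)
  define w where "w t = c t - G t" for t
  have wc: "continuous_on {0..L} w" unfolding w_def by (intro continuous_intros c Gc)
  have orth: "(LINT x:{0<..<L}|lebesgue. (deriv ^^ 2) \<phi> x *\<^sub>R w x) = 0" if \<phi>: "test_function {0<..<L} \<phi>" for \<phi>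
  proof -
    note \<phi>1 = test_function_deriv[OF \<phi>]
    note \<phi>2 = test_function_deriv[OF \<phi>1]
    have i: "(\<lambda>x. deriv (deriv \<phi>) x *\<^sub>R f x) absolutely_integrable_on {0..L}" if "continuous_on {0..L} f" for f :: "real \<Rightarrow> 'a"
      by (intro absolutely_integrable_continuous_real continuous_on_scaleR test_functionD(2)[OF \<phi>2] that)
    have "(LINT x:{0<..<L}|lebesgue. deriv (deriv \<phi>) x *\<^sub>R G x) = - (LINT x:{0<..<L}|lebesgue. deriv \<phi> x *\<^sub>R T0 x)"
      by (rule integral_by_parts_test_function[OF L T0i _ \<phi>1], unfold at0) (simp add: G_def)
    also have "\<dots> = (LINT x:{0<..<L}|lebesgue. \<phi> x *\<^sub>R g x)"
      by (subst integral_by_parts_test_function[OF L g _ \<phi>], unfold at0) (simp_all add: T0_def)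
    also have "\<dots> = (LINT x:{0<..<L}|lebesgue. (deriv ^^ 2) \<phi> x *\<^sub>R c x)"
    proof -
      have "(LINT x:{0<..<L}|lebesgue. (deriv ^^ 2) \<phi> x *\<^sub>R c x) = (- 1) ^ 2 *\<^sub>R (LINT x:{0<..<L}|lebesgue. \<phi> x *\<^sub>R g x)"
        using weak \<phi> unfolding has_weak_derivative_def by blast
      then show ?thesis by simp
    qed
    finally have eq: "(LINT x:{0..L}|lebesgue. deriv (deriv \<phi>) x *\<^sub>R G x) = (LINT x:{0..L}|lebesgue. deriv (deriv \<phi>) x *\<^sub>R c x)"
      by (simp add: set_lebesgue_integral_Ioo_Icc numeral_2_eq_2)
    have "(LINT x:{0<..<L}|lebesgue. (deriv ^^ 2) \<phi> x *\<^sub>R w x)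
      = (LINT x:{0..L}|lebesgue. deriv (deriv \<phi>) x *\<^sub>R c x - deriv (deriv \<phi>) x *\<^sub>R G x)"
      by (simp add: set_lebesgue_integral_Ioo_Icc numeral_2_eq_2 w_def scaleR_diff_right)
    also have "\<dots> = (LINT x:{0..L}|lebesgue. deriv (deriv \<phi>) x *\<^sub>R c x) - (LINT x:{0..L}|lebesgue. deriv (deriv \<phi>) x *\<^sub>R G x)"
      by (rule set_integral_diff(2)[OF i[OF c] i[OF Gc]])
    finally show ?thesis using eq by simp
  qed
  define \<beta> where "\<beta> = (w L - w 0) /\<^sub>R L"
  have wt: "w t = w 0 + t *\<^sub>R \<beta>" if "0 \<le> t" "t \<le> L" for t
    using affine_if_weak_second_derivative_zero[OF L wc orth that] by (simp add: \<beta>_def divide_inverse)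
  show thesis
  proof (rule that[of "\<lambda>t. T0 t + \<beta>"])
    show "continuous_on {0..L} (\<lambda>t. T0 t + \<beta>)" by (intro continuous_intros T0c)
    fix a b assume ab: "0 \<le> a" "a \<le> b" "b \<le> L"
    show "T0 b + \<beta> - (T0 a + \<beta>) = (LINT x:{a..b}|lebesgue. g x)"
      using set_integral_diff_Icc[OF g ab] by (simp add: T0_def)
    have T0i': "T0 absolutely_integrable_on {a..b}"
      by (rule set_integrable_subset[OF T0i]) (use ab in auto)
    have "(LINT x:{a..b}|lebesgue. T0 x + \<beta>) = (LINT x:{a..b}|lebesgue. T0 x) + (LINT x:{a..b}|lebesgue. \<beta>)"
      by (rule set_integral_add(2)[OF T0i']) (rule absolutely_integrable_continuous_real, simp)
    also have "(LINT x:{a..b}|lebesgue. \<beta>) = (b - a) *\<^sub>R \<beta>"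
      using ab by (simp add: set_lebesgue_integral_def)
    also have "(LINT x:{a..b}|lebesgue. T0 x) = G b - G a"
      using set_integral_diff_Icc[OF T0i ab] by (simp add: G_def)
    finally have I: "(LINT x:{a..b}|lebesgue. T0 x + \<beta>) = G b - G a + (b - a) *\<^sub>R \<beta>" .
    have ct: "c t = G t + (w 0 + t *\<^sub>R \<beta>)" if "0 \<le> t" "t \<le> L" for t
      using wt[OF that] by (simp add: w_def algebra_simps)
    have "c b - c a = G b - G a + (b - a) *\<^sub>R \<beta>"
      using ab by (subst (1 2) ct) (simp_all add: algebra_simps)
    then show "c b - c a = (LINT x:{a..b}|lebesgue. T0 x + \<beta>)" using I by simp
  qed
qed

section \<open>The upper bound\<close>

text \<open>Let V be the mean of T over [a, b], so that T stays within \<eta> of V. Then polygons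
  inscribed in the subarc have length at most (b - a) (|V| + \<eta>), while their supremum is b - a;
  hence |V| \<ge> 1 - \<eta>.\<close>

lemma chord_ge_of_nearly_constant_derivative:
  fixes c T :: "real \<Rightarrow> 'a::euclidean_space"
  assumes c: "arclength_curve L c" and ab: "0 \<le> a" "a < b" "b \<le> L"
    and T: "continuous_on {a..b} T"
    and cT: "\<And>s t. a \<le> s \<Longrightarrow> s \<le> t \<Longrightarrow> t \<le> b \<Longrightarrow> c t - c s = integral {s..t} T"
    and osc: "\<And>s t. s \<in> {a..b} \<Longrightarrow> t \<in> {a..b} \<Longrightarrow> norm (T s - T t) \<le> \<eta>"
  shows "(b - a) * (1 - \<eta>) \<le> norm (c b - c a)"
proof -
  have Ti: "T integrable_on {s..t}" if "a \<le> s" "t \<le> b" for s t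
    by (intro integrable_continuous_real continuous_on_subset[OF T]) (use that in auto)
  have dev: "norm (integral {s..t} T - (t - s) *\<^sub>R V) \<le> (t - s) * \<eta>"
    if st: "a \<le> s" "s \<le> t" "t \<le> b" and V: "\<And>x. x \<in> {s..t} \<Longrightarrow> norm (T x - V) \<le> \<eta>" for s t V
  proof -
    have "norm (integral {s..t} (\<lambda>x. T x - V)) \<le> \<eta> * (t - s)"
      using st V by (intro integral_bound continuous_intros continuous_on_subset[OF T]) auto
    moreover have "integral {s..t} (\<lambda>x. T x - V) = integral {s..t} T - (t - s) *\<^sub>R V"
      using st by (subst Henstock_Kurzweil_Integration.integral_diff) (auto intro: Ti)
    ultimately show ?thesis by (simp add: mult.commute)
  qed
  define V where "V = (c b - c a) /\<^sub>R (b - a)"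
  have TV: "norm (T x - V) \<le> \<eta>" if x: "x \<in> {a..b}" for x
  proof -
    have "norm (c b - c a - (b - a) *\<^sub>R T x) \<le> (b - a) * \<eta>"
      using dev[of a b "T x"] cT[of a b] ab osc[OF _ x] by simp
    moreover have "c b - c a - (b - a) *\<^sub>R T x = (b - a) *\<^sub>R (V - T x)"
      using ab by (simp add: V_def scaleR_diff_right)
    ultimately have "(b - a) * norm (V - T x) \<le> (b - a) * \<eta>" using ab by simp
    then show ?thesis using ab by (simp add: norm_minus_commute)
  qed
  have nV: "norm (c b - c a) = (b - a) * norm V" using ab by (simp add: V_def)
  have "(b - a) \<le> (b - a) * (norm V + \<eta>)"
  proof (rule field_le_epsilon)
    fix \<epsilon> :: real assume "0 < \<epsilon>"
    then obtain t where t: "is_partition a b t" "b - a - \<epsilon> < (\<Sum>j<length t - 1. norm (c (t ! Suc j) - c (t ! j)))"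
      using arclength_curve_inscribed[OF c ab] by blast
    note tn = is_partition_nth[OF t(1)]
    have "(\<Sum>j<length t - 1. norm (c (t ! Suc j) - c (t ! j))) \<le> (\<Sum>j<length t - 1. (t ! Suc j - t ! j) * (norm V + \<eta>))"
    proof (rule sum_mono)
      fix j assume "j \<in> {..<length t - 1}"
      then have j: "a \<le> t ! j" "t ! j \<le> t ! Suc j" "t ! Suc j \<le> b"
        using tn(1)[of j] tn(1)[of "Suc j"] tn(4)[of j] by (auto simp: less_diff_conv)
      have "norm (c (t ! Suc j) - c (t ! j) - (t ! Suc j - t ! j) *\<^sub>R V) \<le> (t ! Suc j - t ! j) * \<eta>"
        using dev[OF j, of V] TV cT[OF j] j by simp
      then have "norm (c (t ! Suc j) - c (t ! j)) \<le> norm ((t ! Suc j - t ! j) *\<^sub>R V) + (t ! Suc j - t ! j) * \<eta>"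
        using norm_triangle_sub[of "c (t ! Suc j) - c (t ! j)" "(t ! Suc j - t ! j) *\<^sub>R V"] by linarith
      then show "norm (c (t ! Suc j) - c (t ! j)) \<le> (t ! Suc j - t ! j) * (norm V + \<eta>)"
        using j by (simp add: distrib_left)
    qed
    also have "\<dots> = (\<Sum>j<length t - 1. t ! Suc j - t ! j) * (norm V + \<eta>)" by (simp add: sum_distrib_right)
    also have "(\<Sum>j<length t - 1. t ! Suc j - t ! j) = b - a"
      using sum_lessThan_telescope[of "\<lambda>j. t ! j" "length t - 1"] tn(2,3) by simp
    finally show "b - a \<le> (b - a) * (norm V + \<eta>) + \<epsilon>" using t(2) by simp
  qed
  then show ?thesis unfolding nV by (simp add: algebra_simps)
qed

text \<open>Radial projection onto the unit sphere has Lipschitz constant 1 / r outside the ball of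
  radius r. The law of cosines splits |w - u|^2 into the radial part (|w| - |u|)^2 and the angular
  part |u| |w| |b - a|^2.\<close>

lemma norm_diff_normalized_le:
  fixes u w :: "'a::real_inner"
  assumes r: "0 < r" "r \<le> norm u" "r \<le> norm w"
  shows "norm (w /\<^sub>R norm w - u /\<^sub>R norm u) \<le> norm (w - u) / r"
proof -
  define a where "a = u /\<^sub>R norm u"
  define b where "b = w /\<^sub>R norm w"
  have u: "u = norm u *\<^sub>R a" "a \<bullet> a = 1" and w: "w = norm w *\<^sub>R b" "b \<bullet> b = 1"
  proof -
    have "norm u \<noteq> 0" "norm w \<noteq> 0" using r by linarith+
    then show "u = norm u *\<^sub>R a" "a \<bullet> a = 1" "w = norm w *\<^sub>R b" "b \<bullet> b = 1"
      by (simp_all add: a_def b_def dot_square_norm)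
  qed
  have uw: "u \<bullet> w = norm u * norm w * (a \<bullet> b)"
    by (subst u(1), subst w(1)) simp
  have nba: "(norm (b - a))\<^sup>2 = 2 - 2 * (a \<bullet> b)"
    using u(2) w(2) by (simp add: power2_norm_eq_inner inner_diff_left inner_diff_right inner_commute)
  have "(norm (w - u))\<^sup>2 = (norm w)\<^sup>2 + (norm u)\<^sup>2 - 2 * (u \<bullet> w)"
    by (simp add: power2_norm_eq_inner inner_diff_left inner_diff_right inner_commute)
  also have "\<dots> = (norm w - norm u)\<^sup>2 + norm u * norm w * (norm (b - a))\<^sup>2"
    unfolding nba uw by (simp add: power2_eq_square algebra_simps)
  finally have eq: "(norm (w - u))\<^sup>2 = (norm w - norm u)\<^sup>2 + norm u * norm w * (norm (b - a))\<^sup>2" .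
  have "(r * norm (b - a))\<^sup>2 = r * r * (norm (b - a))\<^sup>2" by (simp add: power2_eq_square)
  also have "\<dots> \<le> norm u * norm w * (norm (b - a))\<^sup>2"
    using r by (intro mult_right_mono mult_mono) auto
  also have "\<dots> \<le> (norm (w - u))\<^sup>2" unfolding eq by simp
  finally have "r * norm (b - a) \<le> norm (w - u)" by (rule power2_le_imp_le) simp
  then show ?thesis using r by (simp add: a_def b_def field_simps)
qed

text \<open>With r = h (1 - \<eta>), the sine bound gives 2 sin (\<theta>/2) \<le> |w - u| / r, and
  cos (\<theta>/2) \<ge> 1 - \<eta> turns it into a bound for \<tau> = 2 tan (\<theta>/2). Then
  \<tau>^p / r^(p-1) contributes 2p + (p - 1) factors 1 / (1 - \<eta>), the origin of the exponent 1
  - 3p.\<close>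

lemma p_rotation_term_le:
  fixes u w :: "'a::real_inner"
  assumes p: "p > 1" and \<eta>: "0 \<le> \<eta>" "\<eta> \<le> 1 / 2" and h: "0 < h"
    and uw: "h * (1 - \<eta>) \<le> norm u" "h * (1 - \<eta>) \<le> norm w" "norm (w - u) \<le> h * \<eta>"
  defines "\<theta> \<equiv> arccos (u \<bullet> w / (norm u * norm w))"
  shows "\<theta> \<noteq> pi"
    and "\<theta> * (tan (\<theta> / 2) / (min (norm u) (norm w) / 2)) powr (p - 1)
      \<le> (1 - \<eta>) powr (1 - 3 * p) * (norm (w - u) powr p / h powr (2 * p - 1))"
proof -
  define r where "r = h * (1 - \<eta>)"
  have r: "0 < r" "r \<le> norm u" "r \<le> norm w" using h \<eta> uw by (auto simp: r_def)
  then have ne: "u \<noteq> 0" "w \<noteq> 0" by auto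
  note a = unit_chord_angle[OF ne, folded \<theta>_def]
  have s: "2 * sin (\<theta> / 2) \<le> norm (w - u) / r"
    using norm_diff_normalized_le[OF r] a(3) by simp
  also have "\<dots> \<le> h * \<eta> / r" using uw r by (intro divide_right_mono) auto
  also have "\<dots> = \<eta> / (1 - \<eta>)" using h by (simp add: r_def)
  \<comment> \<open>Here \<eta> \<le> 1/2 enters. The resulting sin (\<theta>/2) \<le> \<eta> < 1
    also excludes \<theta> = pi.\<close>
  also have "\<dots> \<le> 2 * \<eta>" using \<eta> mult_left_mono[of \<eta> "1/2" \<eta>] by (simp add: field_simps)
  finally have s\<eta>: "sin (\<theta> / 2) \<le> \<eta>" by simp
  show npi: "\<theta> \<noteq> pi" using s\<eta> \<eta> by auto
  have s0: "0 \<le> sin (\<theta> / 2)" using a by (intro sin_ge_zero) auto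
  have c0: "0 < cos (\<theta> / 2)" using a npi by (intro cos_gt_zero_pi) auto
  have c1: "1 - \<eta> \<le> cos (\<theta> / 2)"
  proof (rule power2_le_imp_le)
    have "(1 - \<eta>)\<^sup>2 \<le> (1 - sin (\<theta> / 2))\<^sup>2" using s\<eta> \<eta> by (intro power_mono) auto
    also have "\<dots> \<le> 1 - (sin (\<theta> / 2))\<^sup>2"
      using s0 s\<eta> \<eta> mult_left_mono[of "sin (\<theta> / 2)" 1 "sin (\<theta> / 2)"] by (simp add: power2_eq_square algebra_simps)
    also have "\<dots> = (cos (\<theta> / 2))\<^sup>2" by (simp add: cos_squared_eq)
    finally show "(1 - \<eta>)\<^sup>2 \<le> (cos (\<theta> / 2))\<^sup>2" .
  qed (use c0 in simp)
  define \<tau> where "\<tau> = 2 * tan (\<theta> / 2)"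
  have \<theta>\<tau>: "\<theta> \<le> \<tau>" using tan_ge_self[of "\<theta> / 2"] a npi by (simp add: \<tau>_def)
  have \<tau>: "\<tau> \<le> norm (w - u) / (r * (1 - \<eta>))"
  proof -
    have "\<tau> = 2 * sin (\<theta> / 2) / cos (\<theta> / 2)" by (simp add: \<tau>_def tan_def)
    also have "\<dots> \<le> (norm (w - u) / r) / (1 - \<eta>)"
      using s s0 c0 c1 \<eta> by (intro frac_le) auto
    finally show ?thesis by simp
  qed
  have \<tau>0: "0 \<le> \<tau>" using a \<theta>\<tau> by simp
  have "\<theta> * (tan (\<theta> / 2) / (min (norm u) (norm w) / 2)) powr (p - 1) \<le> \<tau> * (\<tau> / r) powr (p - 1)"
  proof (intro mult_mono powr_mono2)
    have "tan (\<theta> / 2) / (min (norm u) (norm w) / 2) = \<tau> / min (norm u) (norm w)" by (simp add: \<tau>_def)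
    also have "\<dots> \<le> \<tau> / r" using r \<tau>0 by (intro divide_left_mono mult_pos_pos) auto
    finally show "tan (\<theta> / 2) / (min (norm u) (norm w) / 2) \<le> \<tau> / r" .
    show "0 \<le> tan (\<theta> / 2) / (min (norm u) (norm w) / 2)" using \<tau>0 by (simp add: \<tau>_def)
  qed (use \<theta>\<tau> \<tau>0 p in auto)
  also have "\<dots> = \<tau> powr p / r powr (p - 1)"
    using \<tau>0 r powr_mult_powr_minus_one[of \<tau> p] by (simp add: powr_divide)
  also have "\<dots> \<le> (norm (w - u) / (r * (1 - \<eta>))) powr p / r powr (p - 1)"
    using \<tau> \<tau>0 p by (intro divide_right_mono powr_mono2) auto
  also have "\<dots> = (1 - \<eta>) powr (1 - 3 * p) * (norm (w - u) powr p / h powr (2 * p - 1))"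
  proof -
    define k where "k = 1 - \<eta>"
    have k: "0 < k" using \<eta> by (simp add: k_def)
    have "(norm (w - u) / (r * (1 - \<eta>))) powr p / r powr (p - 1)
      = norm (w - u) powr p / ((h powr p * k powr p * k powr p) * (h powr (p - 1) * k powr (p - 1)))"
      using h k by (simp add: r_def powr_divide powr_mult flip: k_def)
    also have "(h powr p * k powr p * k powr p) * (h powr (p - 1) * k powr (p - 1)) = h powr (2 * p - 1) * k powr (3 * p - 1)"
      by (simp add: algebra_simps flip: powr_add)
    also have "norm (w - u) powr p / (h powr (2 * p - 1) * k powr (3 * p - 1)) = k powr (1 - 3 * p) * (norm (w - u) powr p / h powr (2 * p - 1))"
      using powr_minus_divide[of k "3 * p - 1"] by (simp add: mult.commute)
    finally show ?thesis by (simp add: k_def)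
  qed
  finally show "\<theta> * (tan (\<theta> / 2) / (min (norm u) (norm w) / 2)) powr (p - 1)
      \<le> (1 - \<eta>) powr (1 - 3 * p) * (norm (w - u) powr p / h powr (2 * p - 1))" .
qed

text \<open>A second difference of c is the integral over one cell of D s = T (s + h) - T s, itself
  an integral of g over a window of length h. Hoelder's inequality is used once in each variable,
  giving h^(p-1) twice; the remaining factor h comes from the last cell.\<close>

lemma sum_second_differences_le:
  fixes c T g :: "real \<Rightarrow> 'a::euclidean_space" and v :: "nat \<Rightarrow> 'a"
  assumes L: "0 < L" and p: "p > 1" and n: "0 < n"
    and T: "continuous_on {0..L} T"
    and cT: "\<And>a b. 0 \<le> a \<Longrightarrow> a \<le> b \<Longrightarrow> b \<le> L \<Longrightarrow> c b - c a = integral {a..b} T"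
    and Tg: "\<And>a b. 0 \<le> a \<Longrightarrow> a \<le> b \<Longrightarrow> b \<le> L \<Longrightarrow> T b - T a = (LINT x:{a..b}|lebesgue. g x)"
    and g: "g absolutely_integrable_on {0..L}"
    and gp: "(\<lambda>x. norm (g x) powr p) absolutely_integrable_on {0..L}"
    and h_def: "h = L / real n"
    and v_def: "v = (\<lambda>i. c (real (Suc i) * h) - c (real i * h))"
  shows "(\<Sum>i<n-1. norm (v (Suc i) - v i) powr p / h powr (2 * p - 1)) \<le> (LINT x:{0..L}|lebesgue. norm (g x) powr p)"
    and "\<And>i \<eta>. (\<And>s t. s \<in> {0..L} \<Longrightarrow> t \<in> {0..L} \<Longrightarrow> \<bar>s - t\<bar> \<le> h \<Longrightarrow> norm (T s - T t) \<le> \<eta>)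
      \<Longrightarrow> Suc i < n \<Longrightarrow> norm (v (Suc i) - v i) \<le> h * \<eta>"
proof -
  have h: "0 < h" "real n * h = L" using L n by (auto simp: h_def)
  define \<Gamma> where "\<Gamma> t = (LINT x:{0..t}|lebesgue. norm (g x) powr p)" for t
  have \<Gamma>c: "continuous_on {0..L} \<Gamma>" unfolding \<Gamma>_def by (rule continuous_on_set_integral[OF gp])
  have \<Gamma>: "\<Gamma> b - \<Gamma> a = (LINT x:{a..b}|lebesgue. norm (g x) powr p)" if "0 \<le> a" "a \<le> b" "b \<le> L" for a b
    unfolding \<Gamma>_def by (rule set_integral_diff_Icc[OF gp that])
  have \<Gamma>mono: "\<Gamma> a \<le> \<Gamma> b" if "0 \<le> a" "a \<le> b" "b \<le> L" for a b
  proof -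
    have "0 \<le> (LINT x:{a..b}|lebesgue. norm (g x) powr p)"
      unfolding set_lebesgue_integral_def by (rule Bochner_Integration.integral_nonneg) simp
    then show ?thesis using \<Gamma>[OF that] by simp
  qed
  have \<Gamma>0: "\<Gamma> 0 = 0" using \<Gamma>[of 0 0] set_integral_diff_Icc[OF gp, of 0 0] L by (simp add: \<Gamma>_def)
  have node: "0 \<le> real i * h" "real i * h + h = real (Suc i) * h" for i using h by (auto simp: algebra_simps)
  have nodeL: "real i * h \<le> L" if "i \<le> n" for i
    using mult_right_mono[of "real i" "real n" h] that h by simp
  define D where "D s = T (s + h) - T s" for s
  have shc: "continuous_on {a..b} (\<lambda>s. f (s + h))" if "continuous_on {0..L} f" "0 \<le> a" "b + h \<le> L" for f :: "real \<Rightarrow> 'b::euclidean_space" and a b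
    using that h by (intro continuous_on_compose2[OF that(1)] continuous_intros) auto
  have subc: "continuous_on {a..b} f" if "continuous_on {0..L} f" "0 \<le> a" "b \<le> L" for f :: "real \<Rightarrow> 'b::euclidean_space" and a b
    by (rule continuous_on_subset[OF that(1)]) (use that in auto)
  have shift: "integral {a..b} (\<lambda>s. f (s + h)) = integral {a + h..b + h} f"
    for f :: "real \<Rightarrow> 'b::euclidean_space" and a b
    using integral_shift_real_ivl[of "a + h" h "b + h" f] by simp
  have cell: "0 \<le> real i * h" "real i * h \<le> real (Suc i) * h" "real (Suc i) * h + h \<le> L" "real (Suc i) * h \<le> L"
    if "Suc i < n" for i
    using nodeL[of "Suc (Suc i)"] nodeL[of "Suc i"] that h by (auto simp: algebra_simps)
  have Dc: "continuous_on {real i * h..real (Suc i) * h} D" if "Suc i < n" for i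
    unfolding D_def using cell[OF that] by (intro continuous_intros shc[OF T] subc[OF T]) auto
  have vD: "v (Suc i) - v i = integral {real i * h..real (Suc i) * h} D" if i: "Suc i < n" for i
  proof -
    have "v (Suc i) = integral {real i * h + h..real (Suc i) * h + h} T"
      unfolding v_def node(2) using i h by (intro cT node nodeL mult_right_mono) auto
    also have "\<dots> = integral {real i * h..real (Suc i) * h} (\<lambda>s. T (s + h))"
      by (rule shift[symmetric])
    moreover have "v i = integral {real i * h..real (Suc i) * h} T"
      unfolding v_def by (rule cT[OF cell(1,2,4)[OF i]])
    ultimately show ?thesis
      unfolding D_def using cell[OF i]
      by (subst Henstock_Kurzweil_Integration.integral_diff) (auto intro!: integrable_continuous_real shc[OF T] subc[OF T])
  qed
  show "norm (v (Suc i) - v i) \<le> h * \<eta>"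
    if osc: "\<And>s t. s \<in> {0..L} \<Longrightarrow> t \<in> {0..L} \<Longrightarrow> \<bar>s - t\<bar> \<le> h \<Longrightarrow> norm (T s - T t) \<le> \<eta>" and i: "Suc i < n" for i \<eta>
  proof -
    have "norm (integral {real i * h..real (Suc i) * h} D) \<le> \<eta> * (real (Suc i) * h - real i * h)"
    proof (rule integral_bound[OF _ Dc[OF i]])
      fix s assume "s \<in> {real i * h..real (Suc i) * h}"
      then have "0 \<le> s" "s + h \<le> L"
        using cell(1,3)[OF i] unfolding atLeastAtMost_iff by linarith+
      then show "norm (D s) \<le> \<eta>" unfolding D_def using h by (intro osc) auto
    qed (use cell[OF i] in auto)
    then show ?thesis unfolding vD[OF i] by (simp add: algebra_simps)
  qed
  \<comment> \<open>The integral of \<Gamma>(s + h) - \<Gamma>(s) over a cell is the difference of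
    two neighbouring cell integrals of \<Gamma>, so the sum telescopes. This replaces an exchange of
    integrals over overlapping windows.\<close>
  define A where "A i = integral {real i * h..real (Suc i) * h} \<Gamma>" for i
  have step: "norm (v (Suc i) - v i) powr p \<le> h powr (2 * p - 2) * (A (Suc i) - A i)" if i: "Suc i < n" for i
  proof -
    let ?I = "{real i * h..real (Suc i) * h}"
    have len: "real (Suc i) * h - real i * h = h" by (simp add: algebra_simps)
    have Dp: "continuous_on ?I (\<lambda>s. norm (D s) powr p)"
      using p by (intro continuous_on_powr' continuous_intros Dc i) auto
    have "norm (LINT s:?I|lebesgue. D s) powr p \<le> (real (Suc i) * h - real i * h) powr (p - 1) * (LINT s:?I|lebesgue. norm (D s) powr p)"
      using cell[OF i] by (intro set_integral_Holder p absolutely_integrable_continuous_real Dc i Dp) auto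
    then have "norm (v (Suc i) - v i) powr p \<le> h powr (p - 1) * integral ?I (\<lambda>s. norm (D s) powr p)"
      unfolding len vD[OF i] set_lebesgue_integral_eq_integral(2)[OF absolutely_integrable_continuous_real[OF Dc[OF i]]]
          set_lebesgue_integral_eq_integral(2)[OF absolutely_integrable_continuous_real[OF Dp]] .
    also have "\<dots> \<le> h powr (p - 1) * integral ?I (\<lambda>s. h powr (p - 1) * (\<Gamma> (s + h) - \<Gamma> s))"
    proof (intro mult_left_mono integral_le)
      show "(\<lambda>s. norm (D s) powr p) integrable_on ?I" by (rule integrable_continuous_real[OF Dp])
      show "(\<lambda>s. h powr (p - 1) * (\<Gamma> (s + h) - \<Gamma> s)) integrable_on ?I"
        using cell[OF i] by (intro integrable_continuous_real continuous_intros shc[OF \<Gamma>c] subc[OF \<Gamma>c]) auto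
      fix s assume "s \<in> ?I"
      then have s: "0 \<le> s" "s \<le> s + h" "s + h \<le> L"
        using cell(1,3)[OF i] h unfolding atLeastAtMost_iff by linarith+
      have "norm (LINT x:{s..s + h}|lebesgue. g x) powr p \<le> (s + h - s) powr (p - 1) * (LINT x:{s..s + h}|lebesgue. norm (g x) powr p)"
        using s by (intro set_integral_Holder p set_integrable_subset[OF g] set_integrable_subset[OF gp]) auto
      then show "norm (D s) powr p \<le> h powr (p - 1) * (\<Gamma> (s + h) - \<Gamma> s)"
        using Tg[OF s] \<Gamma>[OF s] by (simp add: D_def)
    qed auto
    also have "integral ?I (\<lambda>s. h powr (p - 1) * (\<Gamma> (s + h) - \<Gamma> s)) = h powr (p - 1) * (A (Suc i) - A i)"
    proof -
      have "integral ?I (\<lambda>s. \<Gamma> (s + h) - \<Gamma> s) = integral ?I (\<lambda>s. \<Gamma> (s + h)) - integral ?I \<Gamma>"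
        using cell[OF i] by (intro Henstock_Kurzweil_Integration.integral_diff integrable_continuous_real shc[OF \<Gamma>c] subc[OF \<Gamma>c]) auto
      also have "integral ?I (\<lambda>s. \<Gamma> (s + h)) = integral {real i * h + h..real (Suc i) * h + h} \<Gamma>"
        by (rule shift)
      also have "\<dots> = A (Suc i)" unfolding A_def node(2) ..
      finally show ?thesis by (simp add: A_def)
    qed
    also have "h powr (p - 1) * (h powr (p - 1) * (A (Suc i) - A i)) = h powr (2 * p - 2) * (A (Suc i) - A i)"
      by (simp add: mult.assoc[symmetric] flip: powr_add)
    finally show ?thesis .
  qed
  have "(\<Sum>i<n-1. norm (v (Suc i) - v i) powr p) \<le> (\<Sum>i<n-1. h powr (2 * p - 2) * (A (Suc i) - A i))"
    by (intro sum_mono step) auto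
  also have "\<dots> = h powr (2 * p - 2) * (A (n - 1) - A 0)"
    by (simp add: sum_lessThan_telescope flip: sum_distrib_left)
  also have "\<dots> \<le> h powr (2 * p - 2) * (h * \<Gamma> L)"
  proof (intro mult_left_mono)
    \<comment> \<open>Only the two extreme cells remain: \<Gamma> is at most \<Gamma> L on the last
      and nonnegative on the first.\<close>
    have "A (n - 1) \<le> \<Gamma> L * (real (Suc (n - 1)) * h - real (n - 1) * h)"
    proof -
      have "norm (integral {real (n - 1) * h..real (Suc (n - 1)) * h} \<Gamma>) \<le> \<Gamma> L * (real (Suc (n - 1)) * h - real (n - 1) * h)"
      proof (rule integral_bound)
        have n1: "real (Suc (n - 1)) * h = L" using n h by simp
        show "continuous_on {real (n - 1) * h..real (Suc (n - 1)) * h} \<Gamma>"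
          unfolding n1 using node by (intro subc[OF \<Gamma>c]) auto
        show "norm (\<Gamma> s) \<le> \<Gamma> L" if "s \<in> {real (n - 1) * h..real (Suc (n - 1)) * h}" for s
        proof -
          have s: "0 \<le> s" "s \<le> L" using that node(1)[of "n - 1"] unfolding n1 atLeastAtMost_iff by linarith+
          show ?thesis using \<Gamma>mono[of 0 s] \<Gamma>mono[of s L] s \<Gamma>0 by simp
        qed
      qed (use h in \<open>simp add: mult_right_mono\<close>)
      then show ?thesis by (simp add: A_def)
    qed
    also have "\<dots> = h * \<Gamma> L" by (simp add: algebra_simps)
    finally have 1: "A (n - 1) \<le> h * \<Gamma> L" .
    have "0 \<le> A 0" unfolding A_def
    proof (rule Henstock_Kurzweil_Integration.integral_nonneg)
      have hL: "real (Suc 0) * h \<le> L" using nodeL[of "Suc 0"] n by simp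
      show "\<Gamma> integrable_on {real 0 * h..real (Suc 0) * h}"
        using hL by (intro integrable_continuous_real subc[OF \<Gamma>c]) auto
      show "0 \<le> \<Gamma> x" if "x \<in> {real 0 * h..real (Suc 0) * h}" for x
        using \<Gamma>mono[of 0 x] \<Gamma>0 that hL by auto
    qed
    with 1 show "A (n - 1) - A 0 \<le> h * \<Gamma> L" by simp
  qed simp
  also have "h powr (2 * p - 2) * (h * \<Gamma> L) = h powr (2 * p - 1) * \<Gamma> L"
    using h powr_add[of h "2 * p - 2" 1] by (simp add: mult.assoc[symmetric])
  finally have "(\<Sum>i<n-1. norm (v (Suc i) - v i) powr p) \<le> h powr (2 * p - 1) * \<Gamma> L" .
  then show "(\<Sum>i<n-1. norm (v (Suc i) - v i) powr p / h powr (2 * p - 1)) \<le> (LINT x:{0..L}|lebesgue. norm (g x) powr p)"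
    using h by (simp add: \<Gamma>_def pos_divide_le_eq mult.commute flip: sum_divide_distrib)
qed

text \<open>One number \<eta>, the oscillation of T over a step, controls both ingredients of the
  vertex bound: edges have length at least h (1 - \<eta>), and consecutive edges differ by at most h
  \<eta>.\<close>

lemma uniform_polygon_p_rotation_le:
  fixes c T g :: "real \<Rightarrow> 'a::euclidean_space"
  assumes c: "arclength_curve L c" and L: "0 < L" and p: "p > 1" and n: "0 < n"
    and T: "continuous_on {0..L} T"
    and cT: "\<And>a b. 0 \<le> a \<Longrightarrow> a \<le> b \<Longrightarrow> b \<le> L \<Longrightarrow> c b - c a = integral {a..b} T"
    and Tg: "\<And>a b. 0 \<le> a \<Longrightarrow> a \<le> b \<Longrightarrow> b \<le> L \<Longrightarrow> T b - T a = (LINT x:{a..b}|lebesgue. g x)"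
    and g: "g absolutely_integrable_on {0..L}"
    and gp: "(\<lambda>x. norm (g x) powr p) absolutely_integrable_on {0..L}"
    and \<eta>: "0 \<le> \<eta>" "\<eta> \<le> 1 / 2"
    and osc: "\<And>s t. s \<in> {0..L} \<Longrightarrow> t \<in> {0..L} \<Longrightarrow> \<bar>s - t\<bar> \<le> L / real n \<Longrightarrow> norm (T s - T t) \<le> \<eta>"
  obtains t where "inscribed L c t (map c t)" "modulus c t \<le> L / real n"
    "p_rotation p (map c t) \<le> ennreal ((1 - \<eta>) powr (1 - 3 * p) * (LINT x:{0..L}|lebesgue. norm (g x) powr p))"
proof -
  define h where "h = L / real n"
  have h: "0 < h" "real n * h = L" using L n by (auto simp: h_def)
  define v where "v = (\<lambda>i. c (real (Suc i) * h) - c (real i * h))"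
  define t where "t = map (\<lambda>i. real i * h) [0..<Suc n]"
  have len: "length t = Suc n" by (simp add: t_def)
  have tn: "t ! i = real i * h" if "i \<le> n" for i
    using that nth_map[of i "[0..<Suc n]" "\<lambda>i. real i * h"] by (simp add: t_def del: upt_Suc)
  have nodeL: "real i * h \<le> L" if "i \<le> n" for i
    using mult_right_mono[of "real i" "real n" h] that h by simp
  have part: "is_partition 0 L t"
    unfolding is_partition_def
  proof (intro conjI)
    show ne: "t \<noteq> []" using len by auto
    show "sorted_wrt (<) t"
      unfolding sorted_wrt_iff_nth_less len using tn h by auto
    show "hd t = 0" using tn[of 0] ne by (simp add: hd_conv_nth)
    show "last t = L" using tn[of n] ne len h by (simp add: last_conv_nth)
  qed
  have vlow: "h * (1 - \<eta>) \<le> norm (v i)" if i: "i < n" for i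
  proof -
    have ir: "0 \<le> real i * h" "real i * h < real (Suc i) * h" "real (Suc i) * h \<le> L" "real (Suc i) * h - real i * h = h"
      using nodeL[of "Suc i"] i h by (auto simp: algebra_simps)
    have "(real (Suc i) * h - real i * h) * (1 - \<eta>) \<le> norm (c (real (Suc i) * h) - c (real i * h))"
    proof (rule chord_ge_of_nearly_constant_derivative[OF c ir(1-3)])
      show "continuous_on {real i * h..real (Suc i) * h} T"
        by (rule continuous_on_subset[OF T]) (use ir in auto)
      show "c b - c a = integral {a..b} T" if "real i * h \<le> a" "a \<le> b" "b \<le> real (Suc i) * h" for a b
        by (rule cT[OF order_trans[OF ir(1) that(1)] that(2) order_trans[OF that(3) ir(3)]])
      show "norm (T s - T u) \<le> \<eta>" if "s \<in> {real i * h..real (Suc i) * h}" "u \<in> {real i * h..real (Suc i) * h}" for s u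
      proof (rule osc)
        have sub: "{real i * h..real (Suc i) * h} \<subseteq> {0..L}" using ir(1,3) by (simp only: atLeastatMost_subset_iff) simp
        then show "s \<in> {0..L}" "u \<in> {0..L}" using that by blast+
        have "\<bar>s - u\<bar> \<le> real (Suc i) * h - real i * h" using that by (simp only: atLeastAtMost_iff) linarith
        then have "\<bar>s - u\<bar> \<le> h" by (simp only: ir(4))
        then show "\<bar>s - u\<bar> \<le> L / real n" by (simp only: h_def)
      qed
    qed
    then show ?thesis unfolding ir(4) v_def .
  qed
  have vpos: "v i \<noteq> 0" if "i < n" for i
  proof -
    have "0 < h * (1 - \<eta>)" using h \<eta> by (intro mult_pos_pos) auto
    then show ?thesis using vlow[OF that] by auto
  qed
  have edge: "edge (map c t) (Suc i) = v i" if "i < n" for i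
    using that tn[of i] tn[of "Suc i"] len by (simp add: edge_def v_def del: of_nat_Suc)
  have poly: "polygonal (map c t)"
    unfolding polygonal_def
  proof (intro conjI ballI)
    show "2 \<le> length (map c t)" using len n by simp
    fix i assume i: "i \<in> {1..<length (map c t)}"
    then obtain j where "i = Suc j" "j < n" using len by (cases i) auto
    then show "edge (map c t) i \<noteq> 0" using edge vpos by simp
  qed
  have ins: "inscribed L c t (map c t)" using part poly by (simp add: inscribed_def)
  have mod: "modulus c t \<le> L / real n"
    unfolding modulus_def
  proof (rule Max.boundedI)
    show "(\<lambda>i. diameter (c ` {t ! (i - 1)..t ! i})) ` {1..<length t} \<noteq> {}" using len n by auto
    fix d assume "d \<in> (\<lambda>i. diameter (c ` {t ! (i - 1)..t ! i})) ` {1..<length t}"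
    then obtain i where i: "i \<in> {1..<length t}" "d = diameter (c ` {t ! (i - 1)..t ! i})" by auto
    obtain j where j: "i = Suc j" "j < n" using i(1) len by (cases i) auto
    have d: "d = diameter (c ` {real j * h..real (Suc j) * h})" using i(2) j tn[of j] tn[of "Suc j"] by simp
    have jr: "0 \<le> real j * h" "real j * h \<le> real (Suc j) * h" "real (Suc j) * h \<le> L" "real (Suc j) * h - real j * h = h"
      using nodeL[of "Suc j"] j h by (auto simp: algebra_simps)
    have lip: "norm (c x - c y) \<le> h" if "y \<in> {real j * h..real (Suc j) * h}" "x \<in> {real j * h..real (Suc j) * h}" "y \<le> x" for x y
    proof -
      have "0 \<le> y" "x \<le> L" "x - y \<le> h" using that jr unfolding atLeastAtMost_iff by linarith+
      then show ?thesis using arclength_curve_Lipschitz[OF c, of y x] that by simp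
    qed
    show "d \<le> L / real n"
      unfolding d h_def[symmetric]
    proof (rule diameter_le)
      show "c ` {real j * h..real (Suc j) * h} \<noteq> {} \<or> 0 \<le> h" using h by simp
      fix x y assume "x \<in> c ` {real j * h..real (Suc j) * h}" "y \<in> c ` {real j * h..real (Suc j) * h}"
      then obtain x' y' where "x' \<in> {real j * h..real (Suc j) * h}" "y' \<in> {real j * h..real (Suc j) * h}" "x = c x'" "y = c y'" by auto
      then show "norm (x - y) \<le> h"
        using lip[of x' y'] lip[of y' x'] by (cases "x' \<le> y'") (auto simp: norm_minus_commute)
    qed
  qed auto
  let ?\<theta> = "turning_angle (map c t)"
  let ?term = "\<lambda>i. ?\<theta> i * (tan (?\<theta> i / 2) / (min_edge (map c t) i / 2)) powr (p - 1)"
  note sd = sum_second_differences_le[OF L p n T cT Tg g gp h_def v_def]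
  have trm: "?\<theta> (Suc i) \<noteq> pi \<and> ?term (Suc i) \<le> (1 - \<eta>) powr (1 - 3 * p) * (norm (v (Suc i) - v i) powr p / h powr (2 * p - 1))"
    if i: "Suc i < n" for i
  proof -
    have "norm (v (Suc i) - v i) \<le> h * \<eta>" using i by (intro sd(2)) (auto intro: osc simp: h_def)
    from p_rotation_term_le[OF p \<eta> h(1) _ _ this] show ?thesis
      using vlow[of i] vlow[of "Suc i"] i by (simp add: turning_angle_def min_edge_def edge)
  qed
  have npi: "\<not> (\<exists>i\<in>{1..<length (map c t) - 1}. ?\<theta> i = pi)"
  proof
    assume "\<exists>i\<in>{1..<length (map c t) - 1}. ?\<theta> i = pi"
    then obtain i where i: "i \<in> {1..<n}" "?\<theta> i = pi" using len by auto
    then obtain j where "i = Suc j" by (cases i) auto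
    then show False using trm[of j] i by auto
  qed
  have "p_rotation p (map c t) = ennreal (\<Sum>i = 1..<length (map c t) - 1. ?term i)"
    using npi by (simp only: p_rotation_def if_False)
  also have "(\<Sum>i = 1..<length (map c t) - 1. ?term i) = (\<Sum>i<n - 1. ?term (Suc i))"
  proof -
    have "length (map c t) - 1 = Suc (n - 1)" using len n by simp
    then show ?thesis by (simp only: One_nat_def sum.atLeast_Suc_lessThan_Suc_shift lessThan_atLeast0 o_def)
  qed
  finally have rot_eq: "p_rotation p (map c t) = ennreal (\<Sum>i<n - 1. ?term (Suc i))" .
  have "(\<Sum>i<n - 1. ?term (Suc i)) \<le> (\<Sum>i<n - 1. (1 - \<eta>) powr (1 - 3 * p) * (norm (v (Suc i) - v i) powr p / h powr (2 * p - 1)))"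
    by (intro sum_mono trm[THEN conjunct2]) auto
  also have "\<dots> = (1 - \<eta>) powr (1 - 3 * p) * (\<Sum>i<n - 1. norm (v (Suc i) - v i) powr p / h powr (2 * p - 1))"
    by (rule sum_distrib_left[symmetric])
  also have "\<dots> \<le> (1 - \<eta>) powr (1 - 3 * p) * (LINT x:{0..L}|lebesgue. norm (g x) powr p)"
    by (intro mult_left_mono sd(1) powr_ge_zero)
  finally have "(\<Sum>i<n - 1. ?term (Suc i)) \<le> (1 - \<eta>) powr (1 - 3 * p) * (LINT x:{0..L}|lebesgue. norm (g x) powr p)" .
  then have rot: "p_rotation p (map c t) \<le> ennreal ((1 - \<eta>) powr (1 - 3 * p) * (LINT x:{0..L}|lebesgue. norm (g x) powr p))"
    unfolding rot_eq by (rule ennreal_leI)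
  show thesis by (rule that[OF ins mod rot])
qed

text \<open>Uniform polygonals with oscillation \<eta>_k tending to 0 form an admissible sequence,
  along which the factor (1 - \<eta>_k)^(1 - 3p) tends to 1.\<close>

lemma p_curvature_le:
  fixes c T g :: "real \<Rightarrow> 'a::euclidean_space"
  assumes c: "arclength_curve L c" and L: "0 < L" and p: "p > 1"
    and T: "continuous_on {0..L} T"
    and cT: "\<And>a b. 0 \<le> a \<Longrightarrow> a \<le> b \<Longrightarrow> b \<le> L \<Longrightarrow> c b - c a = integral {a..b} T"
    and Tg: "\<And>a b. 0 \<le> a \<Longrightarrow> a \<le> b \<Longrightarrow> b \<le> L \<Longrightarrow> T b - T a = (LINT x:{a..b}|lebesgue. g x)"
    and g: "g absolutely_integrable_on {0..L}"
    and gp: "(\<lambda>x. norm (g x) powr p) absolutely_integrable_on {0..L}"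
  shows "p_curvature p L c \<le> ennreal (LINT x:{0..L}|lebesgue. norm (g x) powr p)"
proof -
  define J where "J = (LINT x:{0..L}|lebesgue. norm (g x) powr p)"
  \<comment> \<open>Starting at 1/2 meets the restriction on \<eta> for every k.\<close>
  define \<eta> where "\<eta> k = inverse (real (Suc (Suc k)))" for k
  have \<eta>: "0 < \<eta> k" "\<eta> k \<le> 1 / 2" for k by (auto simp: \<eta>_def field_simps)
  have \<eta>0: "\<eta> \<longlonglongrightarrow> 0" unfolding \<eta>_def using LIMSEQ_Suc[OF LIMSEQ_inverse_real_of_nat] by simp
  have unif: "uniformly_continuous_on {0..L} T" using T by (intro compact_uniformly_continuous) auto
  have "\<exists>t. inscribed L c t (map c t) \<and> modulus c t \<le> \<eta> k
      \<and> p_rotation p (map c t) \<le> ennreal ((1 - \<eta> k) powr (1 - 3 * p) * J)" for k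
  proof -
    obtain d where d: "0 < d" "\<And>s u. s \<in> {0..L} \<Longrightarrow> u \<in> {0..L} \<Longrightarrow> dist u s < d \<Longrightarrow> dist (T u) (T s) < \<eta> k"
      using unif \<eta>(1)[of k] unfolding uniformly_continuous_on_def by blast
    \<comment> \<open>A step below d controls the oscillation of T, a step below \<eta>_k controls
      the modulus.\<close>
    obtain n :: nat where n: "L / min d (\<eta> k) < real n" using reals_Archimedean2 by blast
    have m: "0 < min d (\<eta> k)" using d \<eta> by simp
    then have "0 < real n" using n L by (intro order_less_trans[OF divide_pos_pos n]) auto
    then have n0: "0 < n" by simp
    have Ln: "L / real n < min d (\<eta> k)"
      using n unfolding pos_divide_less_eq[OF m] pos_divide_less_eq[OF \<open>0 < real n\<close>] by (simp only: mult.commute)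
    obtain t where t: "inscribed L c t (map c t)" "modulus c t \<le> L / real n"
      "p_rotation p (map c t) \<le> ennreal ((1 - \<eta> k) powr (1 - 3 * p) * (LINT x:{0..L}|lebesgue. norm (g x) powr p))"
    proof (rule uniform_polygon_p_rotation_le[OF c L p n0 T cT Tg g gp])
      show "0 \<le> \<eta> k" "\<eta> k \<le> 1 / 2" using \<eta>[of k] by auto
      show "norm (T s - T u) \<le> \<eta> k" if "s \<in> {0..L}" "u \<in> {0..L}" "\<bar>s - u\<bar> \<le> L / real n" for s u
        using d(2)[of u s] that Ln by (simp add: dist_norm)
    qed auto
    then show ?thesis using Ln by (intro exI[of _ t]) (auto simp: J_def)
  qed
  then obtain t where t: "\<And>k. inscribed L c (t k) (map c (t k))" "\<And>k. modulus c (t k) \<le> \<eta> k"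
    "\<And>k. p_rotation p (map c (t k)) \<le> ennreal ((1 - \<eta> k) powr (1 - 3 * p) * J)" by metis
  have mod0: "0 \<le> modulus c (t k)" for k
  proof -
    have "2 \<le> length (t k)" using t(1)[of k] by (simp add: inscribed_def polygonal_def)
    then have "diameter (c ` {t k ! (1 - 1)..t k ! 1}) \<le> modulus c (t k)"
      unfolding modulus_def by (intro Max_ge image_eqI[where x=1]) auto
    moreover have "0 \<le> diameter (c ` {t k ! (1 - 1)..t k ! 1})"
    proof (rule diameter_ge_0)
      have "t k ! 0 = 0" "t k ! 1 \<le> L"
        using is_partition_nth[of 0 L "t k"] t(1)[of k] \<open>2 \<le> length (t k)\<close> by (auto simp: inscribed_def)
      then have "continuous_on {t k ! (1 - 1)..t k ! 1} c"
        using c by (auto simp: arclength_curve_def elim!: continuous_on_subset)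
      then show "bounded (c ` {t k ! (1 - 1)..t k ! 1})"
        by (intro compact_imp_bounded compact_continuous_image) auto
    qed
    ultimately show ?thesis by simp
  qed
  have lim: "(\<lambda>k. modulus c (t k)) \<longlonglongrightarrow> 0"
    by (rule tendsto_sandwich[OF always_eventually[OF allI[OF mod0]] always_eventually[OF allI[OF t(2)]] tendsto_const \<eta>0])
  have "p_curvature p L c \<le> liminf (\<lambda>k. p_rotation p (map c (t k)))"
    unfolding p_curvature_def
    by (rule Inf_lower, rule CollectI, intro exI[of _ "\<lambda>k. map c (t k)"] exI[of _ t]) (use t(1) lim in simp)
  also have "\<dots> \<le> liminf (\<lambda>k. ennreal ((1 - \<eta> k) powr (1 - 3 * p) * J))"
    by (intro Liminf_mono always_eventually allI t(3))
  also have "\<dots> = ennreal J"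
  proof (rule lim_imp_Liminf)
    have "(\<lambda>k. (1 - \<eta> k) powr (1 - 3 * p) * J) \<longlonglongrightarrow> (1 - 0) powr (1 - 3 * p) * J"
      by (intro tendsto_intros \<eta>0) auto
    then have "(\<lambda>k. (1 - \<eta> k) powr (1 - 3 * p) * J) \<longlonglongrightarrow> J" by simp
    then show "(\<lambda>k. ennreal ((1 - \<eta> k) powr (1 - 3 * p) * J)) \<longlonglongrightarrow> ennreal J" by (rule tendsto_ennrealI)
  qed simp
  finally show ?thesis by (simp add: J_def)
qed

section \<open>Characterization of finite p-curvature\<close>

lemma nn_integral_weak_derivative_unique:
  fixes f g1 g2 :: "real \<Rightarrow> 'a::euclidean_space"
  assumes "has_weak_derivative {0<..<L} k f g1" "has_weak_derivative {0<..<L} k f g2"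
  shows "(\<integral>\<^sup>+s\<in>{0..L}. ennreal (norm (g1 s) powr p) \<partial>lebesgue) = (\<integral>\<^sup>+s\<in>{0..L}. ennreal (norm (g2 s) powr p) \<partial>lebesgue)"
proof (rule nn_integral_cong_AE)
  have "AE s in lebesgue. s \<noteq> 0" "AE s in lebesgue. s \<noteq> L"
    by (auto intro!: AE_completion AE_lborel_singleton)
  with weak_derivative_unique[OF assms]
  show "AE s in lebesgue. ennreal (norm (g1 s) powr p) * indicator {0..L} s = ennreal (norm (g2 s) powr p) * indicator {0..L} s"
    by eventually_elim (auto simp: indicator_def)
qed

text \<open>On a bounded interval the constant 1 is integrable, and t \<le> 1 + t^p for t \<ge>
  0.\<close>

lemma Lp_on_imp_absolutely_integrable:
  fixes g :: "real \<Rightarrow> 'a::euclidean_space"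
  assumes g: "g \<in> Lp_on p {a<..<b}" and p: "p \<ge> 1"
  shows "g absolutely_integrable_on {a<..<b}"
proof -
  have "(\<lambda>x. 1 + norm (g x) powr p) absolutely_integrable_on {a<..<b}"
  proof (rule set_integral_add(1))
    show "(\<lambda>x. norm (g x) powr p) absolutely_integrable_on {a<..<b}" using g by (simp add: Lp_on_def)
    show "(\<lambda>x. 1::real) absolutely_integrable_on {a<..<b}"
      unfolding absolutely_integrable_Ioo_Icc by (rule absolutely_integrable_continuous_real) simp
  qed
  then show ?thesis
  proof (rule set_integrable_bound)
    show "set_borel_measurable lebesgue {a<..<b} g" using g by (simp add: Lp_on_def)
    have "norm (g x) \<le> 1 + norm (g x) powr p" for x
    proof (cases "norm (g x) \<le> 1")
      case True
      then show ?thesis using powr_ge_zero[of "norm (g x)" p] by linarith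
    next
      case False
      then have "norm (g x) powr 1 \<le> norm (g x) powr p" using p by (intro powr_mono) auto
      then show ?thesis using False by simp
    qed
    then have "norm (g x) \<le> norm (1 + norm (g x) powr p)" for x using powr_ge_zero[of "norm (g x)" p] by simp
    then show "AE x in lebesgue. x \<in> {a<..<b} \<longrightarrow> norm (g x) \<le> norm (1 + norm (g x) powr p)"
      by (intro AE_I2) blast
  qed
qed

lemma p_curvature_le_sobolev:
  fixes c :: "real \<Rightarrow> 'a::euclidean_space"
  assumes c: "arclength_curve L c" and L: "0 < L" and p: "p > 1" and S: "c \<in> sobolev 2 p {0<..<L}"
  obtains g where "has_weak_derivative {0<..<L} 2 c g"
    "p_curvature p L c \<le> (\<integral>\<^sup>+s\<in>{0..L}. ennreal (norm (g s) powr p) \<partial>lebesgue)" "p_curvature p L c < \<infinity>"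
proof -
  have "\<forall>j\<in>{1..2}. \<exists>g\<in>Lp_on p {0<..<L}. has_weak_derivative {0<..<L} j c g"
    using S unfolding sobolev_def by blast
  then have "\<exists>g\<in>Lp_on p {0<..<L}. has_weak_derivative {0<..<L} 2 c g" by (rule bspec) simp
  then obtain g where g: "g \<in> Lp_on p {0<..<L}" "has_weak_derivative {0<..<L} 2 c g" by blast
  have cc: "continuous_on {0..L} c" using c by (simp add: arclength_curve_def)
  have gi: "g absolutely_integrable_on {0..L}"
    using Lp_on_imp_absolutely_integrable[OF g(1)] p absolutely_integrable_Ioo_Icc[where f=g] by simp
  have gp: "(\<lambda>x. norm (g x) powr p) absolutely_integrable_on {0..L}"
    using g(1) absolutely_integrable_Ioo_Icc[where f="\<lambda>x. norm (g x) powr p"] by (simp add: Lp_on_def)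
  obtain T where T: "continuous_on {0..L} T"
    "\<And>a b. 0 \<le> a \<Longrightarrow> a \<le> b \<Longrightarrow> b \<le> L \<Longrightarrow> T b - T a = (LINT x:{a..b}|lebesgue. g x)"
    "\<And>a b. 0 \<le> a \<Longrightarrow> a \<le> b \<Longrightarrow> b \<le> L \<Longrightarrow> c b - c a = (LINT x:{a..b}|lebesgue. T x)"
    using weak_second_derivative_representation[OF L cc gi g(2)] by blast
  have cT: "c b - c a = integral {a..b} T" if ab: "0 \<le> a" "a \<le> b" "b \<le> L" for a b
  proof -
    have "T absolutely_integrable_on {a..b}"
      by (intro absolutely_integrable_continuous_real continuous_on_subset[OF T(1)]) (use ab in auto)
    then show ?thesis using T(3)[OF ab] set_lebesgue_integral_eq_integral(2) by metis
  qed
  have le: "p_curvature p L c \<le> ennreal (LINT x:{0..L}|lebesgue. norm (g x) powr p)"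
    by (rule p_curvature_le[OF c L p T(1) cT T(2) gi gp])
  have "ennreal (LINT x:{0..L}|lebesgue. norm (g x) powr p) = (\<integral>\<^sup>+s\<in>{0..L}. ennreal (norm (g s) powr p) \<partial>lebesgue)"
  proof -
    have "(\<integral>\<^sup>+s. ennreal (indicator {0..L} s *\<^sub>R norm (g s) powr p) \<partial>lebesgue) = ennreal (LINT s|lebesgue. indicator {0..L} s *\<^sub>R norm (g s) powr p)"
      using gp unfolding set_integrable_def by (rule nn_integral_eq_integral) simp
    moreover have "ennreal (indicator {0..L} s *\<^sub>R norm (g s) powr p) = ennreal (norm (g s) powr p) * indicator {0..L} s" for s
      by (simp add: indicator_def)
    ultimately show ?thesis by (simp add: set_lebesgue_integral_def)
  qed
  then have "p_curvature p L c \<le> (\<integral>\<^sup>+s\<in>{0..L}. ennreal (norm (g s) powr p) \<partial>lebesgue)"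
    using le by simp
  moreover have "p_curvature p L c < \<infinity>" using le_less_trans[OF le ennreal_less_top] by simp
  ultimately show thesis by (rule that[OF g(2)])
qed

lemma continuous_in_Lp_on:
  fixes f :: "real \<Rightarrow> 'a::euclidean_space"
  assumes f: "continuous_on {a..b} f" and p: "p > 0"
  shows "f \<in> Lp_on p {a<..<b}" "f locally_integrable_on {a<..<b}"
proof -
  have fi: "f absolutely_integrable_on {a..b}" using f by (rule absolutely_integrable_continuous_real)
  have "continuous_on {a..b} (\<lambda>x. norm (f x) powr p)"
    using p by (intro continuous_on_powr' continuous_intros f) auto
  then have "(\<lambda>x. norm (f x) powr p) absolutely_integrable_on {a<..<b}"
    unfolding absolutely_integrable_Ioo_Icc by (rule absolutely_integrable_continuous_real)
  moreover have "set_borel_measurable lebesgue {a<..<b} f"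
  proof -
    have "f absolutely_integrable_on {a<..<b}" using fi by (simp only: absolutely_integrable_Ioo_Icc)
    then show ?thesis
      unfolding set_integrable_def set_borel_measurable_def by (rule borel_measurable_integrable)
  qed
  ultimately show "f \<in> Lp_on p {a<..<b}" by (simp add: Lp_on_def)
  show "f locally_integrable_on {a<..<b}"
    unfolding locally_integrable_on_def
  proof (intro allI impI)
    fix K :: "real set" assume K: "compact K \<and> K \<subseteq> {a<..<b}"
    show "f absolutely_integrable_on K"
      by (rule set_integrable_subset[OF fi]) (use K in \<open>auto intro: fmeasurableD[OF lmeasurable_compact]\<close>)
  qed
qed

text \<open>The limit direction T is a classical derivative inside (0, L) and extends continuously
  to the ends, so c is an indefinite integral of T. Two integrations by parts then turn T and g into
  weak derivatives.\<close>

lemma p_curvature_less_imp_sobolev: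
  fixes c :: "real \<Rightarrow> 'a::euclidean_space"
  assumes c: "arclength_curve L c" and L: "0 < L" and p: "p > 1" and M: "p_curvature p L c < ennreal M"
  obtains g where "c \<in> sobolev 2 p {0<..<L}" "has_weak_derivative {0<..<L} 2 c g"
    "(\<integral>\<^sup>+s\<in>{0..L}. ennreal (norm (g s) powr p) \<partial>lebesgue) \<le> ennreal M"
proof -
  obtain T g where T: "\<And>a. 0 < a \<Longrightarrow> a < L \<Longrightarrow> (c has_vector_derivative T a) (at a)"
    and g: "g \<in> borel_measurable borel" "set_integrable lborel {0..L} g"
    and Tg: "\<And>a b. 0 \<le> a \<Longrightarrow> a \<le> b \<Longrightarrow> b \<le> L \<Longrightarrow> T b - T a = (LINT x:{a..b}|lborel. g x)"
    and gM: "(\<integral>\<^sup>+x\<in>{0..L}. ennreal (norm (g x) powr p) \<partial>lborel) \<le> ennreal M"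
    using p_curvature_less_imp_derivatives[OF c L p M] by blast
  have cc: "continuous_on {0..L} c" using c by (simp add: arclength_curve_def)
  have gb: "(\<lambda>x. indicator A x *\<^sub>R g x) \<in> borel_measurable lborel" if "A \<in> sets borel" for A
    using g(1) that by simp
  have gi: "g absolutely_integrable_on {0..L}"
    using g(2) integrable_completion[OF gb[of "{0..L}"]] by (simp add: set_integrable_def)
  have TgL: "T b = T a + (LINT x:{a..b}|lebesgue. g x)" if "0 \<le> a" "a \<le> b" "b \<le> L" for a b
    using Tg[OF that] integral_completion[OF gb[of "{a..b}"]]
    by (simp add: set_lebesgue_integral_def algebra_simps)
  have Tc: "continuous_on {0..L} T"
  proof -
    have "continuous_on {0..L} (\<lambda>t. T 0 + (LINT x:{0..t}|lebesgue. g x))"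
      by (intro continuous_intros continuous_on_set_integral gi)
    then show ?thesis by (rule continuous_on_eq) (rule TgL[symmetric], auto)
  qed
  have Ti: "T absolutely_integrable_on {0..L}" using Tc by (rule absolutely_integrable_continuous_real)
  have cT: "c t = c 0 + (LINT x:{0..t}|lebesgue. T x)" if t: "0 \<le> t" "t \<le> L" for t
  proof -
    have "(T has_integral (c t - c 0)) {0..t}"
      using t by (intro fundamental_theorem_of_calculus_interior continuous_on_subset[OF cc] T) auto
    then have "integral {0..t} T = c t - c 0" by (rule integral_unique)
    moreover have "T absolutely_integrable_on {0..t}"
      by (rule set_integrable_subset[OF Ti]) (use t in auto)
    then have "(LINT x:{0..t}|lebesgue. T x) = integral {0..t} T"
      by (rule set_lebesgue_integral_eq_integral(2))
    ultimately show ?thesis by simp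
  qed
  have d1: "(LINT x:{0<..<L}|lebesgue. deriv \<phi> x *\<^sub>R c x) = - (LINT x:{0<..<L}|lebesgue. \<phi> x *\<^sub>R T x)"
    if "test_function {0<..<L} \<phi>" for \<phi>
    by (rule integral_by_parts_test_function[OF L Ti cT that])
  have d2: "(LINT x:{0<..<L}|lebesgue. deriv \<phi> x *\<^sub>R T x) = - (LINT x:{0<..<L}|lebesgue. \<phi> x *\<^sub>R g x)"
    if "test_function {0<..<L} \<phi>" for \<phi>
    by (rule integral_by_parts_test_function[OF L gi TgL[OF order_refl] that])
  have W1: "has_weak_derivative {0<..<L} 1 c T"
    unfolding has_weak_derivative_def using continuous_in_Lp_on(2)[OF cc p[THEN less_trans[OF zero_less_one]]]
      continuous_in_Lp_on(2)[OF Tc p[THEN less_trans[OF zero_less_one]]] d1 by simp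
  have gloc: "g locally_integrable_on {0<..<L}"
    unfolding locally_integrable_on_def
  proof (intro allI impI)
    fix K :: "real set" assume K: "compact K \<and> K \<subseteq> {0<..<L}"
    show "g absolutely_integrable_on K"
      by (rule set_integrable_subset[OF gi]) (use K in \<open>auto intro: fmeasurableD[OF lmeasurable_compact]\<close>)
  qed
  have W2: "has_weak_derivative {0<..<L} 2 c g"
    unfolding has_weak_derivative_def
  proof (intro conjI allI impI)
    show "c locally_integrable_on {0<..<L}" using continuous_in_Lp_on(2)[OF cc, of p] p by simp
    show "g locally_integrable_on {0<..<L}" by (rule gloc)
    fix \<phi> assume \<phi>: "test_function {0<..<L} \<phi>"
    have "(LINT x:{0<..<L}|lebesgue. deriv (deriv \<phi>) x *\<^sub>R c x) = - (- (LINT x:{0<..<L}|lebesgue. \<phi> x *\<^sub>R g x))"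
      unfolding d1[OF test_function_deriv[OF \<phi>]] d2[OF \<phi>] ..
    then show "(LINT x:{0<..<L}|lebesgue. (deriv ^^ 2) \<phi> x *\<^sub>R c x) = (- 1) ^ 2 *\<^sub>R (LINT x:{0<..<L}|lebesgue. \<phi> x *\<^sub>R g x)"
      by (simp add: numeral_2_eq_2)
  qed
  have gM': "(\<integral>\<^sup>+x\<in>{0..L}. ennreal (norm (g x) powr p) \<partial>lebesgue) \<le> ennreal M"
    using gM by (simp add: nn_integral_completion)
  have gp: "(\<lambda>x. norm (g x) powr p) absolutely_integrable_on {0..L}"
    unfolding set_integrable_def
  proof (rule integrableI_bounded)
    have "(\<lambda>x. indicator {0..L} x *\<^sub>R norm (g x) powr p) \<in> borel_measurable lborel" using g(1) by simp
    then show "(\<lambda>x. indicator {0..L} x *\<^sub>R norm (g x) powr p) \<in> borel_measurable lebesgue" by (rule measurable_completion)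
    have "(\<integral>\<^sup>+x. ennreal (norm (indicator {0..L} x *\<^sub>R norm (g x) powr p)) \<partial>lebesgue) = (\<integral>\<^sup>+x\<in>{0..L}. ennreal (norm (g x) powr p) \<partial>lebesgue)"
      by (intro nn_integral_cong) (simp add: indicator_def)
    also have "\<dots> < \<infinity>" using gM' by (rule le_less_trans) simp
    finally show "(\<integral>\<^sup>+x. ennreal (norm (indicator {0..L} x *\<^sub>R norm (g x) powr p)) \<partial>lebesgue) < \<infinity>" .
  qed
  have gLp: "g \<in> Lp_on p {0<..<L}"
  proof -
    have "g absolutely_integrable_on {0<..<L}" using gi by (simp only: absolutely_integrable_Ioo_Icc)
    then have "set_borel_measurable lebesgue {0<..<L} g"
      unfolding set_integrable_def set_borel_measurable_def by (rule borel_measurable_integrable)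
    moreover have "(\<lambda>x. norm (g x) powr p) absolutely_integrable_on {0<..<L}"
      using gp by (simp only: absolutely_integrable_Ioo_Icc)
    ultimately show ?thesis by (simp add: Lp_on_def)
  qed
  have "c \<in> sobolev 2 p {0<..<L}"
    unfolding sobolev_def
  proof (intro CollectI conjI ballI)
    show "c \<in> Lp_on p {0<..<L}" using continuous_in_Lp_on(1)[OF cc, of p] p by simp
    fix j :: nat assume "j \<in> {1..2}"
    then consider "j = 1" | "j = 2" by force
    then show "\<exists>g\<in>Lp_on p {0<..<L}. has_weak_derivative {0<..<L} j c g"
    proof cases
      case 1
      then show ?thesis using W1 continuous_in_Lp_on(1)[OF Tc, of p] p by auto
    next
      case 2
      then show ?thesis using W2 gLp by auto
    qed
  qed
  from this W2 gM' show thesis by (rule that)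
qed

theorem theorem1p1:
  fixes c :: "real \<Rightarrow> real ^ 'n" and L p :: real
  assumes "CARD('n) \<ge> 2"
    and "0 < L"
    and "arclength_curve L c"
    and "c 0 \<noteq> c L"
    and "p > 1"
  shows "(p_curvature p L c < \<infinity> \<longleftrightarrow> c \<in> sobolev 2 p {0<..<L}) \<and>
    (c \<in> sobolev 2 p {0<..<L} \<longrightarrow>
      (\<forall>c''. has_weak_derivative {0<..<L} 2 c c'' \<longrightarrow>
        p_curvature p L c = (\<integral>\<^sup>+ s\<in>{0..L}. ennreal (norm (c'' s) powr p) \<partial>lebesgue)))"
proof (intro conjI iffI impI allI)
  note L = assms(2) and c = assms(3) and p = assms(5)
  show "c \<in> sobolev 2 p {0<..<L}" if fin: "p_curvature p L c < \<infinity>"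
  proof -
    obtain M where "p_curvature p L c < ennreal M"
    proof (cases "p_curvature p L c")
      case (real r)
      then have "p_curvature p L c < ennreal (r + 1)" by (simp add: ennreal_lessI)
      then show thesis by (rule that)
    qed (use fin in simp)
    then show ?thesis by (rule p_curvature_less_imp_sobolev[OF c L p])
  qed
  show "p_curvature p L c < \<infinity>" if "c \<in> sobolev 2 p {0<..<L}"
    by (rule p_curvature_le_sobolev[OF c L p that])
  fix c'' assume S: "c \<in> sobolev 2 p {0<..<L}" and W: "has_weak_derivative {0<..<L} 2 c c''"
  show "p_curvature p L c = (\<integral>\<^sup>+ s\<in>{0..L}. ennreal (norm (c'' s) powr p) \<partial>lebesgue)" (is "_ = ?I")
  proof (rule antisym)
    obtain g where g: "has_weak_derivative {0<..<L} 2 c g"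
      "p_curvature p L c \<le> (\<integral>\<^sup>+s\<in>{0..L}. ennreal (norm (g s) powr p) \<partial>lebesgue)"
      by (rule p_curvature_le_sobolev[OF c L p S])
    show "p_curvature p L c \<le> ?I"
      using g(2) unfolding nn_integral_weak_derivative_unique[OF g(1) W] .
    show "?I \<le> p_curvature p L c"
    proof (rule ccontr)
      assume "\<not> ?thesis"
      \<comment> \<open>A value strictly between is a finite bound M to which the lower bound
        applies; it forces the integral below M, against the choice of m.\<close>
      then obtain m where m: "p_curvature p L c < m" "m < ?I" by (auto simp: not_le dest: dense)
      then have "m < \<infinity>" using top.not_eq_extremum by fastforce
      then obtain M where M: "m = ennreal M" by (cases m) auto
      obtain g where g: "has_weak_derivative {0<..<L} 2 c g"
        "(\<integral>\<^sup>+s\<in>{0..L}. ennreal (norm (g s) powr p) \<partial>lebesgue) \<le> ennreal M"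
        by (rule p_curvature_less_imp_sobolev[OF c L p m(1)[unfolded M]])
      have "?I \<le> ennreal M" using g(2) unfolding nn_integral_weak_derivative_unique[OF g(1) W] .
      then show False using m(2) M by simp
    qed
  qed
qed

end
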